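(* Let $\varepsilon>0$ be an arbitrarily small constant and let $G\in\mathcal G(n,r,2)$ with $r\ge(1+\varepsilon)r_c$. Then a.a.s. $\tau_{cov}(G)=\Theta(n\log n)$.
   Context: Random geometric graph: for integers $d,n\ge1$ and real $r>0$ (possibly depending on $n$), $\mathcal G(n,r,d)$ is the random graph whose vertex set is a Poisson point process of intensity $1$ on $\Lambda_n=[-n^{1/d}/2,\,n^{1/d}/2]^d$, two vertices being adjacent iff their Euclidean distance is at most $r$. $V_d$ is the volume of the unit ball in $\mathbb R^d$ and $r_c=(\log n/V_d)^{1/d}$ (so for $d=2$, $r_c^2=\log n/\pi$). An event holds a.a.s. if its probability tends to $1$ as $n\to\infty$. For a finite connected graph $H=(V,E)$, $\tau_{cov}(H)=\max_{v\in V}\mathbb E_v[\min\{t\ge0:\{X_0,\dots,X_t\}=V\}]$ for simple random walk $(X_t)$ on $H$ started at $v$ (a.a.s. $G$ is connected in this regime). *)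

theory Defs
  imports "HOL-Probability.Probability"
begin

definition Lambda2 :: "nat \<Rightarrow> (real^2) set" where
  "Lambda2 n = cbox (\<chi> i. - sqrt (real n) / 2) (\<chi> i. sqrt (real n) / 2)"

text \<open>Connectivity threshold radius for d = 2: r_c^2 = log n / pi.\<close>
definition r_c2 :: "nat \<Rightarrow> real" where
  "r_c2 n = sqrt (ln (real n) / pi)"

text \<open>Poisson point process of intensity 1 on \<Lambda>_n, realised as: N ~ Poisson(n) (= Poisson(area)),
  and independently an i.i.d. sequence of uniform points x_0, x_1, ... in \<Lambda>_n;
  the process consists of the points x_0, ..., x_(N-1).\<close>
definition PPP2 :: "nat \<Rightarrow> (nat \<times> (nat \<Rightarrow> real^2)) measure" where
  "PPP2 n = measure_pmf (poisson_pmf (real n))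
            \<Otimes>\<^sub>M (\<Pi>\<^sub>M i\<in>(UNIV::nat set). uniform_measure lborel (Lambda2 n))"

definition rgg_adj :: "real \<Rightarrow> (nat \<Rightarrow> real^2) \<Rightarrow> nat \<Rightarrow> nat \<Rightarrow> bool" where
  "rgg_adj r x i j \<longleftrightarrow> i \<noteq> j \<and> dist (x i) (x j) \<le> r"

definition srw_step :: "nat \<Rightarrow> (nat \<Rightarrow> nat \<Rightarrow> bool) \<Rightarrow> nat \<Rightarrow> nat pmf" where
  "srw_step N adj u =
     (let nb = {w. w < N \<and> adj u w} in if nb = {} then return_pmf u else pmf_of_set nb)"

fun srw_path :: "nat \<Rightarrow> (nat \<Rightarrow> nat \<Rightarrow> bool) \<Rightarrow> nat \<Rightarrow> nat \<Rightarrow> nat list pmf" where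
  "srw_path N adj v 0 = return_pmf [v]"
| "srw_path N adj v (Suc t) =
     bind_pmf (srw_path N adj v t) (\<lambda>p. map_pmf (\<lambda>w. p @ [w]) (srw_step N adj (last p)))"

text \<open>E_v[T_cov] where T_cov = min{t : {X_0..X_t} = V}; written via the tail-sum formula
  E[T] = sum_{t>=0} P(T > t), and P(T > t) = P({X_0,...,X_t} \<noteq> V).
  Value in ennreal (infinite if the graph is not connected).\<close>
definition exp_cover_time :: "nat \<Rightarrow> (nat \<Rightarrow> nat \<Rightarrow> bool) \<Rightarrow> nat \<Rightarrow> ennreal" where
  "exp_cover_time N adj v =
     (\<Sum>t. ennreal (measure_pmf.prob (srw_path N adj v t) {p. set p \<noteq> {..<N}}))"

definition cover_time :: "nat \<Rightarrow> (nat \<Rightarrow> nat \<Rightarrow> bool) \<Rightarrow> ennreal" where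
  "cover_time N adj = (SUP v\<in>{..<N}. exp_cover_time N adj v)"

definition rgg_cover_time :: "real \<Rightarrow> nat \<times> (nat \<Rightarrow> real^2) \<Rightarrow> ennreal" where
  "rgg_cover_time r \<omega> = cover_time (fst \<omega>) (rgg_adj r (snd \<omega>))"

end

theory Submission
  imports Defs "HOL-Real_Asymp.Real_Asymp"
begin

text \<open>
  The cover time is squeezed by Matthews' method, whose only inputs are bounds on hitting times.
  These follow from effective resistances: if \<open>(f u - f v)\<^sup>2 \<le> E * dirichlet f\<close> for all \<open>f\<close>, then
  all hitting times are at most \<open>2 * E * vol\<close>; conversely commute times are at least
  \<open>vol / deg\<close>, which yields linearly many vertices that are pairwise hard to hit.

  Resistances in the geometric graph are of the order of one over the typical degree. Cut the
  square into \<open>M * M\<close> cells whose side is a small multiple of the radius. With high probability the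
  sparsely occupied cells near any given cell have total area below that of a disc (half disc at
  a side, quarter disc at a corner) of the connection radius. Hence every window contains full rows
  and columns of dense cells, and every vertex is joined to them through dense cells: a
  component missing them would have such discs of sparse cells at its extreme cells.
  Averaging a function over dense cells thus compares its energy to that of a function on the
  \<open>M * M\<close> grid, whose resistance is only logarithmic in \<open>M\<close>.
\<close>

section \<open>Cover times and effective resistance\<close>

text \<open>The obstacle is the sharp constant in the radius. Near the threshold a cell expects only
  a small multiple of \<open>ln n\<close> points, so it is sparse with probability a small negative
  power of \<open>n\<close>: single sparse cells cannot be excluded, only large clusters. At most
  \<open>n\<close> cells lie in the interior, order \<open>sqrt n\<close> near a side and boundedly
  many near a corner. A cluster as large as the disc, half disc or quarter disc available there has
  probability of order \<open>\<beta>^4\<close>, \<open>\<beta>^2\<close> or \<open>\<beta>\<close>,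
  up to constants, with \<open>\<beta>\<close> at most \<open>n\<close> to the power
  \<open>-(1 + \<epsilon>) / 4\<close>; all three expected numbers vanish.

  The second point is the size of the resistance. Let \<open>k\<close> be a fixed fraction of the
  mean cell occupancy. A vertex is tied to a dense cell by at least \<open>k\<close> edges, at cost
  of order \<open>1 / k\<close>. Two close dense cells are joined by \<open>k^2\<close> edges, so
  the whole grid costs only \<open>ln M / k^2\<close>. Since \<open>k\<close> is at least a constant
  times \<open>ln n\<close>, this is again of order \<open>1 / k\<close>, which cancels against
  degrees of order \<open>k\<close>: hitting times are linear in \<open>N\<close>. For radii beyond
  a small multiple of \<open>sqrt n\<close> the number of cells stays bounded, and the same argument
  covers all denser graphs.\<close>

lemma srw_path_nonempty: "p \<in> set_pmf (srw_path N adj v t) \<Longrightarrow> p \<noteq> []"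
  by (induction t arbitrary: p) auto

text \<open>Paths are defined by appending a last step. First-step analysis needs the first step
  split off instead.\<close>

lemma srw_path_Suc_front:
  "srw_path N adj v (Suc t) =
     bind_pmf (srw_step N adj v) (\<lambda>w. map_pmf (Cons v) (srw_path N adj w t))"
proof (induction t)
  case 0
  show ?case by (simp add: bind_return_pmf map_pmf_def)
next
  case (Suc t)
  define G where "G p = map_pmf (\<lambda>w. p @ [w]) (srw_step N adj (last p))" for p
  have "srw_path N adj v (Suc (Suc t)) = bind_pmf (srw_path N adj v (Suc t)) G"
    unfolding G_def by (subst srw_path.simps(2)) simp
  also have "\<dots> = bind_pmf (srw_step N adj v) (\<lambda>w. bind_pmf (srw_path N adj w t) (\<lambda>q. G (v # q)))"
    unfolding Suc.IH by (simp add: bind_assoc_pmf bind_map_pmf)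
  also have "\<dots> = bind_pmf (srw_step N adj v)
      (\<lambda>w. bind_pmf (srw_path N adj w t) (\<lambda>q. map_pmf (Cons v) (G q)))"
    by (intro bind_pmf_cong refl) (auto simp: G_def map_pmf_comp dest: srw_path_nonempty)
  also have "\<dots> = bind_pmf (srw_step N adj v) (\<lambda>w. map_pmf (Cons v) (srw_path N adj w (Suc t)))"
    by (simp add: map_bind_pmf G_def)
  finally show ?case .
qed

lemma srw_step_subset: "u < N \<Longrightarrow> set_pmf (srw_step N adj u) \<subseteq> {..<N}"
  by (auto simp: srw_step_def Let_def)

lemma srw_path_last: "v < N \<Longrightarrow> p \<in> set_pmf (srw_path N adj v t) \<Longrightarrow> last p < N"
proof (induction t arbitrary: p)
  case (Suc t)
  from Suc.prems(2) obtain q w where q: "q \<in> set_pmf (srw_path N adj v t)" "p = q @ [w]"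
      "w \<in> set_pmf (srw_step N adj (last q))" by auto
  then show ?case using Suc.IH[OF Suc.prems(1) q(1)] srw_step_subset[of "last q" N adj] by auto
qed simp

lemma srw_path_subset: "v < N \<Longrightarrow> p \<in> set_pmf (srw_path N adj v t) \<Longrightarrow> set p \<subseteq> {..<N}"
proof (induction t arbitrary: p)
  case (Suc t)
  from Suc.prems(2) obtain q w where q: "q \<in> set_pmf (srw_path N adj v t)" "p = q @ [w]"
      "w \<in> set_pmf (srw_step N adj (last q))" by auto
  then show ?case using Suc.IH[OF Suc.prems(1) q(1)] srw_path_last[OF Suc.prems(1) q(1)]
     srw_step_subset[of "last q" N adj] by auto
qed simp

lemma finite_set_srw_path: "finite (set_pmf (srw_path N adj v t))"
proof (induction t)
  case (Suc t)
  have "finite (set_pmf (srw_step N adj u))" for u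
  proof (cases "{w. w < N \<and> adj u w} = {}")
    case False
    then show ?thesis unfolding srw_step_def Let_def by (subst if_not_P) auto
  qed (simp add: srw_step_def)
  then show ?case using Suc by simp
qed simp

text \<open>Needed for measurability: with the number of vertices fixed, the cover time is a
  function of a relation on a finite set.\<close>

lemma cover_time_cong:
  assumes "\<And>u w. u < N \<Longrightarrow> w < N \<Longrightarrow> adj u w = adj' u w"
  shows "cover_time N adj = cover_time N adj'"
proof -
  have step: "srw_step N adj u = srw_step N adj' u" if "u < N" for u
  proof -
    have "{w. w < N \<and> adj u w} = {w. w < N \<and> adj' u w}" using assms that by auto
    then show ?thesis by (simp add: srw_step_def)
  qed
  have path: "srw_path N adj v t = srw_path N adj' v t" if "v < N" for v t
  proof (induction t)
    case (Suc t)
    show ?case unfolding srw_path.simps Suc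
      by (intro bind_pmf_cong refl) (simp add: step srw_path_last[OF that])
  qed simp
  show ?thesis unfolding cover_time_def exp_cover_time_def by (simp add: path)
qed

section \<open>Laplacian, Dirichlet form and first-step recursions\<close>

definition nbs :: "nat \<Rightarrow> (nat \<Rightarrow> nat \<Rightarrow> bool) \<Rightarrow> nat \<Rightarrow> nat set" where
  "nbs N adj u = {w. w < N \<and> adj u w}"

lemma finite_nbs [simp]: "finite (nbs N adj u)" by (simp add: nbs_def)

lemma Suc_harm_Suc: "real (Suc j) * harm (Suc j) = real (Suc j) * harm j + 1"
  by (simp add: harm_Suc distrib_left del: of_nat_Suc)

text \<open>The sum runs over ordered pairs, so for symmetric \<open>adj\<close> every edge counts
  twice. This is the origin of the halves in \<open>sum_lap\<close> and
  \<open>sum_lap_CS\<close>.\<close>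

definition dirichlet :: "nat \<Rightarrow> (nat \<Rightarrow> nat \<Rightarrow> bool) \<Rightarrow> (nat \<Rightarrow> real) \<Rightarrow> real" where
  "dirichlet N adj f = (\<Sum>x<N. \<Sum>y\<in>nbs N adj x. (f x - f y)\<^sup>2)"

lemma dirichlet_nonneg: "0 \<le> dirichlet N adj f"
  unfolding dirichlet_def by (intro sum_nonneg) auto

text \<open>\<open>nbs_ne\<close> excludes the vertices at which \<open>srw_step\<close> stays put.
  Connectedness is not assumed here; it comes with the resistance bound of
  \<open>resist_graph\<close>.\<close>

locale walk_graph =
  fixes N :: nat and adj :: "nat \<Rightarrow> nat \<Rightarrow> bool"
  assumes adj_sym: "\<And>u w. u < N \<Longrightarrow> w < N \<Longrightarrow> adj u w = adj w u"
    and nbs_ne: "\<And>u. u < N \<Longrightarrow> nbs N adj u \<noteq> {}"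
begin

abbreviation nb where "nb \<equiv> nbs N adj"

definition deg :: "nat \<Rightarrow> real" where "deg u = real (card (nb u))"

definition avg :: "(nat \<Rightarrow> real) \<Rightarrow> nat \<Rightarrow> real" where
  "avg f u = (\<Sum>w\<in>nb u. f w) / deg u"

definition lap :: "(nat \<Rightarrow> real) \<Rightarrow> nat \<Rightarrow> real" where
  "lap f u = (\<Sum>w\<in>nb u. f u - f w)"

abbreviation dir where "dir \<equiv> dirichlet N adj"

definition vol :: real where "vol = (\<Sum>x<N. deg x)"

lemma deg_pos: "u < N \<Longrightarrow> 0 < deg u"
  using nbs_ne by (simp add: deg_def card_gt_0_iff)

lemma nb_lt: "w \<in> nb u \<Longrightarrow> w < N" by (simp add: nbs_def)

lemma deg_avg: "u < N \<Longrightarrow> deg u * avg f u = (\<Sum>w\<in>nb u. f w)"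
  using deg_pos[of u] by (simp add: avg_def)

lemma lap_avg: "u < N \<Longrightarrow> lap f u = deg u * (f u - avg f u)"
  by (simp add: lap_def sum_subtractf deg_def[symmetric] right_diff_distrib deg_avg)

lemma avg_mono: "(\<And>w. w < N \<Longrightarrow> f w \<le> g w) \<Longrightarrow> avg f u \<le> avg g u"
  unfolding avg_def deg_def by (intro divide_right_mono sum_mono) (auto simp: nb_lt)

lemma avg_const: "u < N \<Longrightarrow> avg (\<lambda>_. c) u = c"
  using nbs_ne[of u] by (simp add: avg_def deg_def)

lemma avg_sum: "avg (\<lambda>w. \<Sum>i\<in>I. f i w) u = (\<Sum>i\<in>I. avg (f i) u)"
  unfolding avg_def by (subst sum.swap) (simp add: sum_divide_distrib)

lemma avg_cmult: "avg (\<lambda>w. c * f w) u = c * avg f u"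
  unfolding avg_def by (simp add: sum_distrib_left)

lemma avg_diff: "avg (\<lambda>w. f w - g w) u = avg f u - avg g u"
  unfolding avg_def by (simp add: sum_subtractf diff_divide_distrib)

lemma sum_nb: "(\<Sum>x<N. \<Sum>y\<in>nb x. a x y) = (\<Sum>x<N. \<Sum>y<N. if adj x y then a x y else (0::real))"
proof (rule sum.cong[OF refl])
  fix x
  have "nb x = {y \<in> {..<N}. adj x y}" by (auto simp: nbs_def)
  then show "(\<Sum>y\<in>nb x. a x y) = (\<Sum>y<N. if adj x y then a x y else 0)"
    using sum.inter_filter[of "{..<N}" "a x" "adj x"] by simp
qed

lemma sum_nb_swap: "(\<Sum>x<N. \<Sum>y\<in>nb x. a x y) = (\<Sum>x<N. \<Sum>y\<in>nb x. (a y x::real))"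
  unfolding sum_nb by (subst sum.swap) (auto simp: adj_sym intro!: sum.cong)

text \<open>Green's formula: symmetrise the sum by exchanging the ends of each edge. It makes
  \<open>lap\<close> self-adjoint for the counting measure and identifies its quadratic form with
  half of \<open>dir\<close>.\<close>

lemma sum_lap:
  "(\<Sum>x<N. f x * lap g x) = (\<Sum>x<N. \<Sum>y\<in>nb x. (f x - f y) * (g x - g y)) / 2"
proof -
  have "(\<Sum>x<N. \<Sum>y\<in>nb x. (f x - f y) * (g x - g y)) =
        (\<Sum>x<N. \<Sum>y\<in>nb x. f x * (g x - g y)) + (\<Sum>x<N. \<Sum>y\<in>nb x. f y * (g y - g x))"
    by (simp add: sum.distrib[symmetric] algebra_simps)
  also have "(\<Sum>x<N. \<Sum>y\<in>nb x. f y * (g y - g x)) = (\<Sum>x<N. \<Sum>y\<in>nb x. f x * (g x - g y))"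
    by (rule sum_nb_swap)
  moreover have "(\<Sum>x<N. f x * lap g x) = (\<Sum>x<N. \<Sum>y\<in>nb x. f x * (g x - g y))"
    by (simp add: lap_def sum_distrib_left)
  ultimately show ?thesis by linarith
qed

lemma sum_lap_dir: "(\<Sum>x<N. f x * lap f x) = dir f / 2"
  by (simp add: sum_lap dirichlet_def power2_eq_square)

lemma sum_lap_swap: "(\<Sum>x<N. f x * lap g x) = (\<Sum>x<N. g x * lap f x)"
  by (simp add: sum_lap mult.commute)

lemma sum_lap_eq_0: "(\<Sum>x<N. lap g x) = 0"
  using sum_lap[of "\<lambda>_. 1" g] by simp

lemma sum_lap_CS: "(\<Sum>x<N. f x * lap g x)\<^sup>2 \<le> (dir f / 2) * (dir g / 2)"
proof -
  let ?S = "Sigma {..<N} nb"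
  have "(\<Sum>p\<in>?S. (f (fst p) - f (snd p)) * (g (fst p) - g (snd p)))\<^sup>2
     \<le> (\<Sum>p\<in>?S. (f (fst p) - f (snd p))\<^sup>2) * (\<Sum>p\<in>?S. (g (fst p) - g (snd p))\<^sup>2)"
    by (rule Cauchy_Schwarz_ineq_sum)
  then show ?thesis
    by (simp add: sum_lap dirichlet_def sum.Sigma case_prod_unfold power_divide)
qed

text \<open>The probability that the walk started at \<open>u\<close> has not covered \<open>B\<close> by time \<open>t\<close>.\<close>
fun unc :: "nat \<Rightarrow> nat set \<Rightarrow> nat \<Rightarrow> real" where
  "unc 0 B u = of_bool (\<not> B \<subseteq> {u})"
| "unc (Suc t) B u = (if B \<subseteq> {u} then 0 else avg (unc t (B - {u})) u)"

lemma unc_empty [simp]: "unc t {} u = 0"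
  by (cases t) auto

text \<open>First-step analysis: once the start \<open>v\<close> is peeled off, the rest of the path
  has to visit \<open>B - {v}\<close>. From here on only the recursion \<open>unc\<close> is used
  and no probability.\<close>

lemma prob_srw_path:
  assumes "v < N"
  shows "measure_pmf.prob (srw_path N adj v t) {p. \<not> B \<subseteq> set p} = unc t B v"
  using assms
proof (induction t arbitrary: B v)
  case 0
  have "measure_pmf.prob (return_pmf [v]) {p. \<not> B \<subseteq> set p} = indicator {p. \<not> B \<subseteq> set p} [v]"
    by (rule measure_return_pmf)
  then show ?case by (simp add: indicator_def)
next
  case (Suc t)
  have step: "srw_step N adj v = pmf_of_set (nb v)"
    unfolding srw_step_def Let_def nbs_def[symmetric] using nbs_ne[OF Suc.prems]
    by (simp only: if_False)
  have pre: "{p. \<not> B \<subseteq> insert v (set p)} = {p. \<not> B - {v} \<subseteq> set p}" by auto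
  have "measure_pmf.prob (srw_path N adj v (Suc t)) {p. \<not> B \<subseteq> set p} =
      measure_pmf.expectation (srw_path N adj v (Suc t)) (indicat_real {p. \<not> B \<subseteq> set p})"
    by simp
  also have "\<dots> = (\<Sum>w\<in>nb v. measure_pmf.expectation (map_pmf (Cons v) (srw_path N adj w t))
                      (indicat_real {p. \<not> B \<subseteq> set p}) /\<^sub>R card (nb v))"
    unfolding srw_path_Suc_front step
    by (rule pmf_expectation_bind_pmf_of_set)
       (use nbs_ne[OF Suc.prems] in \<open>auto simp: finite_set_srw_path\<close>)
  also have "\<dots> = (\<Sum>w\<in>nb v. unc t (B - {v}) w / deg v)"
    by (intro sum.cong refl)
       (simp del: integral_map_pmf add: pre Suc.IH nb_lt deg_def divide_inverse_commute)
  also have "\<dots> = avg (unc t (B - {v})) v" by (simp add: avg_def sum_divide_distrib)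
  also have "\<dots> = unc (Suc t) B v"
  proof (cases "B \<subseteq> {v}")
    case True
    then have "B - {v} = {}" by auto
    then show ?thesis using True by (simp only: unc.simps unc_empty if_True) (simp add: avg_def)
  qed simp
  finally show ?case .
qed

lemma exp_cover_time_unc:
  assumes "v < N"
  shows "exp_cover_time N adj v = (\<Sum>t. ennreal (unc t {..<N} v))"
proof -
  have "measure_pmf.prob (srw_path N adj v t) {p. set p \<noteq> {..<N}} =
        measure_pmf.prob (srw_path N adj v t) {p. \<not> {..<N} \<subseteq> set p}" for t
    by (rule measure_pmf.finite_measure_eq_AE)
       (use srw_path_subset[OF assms, of _ adj t] in \<open>auto simp: AE_measure_pmf_iff\<close>)
  then show ?thesis using assms by (simp add: exp_cover_time_def prob_srw_path)
qed

lemma unc_nonneg: "0 \<le> unc t B u"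
  by (induction t arbitrary: B u) (auto simp: avg_def deg_def intro!: divide_nonneg_nonneg sum_nonneg)

text \<open>If \<open>B\<close> is not yet covered, some point of \<open>B\<close> is missed. This
  transfers summability from hitting a point to covering a set.\<close>

lemma unc_union_bound:
  assumes "finite B" shows "unc t B u \<le> (\<Sum>v\<in>B. unc t {v} u)"
  using assms
proof (induction t arbitrary: B u)
  case 0
  show ?case
  proof (cases "B \<subseteq> {u}")
    case False
    then obtain v where v: "v \<in> B" "v \<noteq> u" by auto
    have "unc 0 {v} u \<le> (\<Sum>v\<in>B. unc 0 {v} u)"
      by (rule member_le_sum) (use v 0 in auto)
    then show ?thesis using False v by simp
  qed (simp add: sum_nonneg)
next
  case (Suc t)
  show ?case
  proof (cases "B \<subseteq> {u}")
    case True
    then show ?thesis using unc_nonneg[of "Suc t"] by (auto intro!: sum_nonneg)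
  next
    case False
    have "unc (Suc t) B u \<le> avg (\<lambda>w. \<Sum>v\<in>B-{u}. unc t {v} w) u"
      using False Suc by (auto intro!: avg_mono)
    also have "\<dots> = (\<Sum>v\<in>B-{u}. unc (Suc t) {v} u)"
      unfolding avg_sum by (intro sum.cong) auto
    also have "\<dots> \<le> (\<Sum>v\<in>B. unc (Suc t) {v} u)"
      by (rule sum_mono2) (use Suc.prems unc_nonneg[of "Suc t"] in auto)
    finally show ?thesis .
  qed
qed

lemma unc_mono: "A \<subseteq> B \<Longrightarrow> unc t A u \<le> unc t B u"
proof (induction t arbitrary: A B u)
  case 0
  then show ?case by (auto split: if_splits)
next
  case (Suc t)
  show ?case
  proof (cases "A \<subseteq> {u}")
    case True
    then show ?thesis using unc_nonneg[of "Suc t" B u] by simp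
  next
    case False
    then have "\<not> B \<subseteq> {u}" using Suc.prems by auto
    moreover have "avg (unc t (A - {u})) u \<le> avg (unc t (B - {u})) u"
      by (intro avg_mono Suc.IH) (use Suc.prems in auto)
    ultimately show ?thesis using False by simp
  qed
qed

end

section \<open>Hitting times and Matthews' method under a resistance bound\<close>

locale resist_graph = walk_graph +
  fixes E :: real
  assumes E_pos: "0 < E"
    and resist: "\<And>f u v. u < N \<Longrightarrow> v < N \<Longrightarrow> (f u - f v)\<^sup>2 \<le> E * dir f"
begin

text \<open>A commute time is \<open>vol\<close> times the effective resistance. As
  \<open>dir\<close> counts edges twice, \<open>E\<close> bounds half of that resistance, whence the
  factor 2.\<close>

definition hmax :: real where "hmax = 2 * E * vol"

text \<open>Truncating the hitting time keeps it a subsolution of the hitting time equation; pairing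
  it with its Laplacian and using the resistance bound gives a self-improving estimate.\<close>
lemma hitting_sum_bound:
  assumes "u < N" "v < N"
  shows "(\<Sum>t<T. unc t {v} u) \<le> hmax"
proof -
  define f where "f T u = (\<Sum>t<T. unc t {v} u)" for T u
  have f0: "0 \<le> f T u" for T u unfolding f_def by (intro sum_nonneg) (simp add: unc_nonneg)
  have fv: "f T v = 0" for T
  proof -
    have "unc t {v} v = 0" for t by (cases t) auto
    then show ?thesis by (simp add: f_def)
  qed
  have step: "f (Suc T) x = 1 + avg (f T) x" if "x < N" "x \<noteq> v" for T x
    unfolding f_def using that
    by (subst sum.lessThan_Suc_shift) (simp add: avg_sum Diff_insert0)
  \<comment> \<open>Monotonicity in \<open>T\<close> turns the recursion between two time horizons
    into an inequality for \<open>f T\<close> alone.\<close>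
  have mono: "f T x \<le> f (Suc T) x" for x
    unfolding f_def by (simp add: unc_nonneg)
  have lap: "lap (f T) x \<le> deg x" if "x < N" "x \<noteq> v" for x
  proof -
    have "f T x - avg (f T) x \<le> 1" using mono[of x] step[OF that, of T] by simp
    then have "deg x * (f T x - avg (f T) x) \<le> deg x * 1"
      by (intro mult_left_mono) (use deg_pos[OF that(1)] in auto)
    then show ?thesis using lap_avg[OF that(1)] by simp
  qed
  define m where "m = Max (f T ` {..<N})"
  have ne: "f T ` {..<N} \<noteq> {}" using assms by auto
  have le_m: "f T x \<le> m" if "x < N" for x unfolding m_def using that by (intro Max_ge) auto
  have "m \<in> f T ` {..<N}" unfolding m_def by (rule Max_in) (use ne in auto)
  then obtain w where w: "w < N" "m = f T w" by auto
  have "dir (f T) / 2 = (\<Sum>x<N. f T x * lap (f T) x)" by (simp add: sum_lap_dir)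
  also have "\<dots> \<le> (\<Sum>x<N. m * deg x)"
  proof (rule sum_mono)
    fix x assume x: "x \<in> {..<N}"
    show "f T x * lap (f T) x \<le> m * deg x"
    proof (cases "x = v")
      case True
      then show ?thesis using fv le_m[of v] assms deg_pos[of v] x by auto
    next
      case False
      have "f T x * lap (f T) x \<le> f T x * deg x"
        using lap[of x] False x f0 by (intro mult_left_mono) auto
      also have "\<dots> \<le> m * deg x"
        using le_m[of x] deg_pos[of x] x by (intro mult_right_mono) auto
      finally show ?thesis .
    qed
  qed
  also have "\<dots> = m * vol" by (simp add: vol_def sum_distrib_left)
  finally have d: "dir (f T) \<le> 2 * m * vol" by simp
  have "m\<^sup>2 \<le> E * dir (f T)" using resist[of w v "f T"] w assms fv by simp
  also have "\<dots> \<le> E * (2 * m * vol)" using d E_pos by (intro mult_left_mono) auto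
  finally have "m * m \<le> m * hmax" by (simp add: power2_eq_square hmax_def algebra_simps)
  moreover have "0 \<le> m" using w f0 by simp
  moreover have "0 \<le> hmax"
    unfolding hmax_def vol_def using E_pos by (auto simp: deg_def intro!: mult_nonneg_nonneg sum_nonneg)
  ultimately have "m \<le> hmax" by (cases "m = 0") auto
  then show ?thesis using le_m[OF assms(1)] unfolding f_def by linarith
qed

lemma summable_unc1: "u < N \<Longrightarrow> v < N \<Longrightarrow> summable (\<lambda>t. unc t {v} u)"
  by (rule summableI_nonneg_bounded[where x = hmax])
     (simp_all add: unc_nonneg hitting_sum_bound)

lemma summable_unc: 
  assumes "u < N" "B \<subseteq> {..<N}" shows "summable (\<lambda>t. unc t B u)"
proof -
  have fin: "finite B" using assms finite_subset by auto
  have "summable (\<lambda>t. \<Sum>v\<in>B. unc t {v} u)"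
    by (intro summable_sum summable_unc1) (use assms in auto)
  then show ?thesis
    by (rule summable_comparison_test')
       (use unc_nonneg unc_union_bound[OF fin] in \<open>auto simp: unc_nonneg\<close>)
qed

text \<open>For a singleton this is an expected hitting time: \<open>cov {v} u\<close> is the mean
  time to reach \<open>v\<close> from \<open>u\<close>.\<close>

definition cov :: "nat set \<Rightarrow> nat \<Rightarrow> real" where "cov B u = (\<Sum>t. unc t B u)"

lemma exp_cover_time_cov:
  assumes "v < N" shows "exp_cover_time N adj v = ennreal (cov {..<N} v)"
  unfolding exp_cover_time_unc[OF assms] cov_def
  by (rule suminf_ennreal2) (auto simp: unc_nonneg summable_unc assms)

lemma cov_mono: "u < N \<Longrightarrow> A \<subseteq> B \<Longrightarrow> B \<subseteq> {..<N} \<Longrightarrow> cov A u \<le> cov B u"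
  unfolding cov_def by (intro suminf_le unc_mono summable_unc) auto

lemma cov_trivial: "B \<subseteq> {u} \<Longrightarrow> cov B u = 0"
proof -
  assume B: "B \<subseteq> {u}"
  have "unc t B u = 0" for t using B by (cases t) auto
  then show ?thesis by (simp add: cov_def)
qed

lemma cov_step:
  assumes u: "u < N" and B: "B \<subseteq> {..<N}" "\<not> B \<subseteq> {u}"
  shows "cov B u = 1 + avg (cov (B - {u})) u"
proof -
  have s: "summable (\<lambda>t. unc t B u)" using summable_unc u B by auto
  have "cov B u = (\<Sum>t. unc (Suc t) B u) + unc 0 B u"
    unfolding cov_def using suminf_split_initial_segment[OF s, of 1] by simp
  also have "(\<Sum>t. unc (Suc t) B u) = (\<Sum>t. avg (unc t (B - {u})) u)" using B by simp
  also have "\<dots> = (\<Sum>t. (\<Sum>w\<in>nb u. unc t (B - {u}) w) / deg u)" by (simp add: avg_def)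
  also have "\<dots> = (\<Sum>t. \<Sum>w\<in>nb u. unc t (B - {u}) w) / deg u"
    by (intro suminf_divide summable_sum summable_unc) (use B nb_lt in auto)
  also have "(\<Sum>t. \<Sum>w\<in>nb u. unc t (B - {u}) w) = (\<Sum>w\<in>nb u. cov (B - {u}) w)"
    unfolding cov_def by (rule suminf_sum) (use B nb_lt in \<open>auto intro!: summable_unc\<close>)
  finally show ?thesis using B by (simp add: avg_def)
qed

lemma cov_remove:
  assumes u: "u < N" and B: "B \<subseteq> {..<N}"
  shows "cov (B - {u}) u = cov B u"
proof (cases "B \<subseteq> {u}")
  case True
  then show ?thesis using cov_trivial[of "B - {u}" u] cov_trivial[of B u] by auto
next
  case False
  then have "\<not> B - {u} \<subseteq> {u}" "B - {u} - {u} = B - {u}" by auto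
  then show ?thesis using cov_step[OF u B False] cov_step[OF u, of "B - {u}"] B by auto
qed

text \<open>Minimum principle for functions superharmonic off \<open>B\<close>. Iterating the mean
  value inequality bounds the deficit \<open>a - g x\<close> by a constant \<open>F\<close> times
  the probability of not having hit \<open>b\<close> by time \<open>t\<close>. That probability
  tends to 0 because hitting times have finite mean, so no argument about connected components is
  required.\<close>

lemma min_principle:
  assumes b: "b < N" "u < N"
    and bd: "\<And>x. x \<in> B \<Longrightarrow> x < N \<Longrightarrow> a \<le> g x" "b \<in> B"
    and har: "\<And>x. x < N \<Longrightarrow> x \<notin> B \<Longrightarrow> avg g x \<le> g x"
  shows "a \<le> g u"
proof -
  define F where "F = (\<Sum>x<N. \<bar>a - g x\<bar>)"
  have F: "a - g x \<le> F" if "x < N" for x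
    using member_le_sum[of x "{..<N}" "\<lambda>x. \<bar>a - g x\<bar>"] that unfolding F_def by auto
  have F0: "0 \<le> F" by (simp add: F_def sum_nonneg)
  have *: "a - g x \<le> F * unc t {b} x" if "x < N" for x t using that
  proof (induction t arbitrary: x)
    case 0
    then show ?case using F[of x] bd by (cases "x = b") auto
  next
    case (Suc t)
    show ?case
    proof (cases "x \<in> B")
      case True
      have "a - g x \<le> 0" using bd True Suc.prems by auto
      also have "0 \<le> F * unc (Suc t) {b} x" using F0 unc_nonneg[of "Suc t" "{b}" x] by (intro mult_nonneg_nonneg)
      finally show ?thesis .
    next
      case False
      then have "x \<noteq> b" using bd by auto
      have "a - g x \<le> a - avg g x" using har Suc.prems False by auto
      also have "\<dots> = avg (\<lambda>w. a - g w) x" by (simp add: avg_diff avg_const Suc.prems)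
      also have "\<dots> \<le> avg (\<lambda>w. F * unc t {b} w) x" by (rule avg_mono) (use Suc.IH in auto)
      also have "\<dots> = F * unc (Suc t) {b} x" using \<open>x \<noteq> b\<close> by (simp add: avg_cmult Diff_insert0)
      finally show ?thesis .
    qed
  qed
  have "(\<lambda>t. F * unc t {b} u) \<longlonglongrightarrow> F * 0"
    by (intro tendsto_mult tendsto_const summable_LIMSEQ_zero summable_unc1 b)
  then have "a - g u \<le> F * 0"
    by (rule LIMSEQ_le_const) (use * b in auto)
  then show ?thesis by simp
qed

text \<open>Summed over \<open>w\<close>, the extra cost of covering \<open>w\<close> last; it is harmonic off \<open>B\<close>, which is
  what makes both directions of Matthews' method a plain induction.\<close>
definition incr :: "nat set \<Rightarrow> nat \<Rightarrow> real" where
  "incr B u = (\<Sum>w\<in>B. cov B u - cov (B - {w}) u)"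

text \<open>Off \<open>B\<close> both \<open>cov B\<close> and \<open>cov (B - {w})\<close> satisfy
  the recursion with source 1, and the sources cancel. This needs \<open>B - {w}\<close> nonempty,
  hence two points in \<open>B\<close>.\<close>

lemma incr_harmonic:
  assumes "u < N" "B \<subseteq> {..<N}" "u \<notin> B" "2 \<le> card B"
  shows "incr B u = avg (incr B) u"
proof -
  have 1: "cov B u = 1 + avg (cov B) u"
    using cov_step[of u B] assms by (cases "B = {}") auto
  have 2: "cov (B - {w}) u = 1 + avg (cov (B - {w})) u" if "w \<in> B" for w
  proof -
    have "B - {w} \<noteq> {}"
    proof
      assume "B - {w} = {}"
      then have "B \<subseteq> {w}" by auto
      then have "card B \<le> card {w}" by (intro card_mono) auto
      then show False using assms by simp
    qed
    then have "\<not> B - {w} \<subseteq> {u}" "B - {w} - {u} = B - {w}" using assms(3) by auto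
    then show ?thesis using cov_step[of u "B - {w}"] assms by auto
  qed
  have "avg (incr B) u = (\<Sum>w\<in>B. avg (\<lambda>x. cov B x - cov (B - {w}) x) u)"
    unfolding incr_def by (rule avg_sum)
  then show ?thesis unfolding incr_def by (simp add: avg_diff 1 2)
qed

text \<open>A walk started in \<open>B\<close> has already covered its start, so the boundary values
  of \<open>incr B\<close> are values of \<open>incr\<close> for a smaller set. This drives the
  inductions on \<open>card B\<close>.\<close>

lemma incr_boundary:
  assumes "u \<in> B" "B \<subseteq> {..<N}"
  shows "incr B u = incr (B - {u}) u"
proof -
  have fin: "finite B" and u: "u < N" using assms finite_subset by auto
  have "incr B u = (cov B u - cov (B - {u}) u) + (\<Sum>w\<in>B - {u}. cov B u - cov (B - {w}) u)"
    unfolding incr_def by (rule sum.remove) (use fin assms in auto)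
  also have "cov B u - cov (B - {u}) u = 0" using cov_remove[OF u assms(2)] by simp
  also have "(\<Sum>w\<in>B - {u}. cov B u - cov (B - {w}) u) =
     (\<Sum>w\<in>B - {u}. cov (B - {u}) u - cov (B - {u} - {w}) u)"
  proof (rule sum.cong)
    fix w assume "w \<in> B - {u}"
    have "B - {u} - {w} = B - {w} - {u}" by auto
    then show "cov B u - cov (B - {w}) u = cov (B - {u}) u - cov (B - {u} - {w}) u"
      using cov_remove[OF u assms(2)] cov_remove[OF u, of "B - {w}"] assms(2)
      by (metis Diff_subset order_trans)
  qed simp
  finally show ?thesis by (simp add: incr_def)
qed

lemma incr_single: "u \<noteq> w \<Longrightarrow> incr {w} u = cov {w} u"
  by (simp add: incr_def cov_def)

text \<open>By the minimum principle it suffices to look at starts in \<open>B\<close>, where one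
  point drops out. The induction ends at two points, where \<open>incr\<close> is a hitting time
  between distinct points of \<open>A\<close>; a singleton would not do, as the walk may start on
  it.\<close>

lemma incr_lower:
  assumes "A \<subseteq> {..<N}" "\<And>x y. x \<in> A \<Longrightarrow> y \<in> A \<Longrightarrow> x \<noteq> y \<Longrightarrow> h \<le> cov {y} x"
    and "B \<subseteq> A" "2 \<le> card B" "u < N"
  shows "h \<le> incr B u"
  using assms(3-)
proof (induction "card B" arbitrary: B u rule: less_induct)
  case less
  have fin: "finite B" using less assms(1) finite_subset[of B "{..<N}"] by auto
  have BN: "B \<subseteq> {..<N}" using less assms by auto
  have bd: "h \<le> incr B x" if "x \<in> B" for x
  proof (cases "card B = 2")
    case True
    then have "card (B - {x}) = 1" using that fin by simp
    then obtain y where y: "B - {x} = {y}" by (rule card_1_singletonE)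
    then have yy: "y \<in> B - {x}" by simp
    have "x \<noteq> y" using yy by auto
    then have "incr {y} x = cov {y} x" by (rule incr_single)
    then have "incr B x = cov {y} x" using incr_boundary[OF that BN] unfolding y by simp
    then show ?thesis using assms(2)[of x y] that less.prems(1) yy by auto
  next
    case False
    have "h \<le> incr (B - {x}) x"
      by (rule less.hyps) (use that fin less.prems False BN in \<open>auto simp: card_Diff1_less\<close>)
    then show ?thesis using incr_boundary[OF that BN] by simp
  qed
  have "B \<noteq> {}" using less.prems by auto
  then obtain b where b: "b \<in> B" by auto
  show ?case
    by (rule min_principle[of b u B]) (use b bd BN less.prems incr_harmonic in auto)
qed

text \<open>The same induction for \<open>- incr B\<close>. It can go down to a singleton, since
  hitting times are bounded by \<open>hmax\<close> from every start.\<close>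

lemma incr_upper:
  assumes "B \<subseteq> {..<N}" "1 \<le> card B" "u < N"
  shows "incr B u \<le> hmax"
  using assms
proof (induction "card B" arbitrary: B u rule: less_induct)
  case less
  have hit: "cov {y} x \<le> hmax" if "x < N" "y < N" for x y
    unfolding cov_def by (rule suminf_le_const) (use summable_unc1 hitting_sum_bound that in auto)
  have hm0: "0 \<le> hmax" using hitting_sum_bound[OF less.prems(3) less.prems(3), of 0] by simp
  have fin: "finite B" using less finite_subset[of B "{..<N}"] by auto
  show ?case
  proof (cases "card B = 1")
    case True
    then obtain y where y: "B = {y}" by (rule card_1_singletonE)
    show ?thesis
    proof (cases "u = y")
      case True
      then show ?thesis using y hm0 cov_trivial[of "{y}" y] cov_trivial[of "{}" y] by (simp add: incr_def)
    next
      case False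
      then show ?thesis using y incr_single[of u y] hit less.prems by auto
    qed
  next
    case False
    have bd: "incr B x \<le> hmax" if "x \<in> B" for x
    proof -
      have "incr (B - {x}) x \<le> hmax"
        by (rule less.hyps) (use that fin less.prems False in \<open>auto simp: card_Diff1_less\<close>)
      then show ?thesis using incr_boundary[OF that less.prems(1)] by simp
    qed
    have "B \<noteq> {}" using less.prems by auto
    then obtain b where b: "b \<in> B" by auto
    have avgm: "avg (\<lambda>x. - incr B x) x = - avg (incr B) x" for x
      using avg_cmult[of "-1" "incr B" x] by simp
    have "- hmax \<le> - incr B u"
      by (rule min_principle[of b u B])
         (use b bd less.prems False incr_harmonic[of _ B] avgm in auto)
    then show ?thesis by simp
  qed
qed

text \<open>After division by \<open>card B\<close>: covering \<open>B\<close> costs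
  \<open>incr B / card B\<close> more than covering \<open>B\<close> without one point, on average
  over that point. Iterating gives the harmonic sum.\<close>

lemma cov_incr:
  assumes "finite B" shows "card B * cov B u = incr B u + (\<Sum>w\<in>B. cov (B - {w}) u)"
  by (simp add: incr_def sum_subtractf)

text \<open>Passing from \<open>j - 1\<close> to \<open>j\<close> points adds at least
  \<open>h / j\<close> for each \<open>j\<close> from 2 on. A single point may cost nothing, because
  the walk can start there, which explains the \<open>- 1\<close>.\<close>

theorem matthews_lower:
  assumes "A \<subseteq> {..<N}" "\<And>x y. x \<in> A \<Longrightarrow> y \<in> A \<Longrightarrow> x \<noteq> y \<Longrightarrow> h \<le> cov {y} x"
    and "B \<subseteq> A" "1 \<le> card B" "u < N"
  shows "h * (harm (card B) - 1) \<le> cov B u"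
  using assms(3-)
proof (induction "card B" arbitrary: B rule: less_induct)
  case less
  have fin: "finite B" using less assms(1) finite_subset[of B "{..<N}"] by auto
  show ?case
  proof (cases "card B = 1")
    case True
    have "0 \<le> cov B u" unfolding cov_def
      by (rule suminf_nonneg) (use less.prems assms unc_nonneg in \<open>auto intro!: summable_unc\<close>)
    then show ?thesis using True by (simp add: harm_def)
  next
    case False
    define j where "j = card B - 1"
    have j: "card B = Suc j" "1 \<le> j" using less.prems False by (auto simp: j_def)
    have "h \<le> incr B u" using incr_lower[OF assms(1,2)] less.prems False by auto
    moreover have "h * (harm j - 1) \<le> cov (B - {w}) u" if "w \<in> B" for w

    proof -
      have "card (B - {w}) = j" using that fin j by simp
      then show ?thesis using less.hyps[of "B - {w}"] j less.prems by auto
    qed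
    then have "(\<Sum>w\<in>B. h * (harm j - 1)) \<le> (\<Sum>w\<in>B. cov (B - {w}) u)" by (rule sum_mono)
    ultimately have "h + card B * (h * (harm j - 1)) \<le> card B * cov B u"
      using cov_incr[OF fin, of u] by simp
    moreover have "real (Suc j) * (h * (harm (Suc j) - 1))
        = h * (real (Suc j) * harm (Suc j)) - real (Suc j) * h"
      by (simp add: right_diff_distrib mult.left_commute)
    ultimately have "real (Suc j) * (h * (harm (Suc j) - 1)) \<le> real (Suc j) * cov B u"
      unfolding j(1) Suc_harm_Suc by (simp add: algebra_simps)
    then show ?thesis unfolding j(1) by (subst (asm) mult_le_cancel_left_pos) auto
  qed
qed

theorem matthews_upper:
  assumes "B \<subseteq> {..<N}" "u < N"
  shows "cov B u \<le> hmax * harm (card B)"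
  using assms
proof (induction "card B" arbitrary: B)
  case 0
  then have "B = {}" using finite_subset[of B "{..<N}"] by auto
  then show ?case by (simp add: cov_trivial harm_def)
next
  case (Suc j)
  have fin: "finite B" using Suc finite_subset[of B "{..<N}"] by auto
  have "cov (B - {w}) u \<le> hmax * harm j" if "w \<in> B" for w
    
  proof -
    have "j = card (B - {w})" using Suc.hyps(2) that fin by simp
    then show ?thesis using Suc.hyps(1)[of "B - {w}"] Suc.prems by auto
  qed
  then have "(\<Sum>w\<in>B. cov (B - {w}) u) \<le> (\<Sum>w\<in>B. hmax * harm j)" by (rule sum_mono)
  moreover have "incr B u \<le> hmax" using incr_upper[of B u] Suc by auto
  ultimately have "card B * cov B u \<le> hmax + card B * (hmax * harm j)"
    using cov_incr[OF fin, of u] by simp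
  moreover have "real (Suc j) * (hmax * harm (Suc j)) = hmax * (real (Suc j) * harm (Suc j))"
    by (simp add: mult.left_commute)
  ultimately have "real (Suc j) * cov B u \<le> real (Suc j) * (hmax * harm (Suc j))"
    unfolding Suc.hyps(2)[symmetric] Suc_harm_Suc by (simp add: algebra_simps)
  then show ?case unfolding Suc.hyps(2)[symmetric] by (subst (asm) mult_le_cancel_left_pos) auto
qed

text \<open>Away from \<open>v\<close> this is the hitting time equation. The value at
  \<open>v\<close> is forced by the vanishing total of the Laplacian; it is Kac's formula for the
  mean return time, \<open>vol / deg v\<close>.\<close>

lemma lap_cov1:
  assumes "v < N" "x < N"
  shows "lap (cov {v}) x = deg x - vol * of_bool (x = v)"
proof -
  have 1: "lap (cov {v}) x = deg x" if "x < N" "x \<noteq> v" for x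
    using cov_step[of x "{v}"] that assms by (simp add: lap_avg Diff_insert0)
  have "0 = (\<Sum>x<N. lap (cov {v}) x)" by (simp add: sum_lap_eq_0)
  also have "\<dots> = lap (cov {v}) v + (\<Sum>x\<in>{..<N} - {v}. lap (cov {v}) x)"
    by (rule sum.remove) (use assms in auto)
  also have "(\<Sum>x\<in>{..<N} - {v}. lap (cov {v}) x) = (\<Sum>x\<in>{..<N} - {v}. deg x)"
    by (intro sum.cong) (use 1 in auto)
  also have "\<dots> = vol - deg v"
    unfolding vol_def using sum.remove[of "{..<N}" v deg] assms by simp
  finally show ?thesis using 1 assms by (cases "x = v") auto
qed

text \<open>The mean time to hit \<open>v\<close> from the stationary distribution, which is
  proportional to \<open>deg\<close>.\<close>

definition alpha :: "nat \<Rightarrow> real" where "alpha v = (\<Sum>x<N. deg x * cov {v} x) / vol"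

lemma vol_pos: "0 < N \<Longrightarrow> 0 < vol"
  unfolding vol_def by (intro sum_pos) (auto simp: deg_pos)

text \<open>Pair the two hitting time functions with each other's Laplacian and use
  self-adjointness: the asymmetry of hitting times is the difference of a function of one
  vertex.\<close>

lemma hit_diff:
  assumes "u < N" "v < N"
  shows "cov {v} u - cov {u} v = alpha v - alpha u"
proof -
  have "(\<Sum>x<N. cov {v} x * lap (cov {u}) x) = (\<Sum>x<N. deg x * cov {v} x) - vol * cov {v} u"
    if "u < N" "v < N" for u v
  proof -
    have "(\<Sum>x<N. cov {v} x * lap (cov {u}) x)
        = (\<Sum>x<N. deg x * cov {v} x - (if x = u then vol * cov {v} x else 0))"
      by (intro sum.cong) (auto simp: lap_cov1 that algebra_simps)
    then show ?thesis using that by (simp add: sum_subtractf)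
  qed
  from this[OF assms] this[OF assms(2,1)] sum_lap_swap[of "cov {v}" "cov {u}"]
  have "vol * (cov {v} u - cov {u} v) = (\<Sum>x<N. deg x * cov {v} x) - (\<Sum>x<N. deg x * cov {u} x)"
    unfolding right_diff_distrib by linarith
  moreover have "0 < vol" using vol_pos assms by auto
  ultimately show ?thesis by (simp add: alpha_def diff_divide_distrib[symmetric] eq_divide_eq mult.commute)
qed

text \<open>The effective resistance from \<open>u\<close> is at least \<open>1 / deg u\<close>,
  with the indicator of \<open>u\<close> as test function. The function \<open>g\<close> is, up to
  the factor \<open>vol\<close>, the potential of a unit current between \<open>u\<close> and
  \<open>v\<close>.\<close>

lemma commute_lower:
  assumes "u < N" "v < N" "u \<noteq> v"
  shows "vol \<le> deg u * (cov {v} u + cov {u} v)"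
proof -
  define \<delta> where "\<delta> x = (of_bool (x = u) :: real)" for x :: nat
  define g where "g x = cov {v} x - cov {u} x" for x
  have lapg: "lap g x = vol * of_bool (x = u) - vol * of_bool (x = v)" if "x < N" for x
  proof -
    have "lap g x = lap (cov {v}) x - lap (cov {u}) x"
      unfolding lap_def g_def by (simp add: sum_subtractf right_diff_distrib)
    then show ?thesis using lap_cov1 assms that by simp
  qed
  have pick: "(\<Sum>x<N. f x * lap g x) = vol * (f u - f v)" for f
  proof -
    have "(\<Sum>x<N. f x * lap g x) = (\<Sum>x<N. (if x = u then vol * f x else 0) - (if x = v then vol * f x else 0))"
      by (intro sum.cong) (auto simp: lapg)
    then show ?thesis using assms by (simp add: sum_subtractf right_diff_distrib)
  qed
  \<comment> \<open>The commute time identity: the energy of this potential is \<open>vol\<close>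
    times the commute time.\<close>
  have "dir g / 2 = vol * (g u - g v)" using pick[of g] by (simp add: sum_lap_dir)
  also have "g u - g v = cov {v} u + cov {u} v"
    by (simp add: g_def cov_trivial)
  finally have dg: "dir g / 2 = vol * (cov {v} u + cov {u} v)" .
  have "dir \<delta> / 2 = (\<Sum>x<N. if x = u then lap \<delta> x else 0)"
    unfolding sum_lap_dir[symmetric] by (intro sum.cong) (auto simp: \<delta>_def)
  also have "\<dots> = lap \<delta> u" using assms by simp
  also have "\<dots> \<le> (\<Sum>w\<in>nb u. 1)" unfolding lap_def by (intro sum_mono) (simp add: \<delta>_def)
  finally have dd: "dir \<delta> / 2 \<le> deg u" by (simp add: deg_def)
  have "vol\<^sup>2 \<le> (dir \<delta> / 2) * (dir g / 2)"
    using sum_lap_CS[of \<delta> g] pick[of \<delta>] assms by (simp add: \<delta>_def)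
  also have "\<dots> \<le> deg u * (dir g / 2)"
    using dd dirichlet_nonneg[of N adj g] by (intro mult_right_mono) auto
  finally have "vol * vol \<le> vol * (deg u * (cov {v} u + cov {u} v))"
    by (simp add: dg power2_eq_square algebra_simps)
  moreover have "0 < vol" using vol_pos assms by auto
  ultimately show ?thesis by simp
qed

lemma alpha_bounds: "v < N \<Longrightarrow> 0 \<le> alpha v" "v < N \<Longrightarrow> alpha v \<le> hmax"
proof -
  assume v: "v < N"
  have vp: "0 < vol" using vol_pos v by auto
  have c: "0 \<le> cov {v} x" "cov {v} x \<le> hmax" if "x < N" for x
    unfolding cov_def
    by (rule suminf_nonneg[OF summable_unc1[OF that v] unc_nonneg],
        rule suminf_le_const[OF summable_unc1[OF that v] hitting_sum_bound[OF that v]])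
  show "0 \<le> alpha v" unfolding alpha_def
    by (rule divide_nonneg_pos[OF sum_nonneg vp])
       (auto intro!: mult_nonneg_nonneg c(1) simp: deg_def)
  have "(\<Sum>x<N. deg x * cov {v} x) \<le> (\<Sum>x<N. deg x * hmax)"
    by (intro sum_mono mult_left_mono c(2)) (auto simp: deg_def)
  also have "\<dots> = vol * hmax" by (simp add: vol_def sum_distrib_right)
  finally show "alpha v \<le> hmax" unfolding alpha_def using vp by (simp add: field_simps)
qed

text \<open>Hitting times between vertices of equal \<open>alpha\<close> are half the commute time, so bucketing
  low-degree vertices by \<open>alpha\<close> leaves a linear-size set that is hard to hit from within.\<close>
lemma spread_set:
  fixes C :: real
  assumes N: "0 < N" and C: "hmax \<le> C * N"
  obtains A where "A \<subseteq> {..<N}" "N / (8 * C + 2) \<le> card A"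
    "\<And>x y. x \<in> A \<Longrightarrow> y \<in> A \<Longrightarrow> x \<noteq> y \<Longrightarrow> N / 8 \<le> cov {y} x"
proof -
  have vp: "0 < vol" using vol_pos N by auto
  have "0 \<le> hmax" using alpha_bounds[of 0] N by linarith
  with C have "0 \<le> C * N" by linarith
  then have C0: "0 \<le> C" using N by (simp add: zero_le_mult_iff)
  define A0 where "A0 = {u. u < N \<and> deg u \<le> 2 * vol / N}"
  have A0: "finite A0" "A0 \<subseteq> {..<N}" by (auto simp: A0_def)
  \<comment> \<open>Markov's inequality: at most half of the vertices have more than twice the
    average degree.\<close>
  have half: "N / 2 \<le> card A0"
  proof -
    have "(N - card A0) * (2 * vol / N) = (\<Sum>x\<in>{..<N} - A0. 2 * vol / N)"
      using A0 by (simp add: card_Diff_subset of_nat_diff card_mono[of "{..<N}" A0, simplified])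
    also have "\<dots> \<le> (\<Sum>x\<in>{..<N} - A0. deg x)" by (intro sum_mono) (auto simp: A0_def)
    also have "\<dots> \<le> vol" unfolding vol_def
      by (intro sum_mono2) (auto simp: deg_def)
    finally have "(real N - card A0) * (2 * vol) \<le> vol * N"
      using N A0 card_mono[of "{..<N}" A0] by (simp add: field_simps of_nat_diff)
    then have "vol * (2 * (real N - card A0)) \<le> vol * N" by (simp add: algebra_simps)
    then show ?thesis using vp by (subst (asm) mult_le_cancel_left_pos) auto
  qed
  \<comment> \<open>Buckets of width \<open>N / 4\<close>. As \<open>alpha\<close> lies between 0
    and \<open>C * N\<close>, at most \<open>4 * C + 1\<close> of them occur, and the fullest one
    holds at least \<open>(N / 2) / (4 * C + 1)\<close> vertices of \<open>A0\<close>.\<close>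
  define b where "b v = nat \<lfloor>alpha v / (N / 4)\<rfloor>" for v
  define K where "K = nat \<lfloor>4 * C\<rfloor>"
  have bK: "b v \<le> K" if "v \<in> A0" for v
  proof -
    have "alpha v \<le> C * N" using alpha_bounds(2)[of v] that A0 C by force
    then have "alpha v / (N / 4) \<le> 4 * C" using N by (simp add: field_simps)
    then show ?thesis unfolding b_def K_def by (intro nat_mono floor_mono)
  qed
  have "\<exists>k\<le>K. card A0 \<le> card {v\<in>A0. b v = k} * (K + 1)"
  proof (rule ccontr)
    assume *: "\<not> ?thesis"
    have "card A0 = card (\<Union>k\<le>K. {v\<in>A0. b v = k})"
      by (rule arg_cong[of _ _ card]) (use bK in auto)
    also have "\<dots> = (\<Sum>k\<le>K. card {v\<in>A0. b v = k})"
      by (rule card_UN_disjoint) (use A0 in auto)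
    finally have "card A0 * (K + 1) = (\<Sum>k\<le>K. card {v\<in>A0. b v = k} * (K + 1))"
      by (simp only: sum_distrib_right)
    also have "\<dots> < (\<Sum>k\<le>K. card A0)"
    proof (rule sum_strict_mono)
      fix k assume "k \<in> {..K}"
      then show "card {v\<in>A0. b v = k} * (K + 1) < card A0" using * by (meson atMost_iff not_le)
    qed auto
    finally show False by simp
  qed
  then obtain k where k: "card A0 \<le> card {v\<in>A0. b v = k} * (K + 1)" by auto
  define A where "A = {v\<in>A0. b v = k}"
  show ?thesis
  proof
    show "A \<subseteq> {..<N}" using A0 by (auto simp: A_def)
    have "real (K + 1) \<le> 4 * C + 1" using C0 by (simp add: K_def)
    then have "card A * real (K + 1) \<le> card A * (4 * C + 1)" by (intro mult_left_mono) auto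
    moreover have "real (card A0) \<le> card A * real (K + 1)"
      using k unfolding A_def of_nat_mult[symmetric] of_nat_le_iff .
    ultimately have "N / 2 \<le> card A * (4 * C + 1)" using half by linarith
    then show "N / (8 * C + 2) \<le> card A" using C0 by (simp add: field_simps)
    fix x y assume xy: "x \<in> A" "y \<in> A" "x \<noteq> y"
    then have xN: "x < N" "y < N" using A0 by (auto simp: A_def)
    have "\<lfloor>alpha x / (N / 4)\<rfloor> = \<lfloor>alpha y / (N / 4)\<rfloor>"
      using xy alpha_bounds(1)[OF xN(1)] alpha_bounds(1)[OF xN(2)]
      by (auto simp: A_def b_def nat_eq_iff)
    then have "alpha x / (N / 4) - alpha y / (N / 4) < 1" by linarith
    then have "alpha x - alpha y < N / 4" using N by (simp add: field_simps)
    then have 1: "cov {x} y - cov {y} x < N / 4" using hit_diff[of y x] xN by simp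
    have "0 < deg x * (cov {y} x + cov {x} y)"
      using commute_lower[OF xN xy(3)] vp by linarith
    then have "0 < cov {y} x + cov {x} y" by (rule zero_less_mult_pos) (rule deg_pos[OF xN(1)])
    then have "deg x * (cov {y} x + cov {x} y) \<le> (2 * vol / N) * (cov {y} x + cov {x} y)"
      using xy by (intro mult_right_mono) (auto simp: A_def A0_def)
    then have "vol \<le> (2 * vol / N) * (cov {y} x + cov {x} y)"
      using commute_lower[OF xN xy(3)] by linarith
    then have "vol * N \<le> vol * (2 * (cov {y} x + cov {x} y))"
      using N by (simp add: field_simps)
    \<comment> \<open>The two hitting times add up to at least \<open>N / 2\<close> and differ by
      less than \<open>N / 4\<close> in this direction, so the one wanted is at least
      \<open>N / 8\<close>.\<close>
    then have "N \<le> 2 * (cov {y} x + cov {x} y)" using vp by (subst (asm) mult_le_cancel_left_pos) auto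
    then show "N / 8 \<le> cov {y} x" using 1 by simp
  qed
qed

theorem cover_time_bounds:
  fixes C :: real
  assumes N: "0 < N" and C: "hmax \<le> C * N"
  shows "ennreal (N / 8 * (ln (N / (8 * C + 2)) - 1)) \<le> cover_time N adj"
    and "cover_time N adj \<le> ennreal (C * N * harm N)"
proof -
  obtain A where A: "A \<subseteq> {..<N}" "N / (8 * C + 2) \<le> card A"
    "\<And>x y. x \<in> A \<Longrightarrow> y \<in> A \<Longrightarrow> x \<noteq> y \<Longrightarrow> N / 8 \<le> cov {y} x"
    using spread_set[OF assms] by blast
  have "0 \<le> hmax" using alpha_bounds[of 0] N by linarith
  with C have "0 \<le> C * N" by linarith
  then have C0: "0 \<le> C" using N by (simp add: zero_le_mult_iff)
  have "0 < N / (8 * C + 2)" using N C0 by (intro divide_pos_pos) auto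
  then have cA: "0 < card A" using A(2) by linarith
  have "ln (N / (8 * C + 2)) \<le> ln (real (card A) + 1)"
    using A(2) N C0 by (intro ln_mono) auto
  also have "\<dots> \<le> harm (card A)" by (rule ln_le_harm)
  finally have "N / 8 * (ln (N / (8 * C + 2)) - 1) \<le> N / 8 * (harm (card A) - 1)"
    by (intro mult_left_mono) auto
  also have "\<dots> \<le> cov A 0" using matthews_lower[OF A(1,3), of A 0] cA N by auto
  also have "\<dots> \<le> cov {..<N} 0" using cov_mono A N by auto
  finally have "ennreal (N / 8 * (ln (N / (8 * C + 2)) - 1)) \<le> exp_cover_time N adj 0"
    using N by (simp add: exp_cover_time_cov ennreal_leI)
  also have "\<dots> \<le> cover_time N adj"
    unfolding cover_time_def by (rule SUP_upper) (use N in auto)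
  finally show "ennreal (N / 8 * (ln (N / (8 * C + 2)) - 1)) \<le> cover_time N adj" .
  show "cover_time N adj \<le> ennreal (C * N * harm N)"
    unfolding cover_time_def
  proof (rule SUP_least)
    fix v assume "v \<in> {..<N}"
    then have "cov {..<N} v \<le> hmax * harm N" using matthews_upper[of "{..<N}" v] by simp
    also have "\<dots> \<le> C * N * harm N" using C by (intro mult_right_mono harm_nonneg)
    finally show "exp_cover_time N adj v \<le> ennreal (C * N * harm N)"
      using \<open>v \<in> {..<N}\<close> by (simp add: exp_cover_time_cov ennreal_leI)
  qed
qed

end
text \<open>The indicator of an isolated vertex has energy 0 but differs at any second vertex, so
  the resistance bound already excludes isolated vertices.\<close>

lemma resist_graphI:
  assumes sym: "\<And>u w. u < N \<Longrightarrow> w < N \<Longrightarrow> adj u w = adj w u"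
    and N: "2 \<le> N" and E: "0 < E"
    and res: "\<And>f u v. u < N \<Longrightarrow> v < N \<Longrightarrow> (f u - f v)\<^sup>2 \<le> E * dirichlet N adj f"
  shows "resist_graph N adj E"
proof
  fix u assume u: "u < N"
  show "nbs N adj u \<noteq> {}"
  proof
    assume e: "nbs N adj u = {}"
    obtain v where v: "v < N" "v \<noteq> u"
    proof (cases "u = 0")
      case True
      then show ?thesis using that[of 1] N by simp
    next
      case False
      then show ?thesis using that[of 0] N by simp
    qed
    define f where "f x = (of_bool (x = u) :: real)" for x
    have "f x = f y" if "x < N" "y \<in> nbs N adj x" for x y
      using that e u sym[of x y] by (auto simp: f_def nbs_def)
    then have "dirichlet N adj f = 0" by (simp add: dirichlet_def)
    then show False using res[OF u v(1), of f] v by (simp add: f_def)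
  qed
qed (use assms in auto)

section \<open>Resistance of the square grid\<close>

text \<open>Unlike in \<open>dirichlet\<close>, every edge is counted once.\<close>

definition gridE :: "nat \<Rightarrow> (nat \<Rightarrow> nat \<Rightarrow> real) \<Rightarrow> real" where
  "gridE M f = (\<Sum>i<M - 1. \<Sum>j<M. (f i j - f (Suc i) j)\<^sup>2) +
               (\<Sum>i<M. \<Sum>j<M - 1. (f i j - f i (Suc j))\<^sup>2)"

lemma gridE_nonneg: "0 \<le> gridE M f"
  unfolding gridE_def by (intro add_nonneg_nonneg sum_nonneg) auto

lemma gridE_transpose: "gridE M (\<lambda>i j. f j i) = gridE M f"
  unfolding gridE_def
  by (subst sum.swap, subst (2) sum.swap) simp

lemma gridE_reflect1: "gridE (Suc L) (\<lambda>i j. f (L - i) j) = gridE (Suc L) f"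
proof -
  have "(\<Sum>i<L. \<Sum>j<Suc L. (f (L - i) j - f (L - Suc i) j)\<^sup>2)
      = (\<Sum>i<L. (\<lambda>i. \<Sum>j<Suc L. (f i j - f (Suc i) j)\<^sup>2) (L - Suc i))"
    by (intro sum.cong refl) (simp add: Suc_diff_Suc power2_commute)
  also have "\<dots> = (\<Sum>i<L. \<Sum>j<Suc L. (f i j - f (Suc i) j)\<^sup>2)"
    by (rule sum.nat_diff_reindex)
  moreover have "(\<Sum>i<Suc L. \<Sum>j<L. (f (L - i) j - f (L - i) (Suc j))\<^sup>2)
      = (\<Sum>i<Suc L. \<Sum>j<L. (f i j - f i (Suc j))\<^sup>2)"
    using sum.nat_diff_reindex[of "\<lambda>i. \<Sum>j<L. (f i j - f i (Suc j))\<^sup>2" "Suc L"] by simp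
  ultimately show ?thesis unfolding gridE_def by simp
qed

lemma gridE_reflect2: "gridE (Suc L) (\<lambda>i j. f i (L - j)) = gridE (Suc L) f"
  using gridE_reflect1[of L "\<lambda>i j. f j i"] gridE_transpose[of "Suc L" f]
    gridE_transpose[of "Suc L" "\<lambda>i j. f j (L - i)"] by simp

lemma sum_shift_le:
  fixes h :: "nat \<Rightarrow> real"
  assumes "\<And>i. 0 \<le> h i" "x + a \<le> A"
  shows "(\<Sum>i<a. h (x + i)) \<le> (\<Sum>i<A. h i)"
proof -
  have "(\<Sum>i<a. h (x + i)) = sum h ((+) x ` {..<a})" by (simp add: sum.reindex)
  also have "\<dots> \<le> (\<Sum>i<A. h i)" by (rule sum_mono2) (use assms in auto)
  finally show ?thesis .
qed

lemma gridE_sub: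
  assumes "x + L < M" "y + L < M"
  shows "gridE (Suc L) (\<lambda>i j. f (x + i) (y + j)) \<le> gridE M f"
proof -
  have 2: "(\<Sum>i<a. \<Sum>j<b. g (x + i) (y + j)) \<le> (\<Sum>i<A. \<Sum>j<B. g i j)"
    if "\<And>i j. 0 \<le> g i j" "x + a \<le> A" "y + b \<le> B" for g :: "nat \<Rightarrow> nat \<Rightarrow> real" and a b A B
  proof -
    have "(\<Sum>i<a. \<Sum>j<b. g (x + i) (y + j)) \<le> (\<Sum>i<a. \<Sum>j<B. g (x + i) j)"
      by (intro sum_mono sum_shift_le that)
    also have "\<dots> \<le> (\<Sum>i<A. \<Sum>j<B. g i j)"
      by (intro sum_shift_le sum_nonneg that)
    finally show ?thesis .
  qed
  have "(\<Sum>i<L. \<Sum>j<Suc L. (f (x + i) (y + j) - f (Suc (x + i)) (y + j))\<^sup>2)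
      \<le> (\<Sum>i<M - 1. \<Sum>j<M. (f i j - f (Suc i) j)\<^sup>2)"
    by (rule 2[of "\<lambda>i j. (f i j - f (Suc i) j)\<^sup>2"]) (use assms in auto)
  moreover have "(\<Sum>i<Suc L. \<Sum>j<L. (f (x + i) (y + j) - f (x + i) (Suc (y + j)))\<^sup>2)
      \<le> (\<Sum>i<M. \<Sum>j<M - 1. (f i j - f i (Suc j))\<^sup>2)"
    by (rule 2[of "\<lambda>i j. (f i j - f i (Suc j))\<^sup>2"]) (use assms in auto)
  ultimately have "(\<Sum>i<L. \<Sum>j<Suc L. (f (x + i) (y + j) - f (Suc (x + i)) (y + j))\<^sup>2) +
      (\<Sum>i<Suc L. \<Sum>j<L. (f (x + i) (y + j) - f (x + i) (Suc (y + j)))\<^sup>2) \<le> gridE M f"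
    unfolding gridE_def by (rule add_mono)
  then show ?thesis unfolding gridE_def by (simp only: add_Suc_right diff_Suc_1)
qed

definition adiag :: "(nat \<Rightarrow> nat \<Rightarrow> real) \<Rightarrow> nat \<Rightarrow> real" where
  "adiag f l = (\<Sum>i\<le>l. f i (l - i)) / real (l + 1)"

text \<open>The flow of Polya's urn: it carries the uniform distribution on one antidiagonal to the
  uniform distribution on the next.\<close>
lemma adiag_diff:
  "adiag f l - adiag f (Suc l) =
    ((\<Sum>i\<le>l. real (i + 1) * (f i (l - i) - f (Suc i) (l - i))) +
     (\<Sum>i\<le>l. real (l - i + 1) * (f i (l - i) - f i (Suc (l - i))))) / (real (l + 1) * real (l + 2))"
proof -
  define S where "S = (\<Sum>i\<le>l. f i (l - i))"
  define G where "G k = f k (Suc l - k)" for k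
  have a: "(\<Sum>i\<le>l. real (i + 1) * f i (l - i)) + (\<Sum>i\<le>l. real (l - i + 1) * f i (l - i)) = real (l + 2) * S"
    unfolding S_def sum_distrib_left sum.distrib[symmetric]
    by (intro sum.cong refl) (simp add: of_nat_diff algebra_simps)
  have b: "(\<Sum>i\<le>l. real (i + 1) * f (Suc i) (l - i)) = (\<Sum>k\<le>Suc l. real k * G k)"
    by (subst sum.atMost_Suc_shift) (simp add: G_def)
  have c: "(\<Sum>i\<le>l. real (l - i + 1) * f i (Suc (l - i))) = (\<Sum>k\<le>Suc l. real (Suc l - k) * G k)"
  proof -
    have "(\<Sum>i\<le>l. real (l - i + 1) * f i (Suc (l - i))) = (\<Sum>k\<le>l. real (Suc l - k) * G k)"
      by (intro sum.cong refl) (simp add: G_def Suc_diff_le)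
    then show ?thesis by simp
  qed
  have d: "(\<Sum>k\<le>Suc l. real k * G k) + (\<Sum>k\<le>Suc l. real (Suc l - k) * G k) = real (l + 1) * (\<Sum>k\<le>Suc l. G k)"
    unfolding sum_distrib_left sum.distrib[symmetric]
    by (intro sum.cong refl) (simp add: of_nat_diff algebra_simps)
  have "(\<Sum>i\<le>l. real (i + 1) * (f i (l - i) - f (Suc i) (l - i))) +
     (\<Sum>i\<le>l. real (l - i + 1) * (f i (l - i) - f i (Suc (l - i)))) =
     real (l + 2) * S - real (l + 1) * (\<Sum>k\<le>Suc l. G k)"
    using a b c d by (simp add: right_diff_distrib sum_subtractf)
  then show ?thesis
    unfolding adiag_def S_def[symmetric] G_def[symmetric]
    by (simp add: field_simps)
qed

definition adiagE :: "(nat \<Rightarrow> nat \<Rightarrow> real) \<Rightarrow> nat \<Rightarrow> real" where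
  "adiagE f l = (\<Sum>i\<le>l. (f i (l - i) - f (Suc i) (l - i))\<^sup>2) + (\<Sum>i\<le>l. (f i (l - i) - f i (Suc (l - i)))\<^sup>2)"

lemma weighted_sum_sq:
  fixes x a :: "nat \<Rightarrow> real"
  assumes "\<And>i. i \<le> l \<Longrightarrow> \<bar>a i\<bar> \<le> real (l + 1)"
  shows "(\<Sum>i\<le>l. a i * x i)\<^sup>2 \<le> real (l + 1) ^ 3 * (\<Sum>i\<le>l. (x i)\<^sup>2)"
proof -
  have "(\<Sum>i\<le>l. a i * x i)\<^sup>2 \<le> (\<Sum>i\<le>l. (a i)\<^sup>2) * (\<Sum>i\<le>l. (x i)\<^sup>2)"
    by (rule Cauchy_Schwarz_ineq_sum)
  also have "(\<Sum>i\<le>l. (a i)\<^sup>2) \<le> (\<Sum>i\<le>l. (real (l + 1))\<^sup>2)"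
    by (intro sum_mono) (use assms in \<open>auto simp: abs_le_square_iff[symmetric]\<close>)
  also have "\<dots> = real (l + 1) ^ 3" by (simp add: power3_eq_cube power2_eq_square)
  finally show ?thesis by (simp add: mult_right_mono sum_nonneg)
qed

text \<open>The flow between the two antidiagonals uses \<open>2 * (l + 1)\<close> edges with
  weights at most \<open>1 / (l + 2)\<close>, so its energy is of order \<open>1 / (l + 1)\<close>.
  Summing over \<open>l\<close> is the source of the logarithm.\<close>

lemma adiag_step: "real (l + 1) * (adiag f l - adiag f (Suc l))\<^sup>2 \<le> 2 * adiagE f l"
proof -
  define X where "X = (\<Sum>i\<le>l. real (i + 1) * (f i (l - i) - f (Suc i) (l - i)))"
  define Y where "Y = (\<Sum>i\<le>l. real (l - i + 1) * (f i (l - i) - f i (Suc (l - i))))"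
  have "X\<^sup>2 \<le> real (l + 1) ^ 3 * (\<Sum>i\<le>l. (f i (l - i) - f (Suc i) (l - i))\<^sup>2)"
    unfolding X_def by (rule weighted_sum_sq) simp
  moreover have "Y\<^sup>2 \<le> real (l + 1) ^ 3 * (\<Sum>i\<le>l. (f i (l - i) - f i (Suc (l - i)))\<^sup>2)"
    unfolding Y_def by (rule weighted_sum_sq) simp
  moreover have "(X + Y)\<^sup>2 \<le> 2 * X\<^sup>2 + 2 * Y\<^sup>2"
    using sum_squares_bound[of X Y] by (simp add: power2_sum)
  ultimately have "(X + Y)\<^sup>2 \<le> 2 * real (l + 1) ^ 3 * adiagE f l"
    unfolding adiagE_def by (simp add: distrib_left)
  then have 1: "real (l + 1) * (X + Y)\<^sup>2 \<le> real (l + 1) * (2 * real (l + 1) ^ 3 * adiagE f l)"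
    by (intro mult_left_mono) auto
  have e: "0 \<le> adiagE f l" unfolding adiagE_def by (intro add_nonneg_nonneg sum_nonneg) auto
  have "real (l + 1) * (2 * real (l + 1) ^ 3 * adiagE f l) = (real (l + 1) * real (l + 1))\<^sup>2 * (2 * adiagE f l)"
    by (simp add: power2_eq_square power3_eq_cube)
  also have "\<dots> \<le> (real (l + 1) * real (l + 2))\<^sup>2 * (2 * adiagE f l)"
    by (intro mult_right_mono power_mono mult_left_mono) (use e in auto)
  finally have "real (l + 1) * (X + Y)\<^sup>2 \<le> (real (l + 1) * real (l + 2))\<^sup>2 * (2 * adiagE f l)"
    using 1 by linarith
  then show ?thesis
    unfolding adiag_diff X_def[symmetric] Y_def[symmetric] power_divide
    by (simp add: divide_le_eq mult.commute)
qed

text \<open>Different \<open>l\<close> use disjoint sets of edges, all inside the grid.\<close>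

lemma sum_adiagE: "(\<Sum>l<L. adiagE f l) \<le> gridE (Suc L) f"
proof -
  have tri: "(\<Sum>l<L. \<Sum>i\<le>l. g i (l - i)) \<le> (\<Sum>i<a. \<Sum>j<b. g i j)"
    if "\<And>i j. 0 \<le> g i j" "L \<le> a" "L \<le> b" for g :: "nat \<Rightarrow> nat \<Rightarrow> real" and a b
  proof -
    have "(\<Sum>l<L. \<Sum>i\<le>l. g i (l - i)) = (\<Sum>(i,j)\<in>{(i,j). i + j < L}. g i j)"
      by (simp add: sum.triangle_reindex)
    also have "\<dots> \<le> (\<Sum>(i,j)\<in>{..<a} \<times> {..<b}. g i j)"
      by (rule sum_mono2) (use that in auto)
    finally show ?thesis by (simp add: sum.cartesian_product)
  qed
  show ?thesis
    using tri[of "\<lambda>i j. (f i j - f (Suc i) j)\<^sup>2" L "Suc L"] tri[of "\<lambda>i j. (f i j - f i (Suc j))\<^sup>2" "Suc L" L]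
    by (simp add: adiagE_def gridE_def sum.distrib)
qed

text \<open>Telescope over the antidiagonals and apply Cauchy-Schwarz with weights
  \<open>1 / (l + 1)\<close>, whose sum is \<open>harm L\<close>.\<close>

lemma adiag_bound: "(f 0 0 - adiag f L)\<^sup>2 \<le> 2 * harm L * gridE (Suc L) f"
proof -
  have "adiag f 0 = f 0 0" by (simp add: adiag_def)
  then have "f 0 0 - adiag f L = (\<Sum>l<L. adiag f l - adiag f (Suc l))"
    by (simp only: sum_lessThan_telescope'[of "adiag f" L])
  also have "\<dots> = (\<Sum>l<L. inverse (sqrt (real (l + 1))) * (sqrt (real (l + 1)) * (adiag f l - adiag f (Suc l))))"
  proof (intro sum.cong refl)
    fix l
    have "sqrt (real (l + 1)) \<noteq> 0" by simp
    then show "adiag f l - adiag f (Suc l) =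
        inverse (sqrt (real (l + 1))) * (sqrt (real (l + 1)) * (adiag f l - adiag f (Suc l)))"
      by (simp only: mult.assoc[symmetric] left_inverse mult_1_left not_False_eq_True)
  qed
  finally have "(f 0 0 - adiag f L)\<^sup>2 \<le> (\<Sum>l<L. (inverse (sqrt (real (l + 1))))\<^sup>2) *
      (\<Sum>l<L. (sqrt (real (l + 1)) * (adiag f l - adiag f (Suc l)))\<^sup>2)"
    by (simp only: Cauchy_Schwarz_ineq_sum)
  also have "(\<Sum>l<L. (inverse (sqrt (real (l + 1))))\<^sup>2) = harm L"
    by (simp add: harm_altdef power_inverse)
  also have "(\<Sum>l<L. (sqrt (real (l + 1)) * (adiag f l - adiag f (Suc l)))\<^sup>2) =
      (\<Sum>l<L. real (l + 1) * (adiag f l - adiag f (Suc l))\<^sup>2)"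
    by (simp add: power_mult_distrib)
  also have "harm L * (\<Sum>l<L. real (l + 1) * (adiag f l - adiag f (Suc l))\<^sup>2) \<le> harm L * (\<Sum>l<L. 2 * adiagE f l)"
    by (intro mult_left_mono sum_mono adiag_step harm_nonneg)
  also have "\<dots> \<le> harm L * (2 * gridE (Suc L) f)"
  proof (intro mult_left_mono harm_nonneg)
    have "(\<Sum>l<L. 2 * adiagE f l) = 2 * (\<Sum>l<L. adiagE f l)" by (rule sum_distrib_left[symmetric])
    then show "(\<Sum>l<L. 2 * adiagE f l) \<le> 2 * gridE (Suc L) f" using sum_adiagE[of f L] by simp
  qed
  finally show ?thesis by (simp add: mult.left_commute mult.assoc)
qed

text \<open>The antidiagonal through the other two corners is invariant under rotation by 180
  degrees, so both ends of the diagonal can be compared with the mean over it.\<close>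

lemma diamond_bound0: "(f 0 0 - f L L)\<^sup>2 \<le> 8 * harm L * gridE (Suc L) f"
proof -
  define g where "g = (\<lambda>i j. f (L - i) (L - j))"
  have "gridE (Suc L) g = gridE (Suc L) f"
    unfolding g_def using gridE_reflect1[of L "\<lambda>i j. f i (L - j)"] gridE_reflect2[of L f] by simp
  moreover have "adiag g L = adiag f L"
  proof -
    have "(\<Sum>i\<le>L. g i (L - i)) = (\<Sum>i\<le>L. (\<lambda>i. f i (L - i)) (L - i))"
      by (simp add: g_def)
    also have "\<dots> = (\<Sum>i\<le>L. f i (L - i))"
      using sum.nat_diff_reindex[of "\<lambda>i. f i (L - i)" "Suc L"] by (simp add: lessThan_Suc_atMost)
    finally show ?thesis by (simp add: adiag_def)
  qed
  ultimately have 1: "(f L L - adiag f L)\<^sup>2 \<le> 2 * harm L * gridE (Suc L) f"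
    using adiag_bound[of g L] by (simp add: g_def)
  have "(f 0 0 - f L L)\<^sup>2 = ((f 0 0 - adiag f L) - (f L L - adiag f L))\<^sup>2" by simp
  also have "\<dots> \<le> 2 * (f 0 0 - adiag f L)\<^sup>2 + 2 * (f L L - adiag f L)\<^sup>2"
  proof -
    have "(a - b)\<^sup>2 \<le> 2 * a\<^sup>2 + 2 * b\<^sup>2" for a b :: real
      using sum_squares_bound[of a "- b"] by (simp add: power2_diff)
    then show ?thesis .
  qed
  finally show ?thesis using 1 adiag_bound[of f L] by simp
qed

text \<open>Apply the previous bound to the subsquare spanned by the two points, reflected for the
  second claim. The factor 3 is an upper bound for \<open>sqrt 8\<close>.\<close>

lemma diagonal_bound:
  assumes "x + L < M" "y + L < M"
  shows "\<bar>f x y - f (x + L) (y + L)\<bar> \<le> 3 * sqrt (harm M * gridE M f)"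
    and "\<bar>f x (y + L) - f (x + L) y\<bar> \<le> 3 * sqrt (harm M * gridE M f)"
proof -
  have *: "\<bar>a\<bar> \<le> 3 * sqrt (harm M * gridE M f)" if "a\<^sup>2 \<le> 8 * harm L * gridE (Suc L) g" "gridE (Suc L) g \<le> gridE M f" for a g
  proof -
    have "a\<^sup>2 \<le> 8 * harm L * gridE (Suc L) g" by fact
    also have "\<dots> \<le> 9 * (harm M * gridE M f)"
      using that(2) harm_mono[of L M, where 'a = real] assms gridE_nonneg[of "Suc L" g] harm_nonneg[of L, where 'a = real]
      by (simp only: mult.assoc) (intro mult_mono, auto intro: mult_nonneg_nonneg)
    finally have "sqrt (a\<^sup>2) \<le> sqrt (9 * (harm M * gridE M f))" by (rule real_sqrt_le_mono)
    then show ?thesis by (simp add: real_sqrt_mult)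
  qed
  have s: "gridE (Suc L) (\<lambda>i j. f (x + i) (y + j)) \<le> gridE M f" by (rule gridE_sub[OF assms])
  show "\<bar>f x y - f (x + L) (y + L)\<bar> \<le> 3 * sqrt (harm M * gridE M f)"
    using *[OF _ s] diamond_bound0[of "\<lambda>i j. f (x + i) (y + j)" L] by simp
  have "gridE (Suc L) (\<lambda>i j. f (x + i) (y + (L - j))) \<le> gridE M f"
    using s gridE_reflect2[of L "\<lambda>i j. f (x + i) (y + j)"] by simp
  from *[OF _ this] show "\<bar>f x (y + L) - f (x + L) y\<bar> \<le> 3 * sqrt (harm M * gridE M f)"
    using diamond_bound0[of "\<lambda>i j. f (x + i) (y + (L - j))" L] by simp
qed

text \<open>Diagonal moves preserve the parity of the coordinate sum; one edge is needed to change
  it.\<close>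

lemma grid_edge:
  assumes "x < M" "Suc y < M"
  shows "\<bar>f x (Suc y) - f x y\<bar> \<le> sqrt (harm M * gridE M f)"
proof -
  have h: "1 \<le> (harm M :: real)" using harm_mono[of 1 M, where 'a = real] assms by (simp add: harm_def)
  have "(f x y - f x (Suc y))\<^sup>2 \<le> (\<Sum>j<M - 1. (f x j - f x (Suc j))\<^sup>2)"
    by (rule member_le_sum[of y]) (use assms in auto)
  also have "\<dots> \<le> (\<Sum>i<M. \<Sum>j<M - 1. (f i j - f i (Suc j))\<^sup>2)"
    by (rule member_le_sum[of x]) (use assms in \<open>auto intro: sum_nonneg\<close>)
  also have "\<dots> \<le> gridE M f" unfolding gridE_def by (auto intro!: sum_nonneg)
  also have "\<dots> \<le> harm M * gridE M f"
    using mult_right_mono[OF h gridE_nonneg[of M f]] by simp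
  finally have "sqrt ((f x y - f x (Suc y))\<^sup>2) \<le> sqrt (harm M * gridE M f)" by (rule real_sqrt_le_mono)
  then show ?thesis by (simp add: abs_minus_commute)
qed

text \<open>One diagonal leads to an axis (cost 3), one edge makes the distance to the corner even
  (cost 1), and two diagonals, out to \<open>(k, k)\<close> and back, lead to the corner (cost
  6).\<close>

lemma grid_to_corner:
  assumes "x < M" "y < M"
  shows "\<bar>f x y - f 0 0\<bar> \<le> 10 * sqrt (harm M * gridE M f)"
proof -
  define Z where "Z f = sqrt (harm M * gridE M f)" for f
  have Z0: "0 \<le> Z f" for f by (simp add: Z_def harm_nonneg gridE_nonneg)
  have ev: "\<bar>f 0 (2 * k) - f 0 0\<bar> \<le> 6 * Z f" if "2 * k < M" for k f
  proof -
    have "\<bar>f 0 (0 + k + k) - f k k\<bar> \<le> 3 * Z f"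
      using diagonal_bound(2)[of 0 k M k f] that by (simp add: Z_def)
    moreover have "\<bar>f 0 0 - f k k\<bar> \<le> 3 * Z f"
      using diagonal_bound(1)[of 0 k M 0 f] that by (simp add: Z_def)
    ultimately show ?thesis by (simp add: mult_2)
  qed
  have ax: "\<bar>f 0 y - f 0 0\<bar> \<le> 7 * Z f" if "y < M" for y f
  proof (cases "even y")
    case True
    then show ?thesis using ev[of "y div 2" f] that Z0[of f] by auto
  next
    case False
    then obtain k where k: "y = Suc (2 * k)" by (metis oddE Suc_eq_plus1)
    then show ?thesis using ev[of k f] grid_edge[of 0 M "2 * k" f] that by (simp add: Z_def)
  qed
  have le: "\<bar>f x y - f 0 0\<bar> \<le> 10 * Z f" if "x \<le> y" "y < M" for x y f
  proof -
    have "\<bar>f 0 (y - x) - f x y\<bar> \<le> 3 * Z f"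
      using diagonal_bound(1)[of 0 x M "y - x" f] that by (simp add: Z_def)
    moreover have "\<bar>f 0 (y - x) - f 0 0\<bar> \<le> 7 * Z f" using ax that by simp
    ultimately show ?thesis by linarith
  qed
  show ?thesis
  proof (cases "x \<le> y")
    case True
    then show ?thesis using le assms by (simp add: Z_def)
  next
    case False
    then show ?thesis using le[of y x "\<lambda>i j. f j i"] assms gridE_transpose[of M f] by (simp add: Z_def)
  qed
qed

theorem grid_resistance:
  assumes "x < M" "y < M" "x' < M" "y' < M"
  shows "\<bar>f x y - f x' y'\<bar> \<le> 20 * sqrt (harm M * gridE M f)"
  using grid_to_corner[OF assms(1,2), of f] grid_to_corner[OF assms(3,4), of f] by linarith

section \<open>Dense cells\<close>

text \<open>With cells of side 1, any two points of such cells are at distance at most \<rho>: a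
  difference of \<open>d\<close> in the index allows \<open>d + 1\<close> in the coordinate.\<close>

definition cadj :: "int \<Rightarrow> int \<times> int \<Rightarrow> int \<times> int \<Rightarrow> bool" where
  "cadj \<rho> p q \<longleftrightarrow> (\<bar>fst p - fst q\<bar> + 1)\<^sup>2 + (\<bar>snd p - snd q\<bar> + 1)\<^sup>2 \<le> \<rho>\<^sup>2"

text \<open>One open quadrant of the cells \<open>cadj\<close> to a given cell. Offsets start at 1,
  so that the four reflected copies are disjoint and lie strictly beyond the row and the column of
  the cell.\<close>

definition quarter :: "int \<Rightarrow> (int \<times> int) set" where
  "quarter \<rho> = {(i, j). 1 \<le> i \<and> 1 \<le> j \<and> (i + 1)\<^sup>2 + (j + 1)\<^sup>2 \<le> \<rho>\<^sup>2}"

text \<open>A window has fewer than \<open>4 * card (quarter \<rho>)\<close> bad cells, so among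
  that many consecutive lines one is full. The term \<rho> leaves room for a quarter disc beyond
  it.\<close>

definition reach :: "int \<Rightarrow> int" where "reach \<rho> = 4 * int (card (quarter \<rho>)) + 1 + \<rho>"

definition cells :: "int \<Rightarrow> (int \<times> int) set" where "cells M = {0..<M} \<times> {0..<M}"

text \<open>The margin of 1 beyond \<open>reach \<rho>\<close> puts the reference lines of a cell
  into the windows of its neighbours as well.\<close>

definition window :: "int \<Rightarrow> int \<Rightarrow> int \<times> int \<Rightarrow> (int \<times> int) set" where
  "window M \<rho> c = {p \<in> cells M. \<bar>fst p - fst c\<bar> \<le> reach \<rho> + 1 \<and> \<bar>snd p - snd c\<bar> \<le> reach \<rho> + 1}"

text \<open>The directions in which the grid extends far enough from coordinate \<open>x\<close>; a cell has
  \<open>4\<close>, \<open>2\<close> or \<open>1\<close> free quadrants according to whether it is interior, near a side or near a corner.\<close>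
definition dirs :: "int \<Rightarrow> int \<Rightarrow> int \<Rightarrow> int set" where
  "dirs M \<rho> x = {d \<in> {-1, 1}. 0 \<le> x + d * reach \<rho> \<and> x + d * reach \<rho> < M}"

definition quads :: "int \<Rightarrow> int \<Rightarrow> int \<times> int \<Rightarrow> nat" where
  "quads M \<rho> c = card (dirs M \<rho> (fst c)) * card (dirs M \<rho> (snd c))"

lemma quarter_bounds: "(i, j) \<in> quarter \<rho> \<Longrightarrow> 0 \<le> \<rho> \<Longrightarrow> i < \<rho> \<and> j < \<rho>"
proof -
  assume a: "(i, j) \<in> quarter \<rho>" "0 \<le> \<rho>"
  then have "(i + 1)\<^sup>2 + (j + 1)\<^sup>2 \<le> \<rho>\<^sup>2" by (simp add: quarter_def)
  then have "(i + 1)\<^sup>2 \<le> \<rho>\<^sup>2" "(j + 1)\<^sup>2 \<le> \<rho>\<^sup>2"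
    using zero_le_power2[of "i + 1"] zero_le_power2[of "j + 1"] by linarith+
  then have "i + 1 \<le> \<rho>" "j + 1 \<le> \<rho>" using a(2) by (blast intro: power2_le_imp_le)+
  then show ?thesis by simp
qed

lemma finite_quarter: "0 \<le> \<rho> \<Longrightarrow> finite (quarter \<rho>)"
  by (rule finite_subset[of _ "{0..\<rho>} \<times> {0..\<rho>}"]) (use quarter_bounds in \<open>force simp: quarter_def\<close>)+

lemma finite_cells [simp]: "finite (cells M)" by (simp add: cells_def)

lemma finite_window [simp]: "finite (window M \<rho> c)" by (simp add: window_def)

lemma card_window: "card (window M \<rho> c) \<le> (2 * nat (reach \<rho> + 1) + 1)\<^sup>2"
proof (cases "0 \<le> reach \<rho> + 1")
  case True
  let ?R = "reach \<rho> + 1"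
  have "window M \<rho> c \<subseteq> {fst c - ?R..fst c + ?R} \<times> {snd c - ?R..snd c + ?R}"
    by (auto simp: window_def)
  then have "card (window M \<rho> c) \<le> card ({fst c - ?R..fst c + ?R} \<times> {snd c - ?R..snd c + ?R})"
    by (intro card_mono) auto
  also have "\<dots> = nat (2 * ?R + 1) ^ 2"
    by (simp add: power2_eq_square algebra_simps)
  also have "nat (2 * ?R + 1) = 2 * nat ?R + 1"
  proof -
    have "nat (2 * x + 1) = 2 * nat x + 1" if "0 \<le> x" for x using that by simp
    then show ?thesis using True by blast
  qed
  finally show ?thesis .
next
  case False
  then have "window M \<rho> c = {}" by (auto simp: window_def)
  then show ?thesis by simp
qed

lemma cadj_closer:
  assumes "cadj \<rho> p q" "\<bar>fst p - fst r\<bar> \<le> \<bar>fst p - fst q\<bar>" "\<bar>snd p - snd r\<bar> \<le> \<bar>snd p - snd q\<bar>"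
  shows "cadj \<rho> p r"
proof -
  have "(\<bar>fst p - fst r\<bar> + 1)\<^sup>2 \<le> (\<bar>fst p - fst q\<bar> + 1)\<^sup>2" "(\<bar>snd p - snd r\<bar> + 1)\<^sup>2 \<le> (\<bar>snd p - snd q\<bar> + 1)\<^sup>2"
    using assms by (intro power_mono; simp)+
  then show ?thesis using assms(1) unfolding cadj_def by linarith
qed

text \<open>The bound on \<open>M\<close> guarantees a free direction in each coordinate at every
  cell, so the right side of \<open>few_bad\<close> is the number of cells in one, two or four
  quarter discs.\<close>

locale cell_config =
  fixes M \<rho> :: int and dense :: "int \<times> int \<Rightarrow> bool"
  assumes rho: "3 \<le> \<rho>"
    and M: "2 * (reach \<rho> + 1) \<le> M"
    and few_bad: "\<And>c. c \<in> cells M \<Longrightarrow>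
      card {p \<in> window M \<rho> c. \<not> dense p} < quads M \<rho> c * card (quarter \<rho>)"
begin

abbreviation "Q \<equiv> card (quarter \<rho>)"
abbreviation "R \<equiv> reach \<rho> + 1"
abbreviation "win \<equiv> window M \<rho>"

definition bad :: "int \<times> int \<Rightarrow> (int \<times> int) set" where "bad c = {p \<in> win c. \<not> dense p}"

definition full_col :: "int \<times> int \<Rightarrow> int \<Rightarrow> bool" where
  "full_col c x \<longleftrightarrow> (\<forall>y. (x, y) \<in> win c \<longrightarrow> dense (x, y))"
definition full_row :: "int \<times> int \<Rightarrow> int \<Rightarrow> bool" where
  "full_row c y \<longleftrightarrow> (\<forall>x. (x, y) \<in> win c \<longrightarrow> dense (x, y))"

lemma finite_bad [simp]: "finite (bad c)" by (simp add: bad_def)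

lemma dirs_le: "card (dirs M \<rho> x) \<le> 2"
proof -
  have "card (dirs M \<rho> x) \<le> card {-1, 1 :: int}" by (intro card_mono) (auto simp: dirs_def)
  then show ?thesis by simp
qed

lemma card_bad: "c \<in> cells M \<Longrightarrow> card (bad c) < 4 * Q"
proof -
  assume "c \<in> cells M"
  then have "card (bad c) < quads M \<rho> c * Q" using few_bad by (simp add: bad_def)
  also have "quads M \<rho> c * Q \<le> 2 * 2 * Q"
    unfolding quads_def by (intro mult_mono dirs_le) auto
  finally show ?thesis by simp
qed

lemma Q_R: "4 * int Q + 1 + \<rho> = reach \<rho>" by (simp add: reach_def)

text \<open>Every column that is not full contains a bad cell, and different columns contain
  different ones.\<close>

lemma full_col_exists:
  assumes "c \<in> cells M" "finite J" "4 * Q \<le> card J"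
  shows "\<exists>x\<in>J. full_col c x"
proof (rule ccontr)
  assume "\<not> ?thesis"
  then have "J \<subseteq> fst ` bad c" by (force simp: full_col_def bad_def)
  then have "card J \<le> card (bad c)"
    by (meson card_image_le card_mono finite_bad finite_imageI order_trans)
  then show False using card_bad[OF assms(1)] assms(3) by simp
qed

lemma full_row_exists:
  assumes "c \<in> cells M" "finite J" "4 * Q \<le> card J"
  shows "\<exists>x\<in>J. full_row c x"
proof (rule ccontr)
  assume "\<not> ?thesis"
  then have "J \<subseteq> snd ` bad c" by (force simp: full_row_def bad_def)
  then have "card J \<le> card (bad c)"
    by (meson card_image_le card_mono finite_bad finite_imageI order_trans)
  then show False using card_bad[OF assms(1)] assms(3) by simp
qed

section \<open>Reference lines and reachability through dense cells\<close>

definition core :: "int \<Rightarrow> int set" where "core x = {i. 0 \<le> i \<and> i < M \<and> \<bar>i - x\<bar> \<le> R - 1}"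

text \<open>At least one side of \<open>x\<close> leaves room for \<open>4 * Q\<close> lines inside
  the grid.\<close>

lemma core: assumes "0 \<le> x" "x < M" shows "finite (core x)" "4 * Q \<le> card (core x)"
proof -
  have "core x \<subseteq> {0..M}" by (auto simp: core_def)
  then show f: "finite (core x)" using finite_subset by blast
  show "4 * Q \<le> card (core x)"
  proof (cases "x + reach \<rho> < M")
    case True
    then have "{x..<x + 4 * int Q} \<subseteq> core x" using assms rho Q_R by (auto simp: core_def)
    then have "card {x..<x + 4 * int Q} \<le> card (core x)" by (rule card_mono[OF f])
    then show ?thesis by simp
  next
    case False
    then have "{x - 4 * int Q<..x} \<subseteq> core x" using assms rho Q_R M by (auto simp: core_def)
    then have "card {x - 4 * int Q<..x} \<le> card (core x)" by (rule card_mono[OF f])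
    then show ?thesis by simp
  qed
qed

definition col :: "int \<times> int \<Rightarrow> int" where "col c = (SOME x. x \<in> core (fst c) \<and> full_col c x)"
definition row :: "int \<times> int \<Rightarrow> int" where "row c = (SOME y. y \<in> core (snd c) \<and> full_row c y)"
text \<open>The crossing of the chosen full column and full row represents \<open>c\<close> in the
  comparison with the grid.\<close>

definition ref :: "int \<times> int \<Rightarrow> int \<times> int" where "ref c = (col c, row c)"

lemma col: assumes "c \<in> cells M" shows "col c \<in> core (fst c)" "full_col c (col c)"
proof -
  have "\<exists>x. x \<in> core (fst c) \<and> full_col c x"
    using full_col_exists[OF assms core[of "fst c"]] assms by (auto simp: cells_def)
  then have "col c \<in> core (fst c) \<and> full_col c (col c)" unfolding col_def by (rule someI_ex)
  then show "col c \<in> core (fst c)" "full_col c (col c)" by auto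
qed

lemma row: assumes "c \<in> cells M" shows "row c \<in> core (snd c)" "full_row c (row c)"
proof -
  have "\<exists>x. x \<in> core (snd c) \<and> full_row c x"
    using full_row_exists[OF assms core[of "snd c"]] assms by (auto simp: cells_def)
  then have "row c \<in> core (snd c) \<and> full_row c (row c)" unfolding row_def by (rule someI_ex)
  then show "row c \<in> core (snd c)" "full_row c (row c)" by auto
qed

text \<open>Only the target has to be dense: the walk starts in the cell of an arbitrary vertex,
  which may be sparse.\<close>

definition step :: "int \<times> int \<Rightarrow> ((int \<times> int) \<times> (int \<times> int)) set" where
  "step c = {(p, q). p \<in> win c \<and> q \<in> win c \<and> dense q \<and> cadj \<rho> p q}"

lemma finite_step: "finite (step c)"
  by (rule finite_subset[of _ "win c \<times> win c"]) (auto simp: step_def)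

lemma card_step: "card (step c) \<le> ((2 * nat R + 1)\<^sup>2)\<^sup>2"
proof -
  have "card (step c) \<le> card (win c \<times> win c)" by (rule card_mono) (auto simp: step_def)
  also have "\<dots> = (card (win c))\<^sup>2" by (simp add: power2_eq_square card_cartesian_product)
  also have "\<dots> \<le> ((2 * nat R + 1)\<^sup>2)\<^sup>2" using card_window[of M \<rho> c] by (intro power_mono) auto
  finally show ?thesis .
qed

text \<open>If no full line were reachable, the reachable set would be confined between full lines, and
  the quarter discs at its extreme cells would consist of more bad cells than there are.\<close>
lemma reach_full_line:
  assumes c: "c \<in> cells M"
  shows "\<exists>e. (c, e) \<in> (step c)\<^sup>* \<and> (full_col c (fst e) \<or> full_row c (snd e))"
proof (rule ccontr)
  assume "\<not> ?thesis"
  then have no: "\<not> full_col c (fst e)" "\<not> full_row c (snd e)" if "(c, e) \<in> (step c)\<^sup>*" for e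
    using that by blast+
  define S where "S = {e. (c, e) \<in> (step c)\<^sup>*}"
  have R0: "0 \<le> reach \<rho>" using Q_R rho by linarith
  have cwin: "c \<in> win c" using c R0 by (auto simp: window_def)
  have Swin: "S \<subseteq> win c"
  proof
    fix e assume "e \<in> S"
    then have "(c, e) \<in> (step c)\<^sup>*" by (simp add: S_def)
    then show "e \<in> win c" by (cases rule: rtranclE) (use cwin in \<open>auto simp: step_def\<close>)
  qed
  have finS: "finite S" using Swin finite_window finite_subset by blast
  have cS: "c \<in> S" by (simp add: S_def)
  have SI: "q \<in> S" if "p \<in> S" "q \<in> win c" "dense q" "cadj \<rho> p q" for p q
    using that Swin unfolding S_def by (auto simp: step_def intro: rtrancl_into_rtrancl)
  have cb: "0 \<le> fst c" "fst c < M" "0 \<le> snd c" "snd c < M" using c by (auto simp: cells_def)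
  \<comment> \<open>One argument for both coordinates: \<open>pr\<close> selects the coordinate and
    \<open>upd\<close> changes it. Within \<open>4 * Q\<close> lines of \<open>c\<close> in a free
    direction there is a full line. A step across it could be replaced by a shorter step onto it,
    and then a full line would be reached.\<close>
  have conf: "d * pr p < d * pr c + 4 * int Q + 1"
    if pr: "pr = fst \<and> upd = (\<lambda>p x. (x, snd p)) \<and> full = full_col c \<or>
        pr = snd \<and> upd = (\<lambda>p x. (fst p, x)) \<and> full = full_row c"
      and d: "d \<in> dirs M \<rho> (pr c)" and p: "p \<in> S"
    for d p and pr :: "int \<times> int \<Rightarrow> int" and upd :: "int \<times> int \<Rightarrow> int \<Rightarrow> int \<times> int" and full
  proof -
    define J where "J = (\<lambda>i. pr c + d * i) ` {1..4 * int Q}"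
    have dd: "d = 1 \<or> d = - 1" using d by (auto simp: dirs_def)
    have "card J = 4 * Q" unfolding J_def by (subst card_image) (use dd in \<open>auto simp: inj_on_def\<close>)
    then have "\<exists>x\<in>J. full x"
      using pr full_col_exists[OF c, of J] full_row_exists[OF c, of J] by (auto simp: J_def)
    then obtain i where i: "1 \<le> i" "i \<le> 4 * int Q" "full (pr c + d * i)"
      by (auto simp: J_def)
    define x where "x = pr c + d * i"
    have xb: "0 \<le> x" "x < M" "\<bar>x - pr c\<bar> \<le> R"
      using dd i d cb Q_R rho pr by (auto simp: x_def dirs_def)
    have "d * pr e < d * x" if "(c, e) \<in> (step c)\<^sup>*" for e
      using that
    proof (induction rule: rtrancl_induct)
      case base
      then show ?case using dd i by (auto simp: x_def)
    next
      case (step p q)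
      show ?case
      proof (rule ccontr)
        assume n: "\<not> d * pr q < d * x"
        have pS: "p \<in> S" using step by (simp add: S_def)
        then have pw: "p \<in> win c" using Swin by auto
        have xw: "upd p x \<in> win c" using pw xb pr by (auto simp: window_def cells_def)
        moreover have "cadj \<rho> p (upd p x)"
          by (rule cadj_closer[of \<rho> p q]) (use step n dd pr in \<open>auto simp: step_def\<close>)
        moreover have "dense (upd p x)" using xw i pr by (auto simp: full_col_def full_row_def x_def)
        ultimately have "upd p x \<in> S" using SI[OF pS] by blast
        then show False using no[of "upd p x"] i pr by (auto simp: S_def x_def)
      qed
    qed
    then have "d * pr p < d * x" using p by (simp add: S_def)
    then show ?thesis using dd i by (auto simp: x_def)
  qed
  have confx: "d * fst p < d * fst c + 4 * int Q + 1" if "d \<in> dirs M \<rho> (fst c)" "p \<in> S" for d p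
    by (rule conf[of fst "\<lambda>p x. (x, snd p)" "full_col c"]) (use that in auto)
  have confy: "d * snd p < d * snd c + 4 * int Q + 1" if "d \<in> dirs M \<rho> (snd c)" "p \<in> S" for d p
    by (rule conf[of snd "\<lambda>p x. (fst p, x)" "full_row c"]) (use that in auto)
  \<comment> \<open>For \<open>d = 1\<close> and \<open>d = -1\<close> these are a rightmost and a
    leftmost reachable cell.\<close>
  have "\<exists>p\<in>S. \<forall>q\<in>S. d * fst q \<le> d * fst p" for d
  proof -
    have "Max ((\<lambda>q. d * fst q) ` S) \<in> (\<lambda>q. d * fst q) ` S"
      by (rule Max_in) (use finS cS in auto)
    then obtain p where "p \<in> S" "Max ((\<lambda>q. d * fst q) ` S) = d * fst p" by auto
    moreover have "d * fst q \<le> Max ((\<lambda>q. d * fst q) ` S)" if "q \<in> S" for q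
      by (rule Max_ge) (use finS that in auto)
    ultimately have "\<forall>q\<in>S. d * fst q \<le> d * fst p" "p \<in> S" by simp_all
    then show ?thesis by blast
  qed
  then obtain P where P: "\<And>d. P d \<in> S" "\<And>d q. q \<in> S \<Longrightarrow> d * fst q \<le> d * fst (P d)"
    by metis
  \<comment> \<open>Quarter discs attached to the extreme cell \<open>P d\<close>, pointing outwards
    horizontally. Their cells are one step away from \<open>P d\<close> but beyond the extreme
    column, so a dense one would contradict extremality.\<close>
  define \<phi> where "\<phi> = (\<lambda>(d, d', i, j). (fst (P d) + d * i, snd (P d) + d' * j))"
  define I where "I = dirs M \<rho> (fst c) \<times> dirs M \<rho> (snd c) \<times> quarter \<rho>"
  have "\<phi> ` I \<subseteq> bad c"
  proof
    fix z assume "z \<in> \<phi> ` I"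
    then obtain d d' i j where z: "z = (fst (P d) + d * i, snd (P d) + d' * j)"
      and d: "d \<in> dirs M \<rho> (fst c)" and d': "d' \<in> dirs M \<rho> (snd c)" and ij: "(i, j) \<in> quarter \<rho>"
      by (auto simp: \<phi>_def I_def)
    have ijb: "1 \<le> i" "1 \<le> j" "i < \<rho>" "j < \<rho>"
      using quarter_bounds[OF ij] ij rho by (auto simp: quarter_def)
    have dd: "d = 1 \<or> d = - 1" "d' = 1 \<or> d' = - 1" using d d' by (auto simp: dirs_def)
    have Pw: "P d \<in> win c" using P Swin by auto
    have a: "d * fst (P d) \<le> d * fst c + 4 * int Q" "d * fst c \<le> d * fst (P d)"
      using confx[OF d P(1), of d] P(2)[OF cS] by auto
    have b: "d' * snd (P d) \<le> d' * snd c + 4 * int Q"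
      using confy[OF d' P(1), of d] by auto
    have zw: "z \<in> win c"
      using a b d d' ijb Pw cb Q_R dd(1) dd(2)
      by (elim disjE) (auto simp: z window_def cells_def dirs_def)
    moreover have "\<not> dense z"
    proof
      assume "dense z"
      moreover have "cadj \<rho> (P d) z"
        using ij dd ijb unfolding cadj_def z quarter_def by auto
      ultimately have "z \<in> S" using SI[OF P(1) zw] by auto
      from P(2)[OF this, of d] show False using dd ijb by (auto simp: z)
    qed
    ultimately show "z \<in> bad c" by (simp add: bad_def)
  qed
  then have "card (\<phi> ` I) \<le> card (bad c)" by (intro card_mono) auto
  \<comment> \<open>Discs for different \<open>d\<close> lie on opposite sides of the reachable set;
    for equal \<open>d\<close> they share their centre and \<open>d'\<close> separates them.\<close>
  moreover have "inj_on \<phi> I"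
  proof (rule inj_onI)
    fix u v assume "u \<in> I" "v \<in> I" "\<phi> u = \<phi> v"
    then obtain d d' i j e e' k l where uv: "u = (d, d', i, j)" "v = (e, e', k, l)"
      and dd: "d = 1 \<or> d = - 1" "d' = 1 \<or> d' = - 1" "e = 1 \<or> e = - 1" "e' = 1 \<or> e' = - 1"
      and ij: "1 \<le> i" "1 \<le> j" "1 \<le> k" "1 \<le> l"
      and eq: "fst (P d) + d * i = fst (P e) + e * k" "snd (P d) + d' * j = snd (P e) + e' * l"
      by (auto simp: I_def \<phi>_def dirs_def quarter_def)
    have "d = e"
      using dd(1,3) eq(1) ij P(2)[OF P(1), of d e] P(2)[OF P(1), of e d] by (elim disjE) auto
    then show "u = v" using dd ij eq unfolding uv by (elim disjE) auto
  qed
  then have "card (\<phi> ` I) = quads M \<rho> c * Q"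
    by (simp add: card_image I_def quads_def card_cartesian_product)
  ultimately show False using few_bad[OF c] by (simp add: bad_def)
qed

lemma win_interval:
  "(x1, y) \<in> win c \<Longrightarrow> (x2, y) \<in> win c \<Longrightarrow> min x1 x2 \<le> x \<Longrightarrow> x \<le> max x1 x2 \<Longrightarrow> (x, y) \<in> win c"
  "(y, x1) \<in> win c \<Longrightarrow> (y, x2) \<in> win c \<Longrightarrow> min x1 x2 \<le> x \<Longrightarrow> x \<le> max x1 x2 \<Longrightarrow> (y, x) \<in> win c"
  by (auto simp: window_def cells_def)

lemma line_walk:
  fixes f :: "int \<Rightarrow> real" and \<delta> :: real
  assumes "\<And>x. a \<le> x \<Longrightarrow> x < b \<Longrightarrow> \<bar>f x - f (x + 1)\<bar> \<le> \<delta>" "a \<le> b"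
  shows "\<bar>f a - f b\<bar> \<le> (b - a) * \<delta>"
  using assms(2,1)
proof (induction b rule: int_ge_induct)
  case (step b)
  have "\<bar>f a - f b\<bar> \<le> (b - a) * \<delta>" using step by auto
  moreover have "\<bar>f b - f (b + 1)\<bar> \<le> \<delta>" using step by auto
  ultimately show ?case by (simp add: algebra_simps)
qed simp

lemma line_walk_win:
  fixes f :: "int \<Rightarrow> real" and \<delta> :: real
  assumes "\<And>x. min a b \<le> x \<Longrightarrow> x < max a b \<Longrightarrow> \<bar>f x - f (x + 1)\<bar> \<le> \<delta>" "\<bar>a - b\<bar> \<le> 2 * R" "0 \<le> \<delta>"
  shows "\<bar>f a - f b\<bar> \<le> 2 * R * \<delta>"
proof -
  have "\<bar>f a - f b\<bar> \<le> \<bar>a - b\<bar> * \<delta>"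
  proof (cases "a \<le> b")
    case True
    then show ?thesis using line_walk[of a b f \<delta>] assms by auto
  next
    case False
    then show ?thesis using line_walk[of b a f \<delta>] assms by auto
  qed
  also have "\<dots> \<le> 2 * R * \<delta>" using assms by (intro mult_right_mono) auto
  finally show ?thesis .
qed

text \<open>Later \<open>F\<close> is the cell average of a function on the vertices, and
  \<open>\<delta> c\<close> measures its energy in the window of \<open>c\<close>.\<close>

context
  fixes F :: "int \<times> int \<Rightarrow> real" and \<delta> :: "int \<times> int \<Rightarrow> real"
  assumes F: "\<And>c p q. c \<in> cells M \<Longrightarrow> p \<in> win c \<Longrightarrow> q \<in> win c \<Longrightarrow> dense p \<Longrightarrow> dense q \<Longrightarrow>
      cadj \<rho> p q \<Longrightarrow> \<bar>F p - F q\<bar> \<le> \<delta> c"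
    and \<delta>: "\<And>c. 0 \<le> \<delta> c"
begin

lemma cadj_unit: "cadj \<rho> (x, y) (x + 1, y)" "cadj \<rho> (x, y) (x, y + 1)"
proof -
  have "(3::int)\<^sup>2 \<le> \<rho>\<^sup>2" using rho by (intro power_mono) auto
  then show "cadj \<rho> (x, y) (x + 1, y)" "cadj \<rho> (x, y) (x, y + 1)" by (simp_all add: cadj_def)
qed

lemma row_walk:
  assumes c: "c \<in> cells M" "full_row c y" "(x1, y) \<in> win c" "(x2, y) \<in> win c"
  shows "\<bar>F (x1, y) - F (x2, y)\<bar> \<le> 2 * R * \<delta> c"
proof (rule line_walk_win[of x1 x2 "\<lambda>x. F (x, y)"])
  fix x assume "min x1 x2 \<le> x" "x < max x1 x2"
  then have "(x, y) \<in> win c" "(x + 1, y) \<in> win c" using win_interval(1)[OF c(3,4)] by auto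
  then show "\<bar>F (x, y) - F (x + 1, y)\<bar> \<le> \<delta> c"
    using c by (intro F cadj_unit) (auto simp: full_row_def)
qed (use c \<delta> in \<open>auto simp: window_def\<close>)

lemma col_walk:
  assumes c: "c \<in> cells M" "full_col c x" "(x, y1) \<in> win c" "(x, y2) \<in> win c"
  shows "\<bar>F (x, y1) - F (x, y2)\<bar> \<le> 2 * R * \<delta> c"
proof (rule line_walk_win[of y1 y2 "\<lambda>y. F (x, y)"])
  fix y assume "min y1 y2 \<le> y" "y < max y1 y2"
  then have "(x, y) \<in> win c" "(x, y + 1) \<in> win c" using win_interval(2)[OF c(3,4)] by auto
  then show "\<bar>F (x, y) - F (x, y + 1)\<bar> \<le> \<delta> c"
    using c by (intro F cadj_unit) (auto simp: full_col_def)
qed (use c \<delta> in \<open>auto simp: window_def\<close>)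

text \<open>Follow the full row of \<open>c\<close> to the full column of \<open>c'\<close>, then
  this column to the full row of \<open>c'\<close>. Each leg stays in the window whose \<delta> pays
  for it.\<close>

lemma ref_neighbour:
  assumes c: "c \<in> cells M" "c' \<in> cells M" "\<bar>fst c - fst c'\<bar> \<le> 1" "\<bar>snd c - snd c'\<bar> \<le> 1"
  shows "\<bar>F (ref c) - F (ref c')\<bar> \<le> 2 * R * (\<delta> c + \<delta> c')"
proof -
  note cr = col(1)[OF c(1)] col(1)[OF c(2)] row(1)[OF c(1)] row(1)[OF c(2)]
  have "\<bar>F (col c, row c) - F (col c', row c)\<bar> \<le> 2 * R * \<delta> c"
    by (rule row_walk[OF c(1) row(2)[OF c(1)]])
       (use cr c in \<open>auto simp: window_def core_def cells_def\<close>)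
  moreover have "\<bar>F (col c', row c) - F (col c', row c')\<bar> \<le> 2 * R * \<delta> c'"
    by (rule col_walk[OF c(2) col(2)[OF c(2)]])
       (use cr c in \<open>auto simp: window_def core_def cells_def\<close>)
  ultimately show ?thesis unfolding ref_def distrib_left by linarith
qed

text \<open>Here \<open>a\<close> is the value at a vertex of the cell \<open>c\<close>. The first
  hop into a dense cell costs \<tau>, each further hop \<open>\<delta> c\<close>; two stretches
  along full lines then lead to the reference cell.\<close>

lemma ref_reach:
  assumes c: "c \<in> cells M"
    and t: "\<And>p. p \<in> win c \<Longrightarrow> dense p \<Longrightarrow> cadj \<rho> c p \<Longrightarrow> \<bar>a - F p\<bar> \<le> \<tau>"
  shows "\<bar>a - F (ref c)\<bar> \<le> \<tau> + (real (((2 * nat R + 1)\<^sup>2)\<^sup>2) + 4 * real_of_int R) * \<delta> c"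
proof -
  have R0: "0 \<le> reach \<rho>" using Q_R rho by linarith
  have cwin: "c \<in> win c" using c R0 by (auto simp: window_def)
  have cc: "cadj \<rho> c c"
  proof -
    have "(3::int)\<^sup>2 \<le> \<rho>\<^sup>2" using rho by (intro power_mono) auto
    then show ?thesis by (simp add: cadj_def)
  qed
  have walk: "\<bar>a - F e\<bar> \<le> \<tau> + n * \<delta> c" if "(c, e) \<in> step c ^^ n" "dense e" for e n
    using that
  proof (induction n arbitrary: e)
    case 0
    then show ?case using t[of e] cwin cc by simp
  next
    case (Suc n)
    then obtain p where p: "(c, p) \<in> step c ^^ n" "(p, e) \<in> step c" by auto
    show ?case
    proof (cases "dense p")
      case True
      have "\<bar>F p - F e\<bar> \<le> \<delta> c" by (rule F) (use p Suc.prems True c in \<open>auto simp: step_def\<close>)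
      then show ?thesis using Suc.IH[OF p(1) True] by (simp add: algebra_simps)
    next
      case False
      \<comment> \<open>All cells of the walk after the first are dense.\<close>
      have "p = c"
      proof (cases n)
        case 0
        then show ?thesis using p by simp
      next
        case (Suc m)
        then show ?thesis using p False by (auto simp: step_def)
      qed
      then have "\<bar>a - F e\<bar> \<le> \<tau>" using p by (intro t) (auto simp: step_def)
      moreover have "0 \<le> Suc n * \<delta> c" using \<delta> by (intro mult_nonneg_nonneg) auto
      ultimately show ?thesis by linarith
    qed
  qed
  obtain e where e: "(c, e) \<in> (step c)\<^sup>*" "full_col c (fst e) \<or> full_row c (snd e)"
    using reach_full_line[OF c] by blast
  have ew: "e \<in> win c" using e(1) by (cases rule: rtranclE) (use cwin in \<open>auto simp: step_def\<close>)
  have "(fst e, snd e) \<in> win c" using ew by simp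
  then have "dense (fst e, snd e)" using e(2) unfolding full_col_def full_row_def by blast
  then have ed: "dense e" by simp
  \<comment> \<open>A reachable cell is reached in at most as many steps as the finite relation has
    pairs, which bounds the length uniformly in \<open>c\<close>.\<close>
  obtain n where n: "n \<le> card (step c)" "(c, e) \<in> step c ^^ n"
    using e(1) rtrancl_finite_eq_relpow[OF finite_step[of c]] by auto
  have "real n \<le> real (((2 * nat R + 1)\<^sup>2)\<^sup>2)" using n card_step[of c] by (simp only: of_nat_le_iff)
  then have "n * \<delta> c \<le> real (((2 * nat R + 1)\<^sup>2)\<^sup>2) * \<delta> c" using \<delta> by (intro mult_right_mono)
  then have 1: "\<bar>a - F e\<bar> \<le> \<tau> + real (((2 * nat R + 1)\<^sup>2)\<^sup>2) * \<delta> c" using walk[OF n(2) ed] by linarith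
  note cr = col(1)[OF c] row(1)[OF c]
  have "\<bar>F e - F (ref c)\<bar> \<le> 4 * real_of_int R * \<delta> c"
    using e(2)
  proof
    assume fc: "full_col c (fst e)"
    have "\<bar>F (fst e, snd e) - F (fst e, row c)\<bar> \<le> 2 * R * \<delta> c"
      by (rule col_walk[OF c fc]) (use cr ew in \<open>auto simp: window_def core_def cells_def\<close>)
    moreover have "\<bar>F (fst e, row c) - F (col c, row c)\<bar> \<le> 2 * R * \<delta> c"
      by (rule row_walk[OF c row(2)[OF c]]) (use cr ew in \<open>auto simp: window_def core_def cells_def\<close>)
    ultimately have "\<bar>F (fst e, snd e) - F (col c, row c)\<bar> \<le> 2 * R * \<delta> c + 2 * R * \<delta> c" by linarith
    then show ?thesis by (simp add: ref_def algebra_simps)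
  next
    assume fr: "full_row c (snd e)"
    have "\<bar>F (fst e, snd e) - F (col c, snd e)\<bar> \<le> 2 * R * \<delta> c"
      by (rule row_walk[OF c fr]) (use cr ew in \<open>auto simp: window_def core_def cells_def\<close>)
    moreover have "\<bar>F (col c, snd e) - F (col c, row c)\<bar> \<le> 2 * R * \<delta> c"
      by (rule col_walk[OF c col(2)[OF c]]) (use cr ew in \<open>auto simp: window_def core_def cells_def\<close>)
    ultimately have "\<bar>F (fst e, snd e) - F (col c, row c)\<bar> \<le> 2 * R * \<delta> c + 2 * R * \<delta> c" by linarith
    then show ?thesis by (simp add: ref_def algebra_simps)
  qed
  then show ?thesis using 1 unfolding distrib_right by linarith
qed

end

end

section \<open>Comparison with the grid\<close>

definition cell_pts :: "nat \<Rightarrow> (nat \<Rightarrow> int \<times> int) \<Rightarrow> int \<times> int \<Rightarrow> nat set" where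
  "cell_pts N idx p = {v. v < N \<and> idx v = p}"

definition win_size :: "int \<Rightarrow> real" where "win_size \<rho> = real ((2 * nat (reach \<rho> + 1) + 1)\<^sup>2)"

text \<open>The square of the cost of a route between two vertices: twice the way to a reference
  cell, as in \<open>pt_ref\<close>, plus the way through the grid, where \<open>H\<close> bounds
  \<open>harm (nat M) / k\<close>.\<close>

definition resist_const :: "int \<Rightarrow> real \<Rightarrow> real" where
  "resist_const \<rho> H = (2 * (1 + ((win_size \<rho>)\<^sup>2 + 4 * (reach \<rho> + 1))) +
     20 * sqrt (H * (32 * (reach \<rho> + 1)\<^sup>2 * win_size \<rho>)))\<^sup>2"

locale cell_graph = cell_config M \<rho> "\<lambda>p. k \<le> real (card (cell_pts N idx p))"
  for M \<rho> :: int and N :: nat and idx :: "nat \<Rightarrow> int \<times> int" and k :: real +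
  fixes adj :: "nat \<Rightarrow> nat \<Rightarrow> bool"
  assumes k: "1 \<le> k"
    and idx_cells: "\<And>v. v < N \<Longrightarrow> idx v \<in> cells M"
    and close_adj: "\<And>u v. u < N \<Longrightarrow> v < N \<Longrightarrow> u \<noteq> v \<Longrightarrow> cadj \<rho> (idx u) (idx v) \<Longrightarrow> adj u v"
begin

abbreviation "pts \<equiv> cell_pts N idx"
abbreviation "dense p \<equiv> k \<le> real (card (pts p))"

lemma finite_pts [simp]: "finite (pts p)" by (simp add: cell_pts_def)

context
  fixes h :: "nat \<Rightarrow> real"
begin

definition cavg :: "int \<times> int \<Rightarrow> real" where "cavg p = (\<Sum>v\<in>pts p. h v) / card (pts p)"

definition near :: "int \<times> int \<Rightarrow> nat set" where "near p = {v. v < N \<and> cadj \<rho> p (idx v)}"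

text \<open>Each ordered pair is charged to the cell of its first vertex, so that the weights of all
  cells add up to at most the Dirichlet form.\<close>

definition wt :: "int \<times> int \<Rightarrow> real" where "wt p = (\<Sum>u\<in>pts p. \<Sum>v\<in>near p. (h u - h v)\<^sup>2)"

lemma finite_near [simp]: "finite (near p)" by (simp add: near_def)

lemma wt_nonneg: "0 \<le> wt p" unfolding wt_def by (intro sum_nonneg) auto

lemma near_sum: "u < N \<Longrightarrow> (\<Sum>v\<in>near (idx u). (h u - h v)\<^sup>2) \<le> (\<Sum>v\<in>nbs N adj u. (h u - h v)\<^sup>2)"
proof -
  assume u: "u < N"
  have "(\<Sum>v\<in>near (idx u). (h u - h v)\<^sup>2) = (\<Sum>v\<in>near (idx u) - {u}. (h u - h v)\<^sup>2)"
    by (rule sum.mono_neutral_right) auto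
  also have "\<dots> \<le> (\<Sum>v\<in>nbs N adj u. (h u - h v)\<^sup>2)"
    by (rule sum_mono2) (use u in \<open>auto simp: near_def nbs_def close_adj\<close>)
  finally show ?thesis .
qed

lemma sum_wt: "(\<Sum>p\<in>cells M. wt p) \<le> dirichlet N adj h"
proof -
  have "(\<Sum>p\<in>cells M. wt p) = (\<Sum>p\<in>cells M. \<Sum>u\<in>{u\<in>{..<N}. idx u = p}. \<Sum>v\<in>near (idx u). (h u - h v)\<^sup>2)"
    unfolding wt_def cell_pts_def by (intro sum.cong) auto
  also have "\<dots> = (\<Sum>u<N. \<Sum>v\<in>near (idx u). (h u - h v)\<^sup>2)"
    by (rule sum.group) (use idx_cells in auto)
  also have "\<dots> \<le> dirichlet N adj h"
    unfolding dirichlet_def by (intro sum_mono near_sum) auto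
  finally show ?thesis .
qed

text \<open>The difference of the averages is the mean of \<open>h u - h v\<close> over all pairs
  from the two cells. These are at least \<open>k^2\<close> pairs, and distinct vertices in a pair
  are adjacent; Cauchy-Schwarz gains the factor \<open>1 / k^2\<close>.\<close>

lemma cavg_diff:
  assumes "dense p" "dense q" "cadj \<rho> p q"
  shows "(cavg p - cavg q)\<^sup>2 \<le> wt p / k\<^sup>2"
proof -
  define a b where "a = real (card (pts p))" and "b = real (card (pts q))"
  have ab: "k \<le> a" "k \<le> b" "0 < a" "0 < b" using assms k by (auto simp: a_def b_def)
  define A where "A = pts p \<times> pts q"
  have cA: "real (card A) = a * b" by (simp add: A_def a_def b_def card_cartesian_product)
  have "(\<Sum>e\<in>A. h (fst e) - h (snd e)) = b * (\<Sum>v\<in>pts p. h v) - a * (\<Sum>v\<in>pts q. h v)"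
    by (simp add: A_def sum_subtractf sum.cartesian_product' a_def b_def sum_distrib_left)
  then have eq: "cavg p - cavg q = (\<Sum>e\<in>A. h (fst e) - h (snd e)) / (a * b)"
    unfolding cavg_def a_def[symmetric] b_def[symmetric] using ab by (simp add: field_simps)
  have "(\<Sum>e\<in>A. (h (fst e) - h (snd e))\<^sup>2) \<le> wt p"
  proof -
    have "(\<Sum>e\<in>A. (h (fst e) - h (snd e))\<^sup>2) = (\<Sum>u\<in>pts p. \<Sum>v\<in>pts q. (h u - h v)\<^sup>2)"
      by (simp add: A_def sum.cartesian_product')
    also have "\<dots> \<le> wt p"
      unfolding wt_def using assms(3)
      by (intro sum_mono sum_mono2) (auto simp: near_def cell_pts_def)
    finally show ?thesis .
  qed
  then have "(\<Sum>e\<in>A. h (fst e) - h (snd e))\<^sup>2 \<le> wt p * (a * b)"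
    using sum_squared_le_sum_of_squares[of "\<lambda>e. h (fst e) - h (snd e)" A] ab unfolding cA
    by (smt (verit) mult_pos_pos mult_right_mono)
  then have "(cavg p - cavg q)\<^sup>2 \<le> wt p * (a * b) / (a * b)\<^sup>2"
    unfolding eq power_divide by (rule divide_right_mono) simp
  also have "\<dots> = wt p / (a * b)" using ab by (simp add: power2_eq_square)
  also have "\<dots> \<le> wt p / k\<^sup>2"
    using ab k wt_nonneg[of p] unfolding power2_eq_square
    by (intro divide_left_mono mult_mono mult_pos_pos) auto
  finally show ?thesis .
qed

text \<open>A single vertex has only the edges into one dense cell to rely on, so the gain is
  \<open>1 / k\<close>. This determines the order of the final resistance bound.\<close>

lemma pt_cavg_diff:
  assumes "v < N" "dense p" "cadj \<rho> (idx v) p"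
  shows "(h v - cavg p)\<^sup>2 \<le> dirichlet N adj h / k"
proof -
  define a where "a = real (card (pts p))"
  have a: "k \<le> a" "0 < a" using assms k by (auto simp: a_def)
  have eq: "h v - cavg p = (\<Sum>u\<in>pts p. h v - h u) / a"
    unfolding cavg_def a_def[symmetric] using a by (simp add: sum_subtractf a_def[symmetric] field_simps)
  have "(\<Sum>u\<in>pts p. (h v - h u)\<^sup>2) \<le> (\<Sum>u\<in>near (idx v). (h v - h u)\<^sup>2)"
    by (rule sum_mono2) (use assms in \<open>auto simp: near_def cell_pts_def\<close>)
  also have "\<dots> \<le> (\<Sum>u\<in>nbs N adj v. (h v - h u)\<^sup>2)" by (rule near_sum[OF assms(1)])
  also have "\<dots> \<le> dirichlet N adj h"
    unfolding dirichlet_def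
    by (rule member_le_sum[of v "{..<N}" "\<lambda>v. \<Sum>u\<in>nbs N adj v. (h v - h u)\<^sup>2"])
       (use assms in \<open>auto intro: sum_nonneg\<close>)
  finally have "(\<Sum>u\<in>pts p. (h v - h u)\<^sup>2) * a \<le> dirichlet N adj h * a"
    using a by (intro mult_right_mono) auto
  then have "(\<Sum>u\<in>pts p. h v - h u)\<^sup>2 \<le> dirichlet N adj h * a"
    using sum_squared_le_sum_of_squares[of "\<lambda>u. h v - h u" "pts p"] unfolding a_def by linarith
  then have "(h v - cavg p)\<^sup>2 \<le> dirichlet N adj h * a / a\<^sup>2"
    unfolding eq power_divide by (rule divide_right_mono) simp
  also have "\<dots> = dirichlet N adj h / a" using a by (simp add: power2_eq_square)
  also have "\<dots> \<le> dirichlet N adj h / k"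
    using a k dirichlet_nonneg[of N adj h] by (intro divide_left_mono mult_pos_pos) auto
  finally show ?thesis .
qed

text \<open>The root of the energy charged to a window, scaled so that it bounds every hop between
  dense cells there.\<close>

definition del :: "int \<times> int \<Rightarrow> real" where "del c = sqrt (\<Sum>p\<in>win c. wt p) / k"

lemma del_nonneg: "0 \<le> del c"
  unfolding del_def using k wt_nonneg by (intro divide_nonneg_nonneg) (auto intro: sum_nonneg)

lemma del_sq: "(del c)\<^sup>2 = (\<Sum>p\<in>win c. wt p) / k\<^sup>2"
  unfolding del_def using wt_nonneg by (simp add: power_divide sum_nonneg)

lemma cavg_del:
  assumes "p \<in> win c" "dense p" "dense q" "cadj \<rho> p q"
  shows "\<bar>cavg p - cavg q\<bar> \<le> del c"
proof -
  have "wt p \<le> (\<Sum>p\<in>win c. wt p)"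
    by (rule member_le_sum) (use assms wt_nonneg in auto)
  then have "wt p / k\<^sup>2 \<le> (del c)\<^sup>2" unfolding del_sq by (intro divide_right_mono) auto
  then have "(cavg p - cavg q)\<^sup>2 \<le> (del c)\<^sup>2" using cavg_diff[OF assms(2-4)] by linarith
  then show ?thesis using del_nonneg[of c] by (simp add: abs_le_square_iff[symmetric])
qed

lemma del_le: "del c \<le> sqrt (dirichlet N adj h / k)"
proof -
  have "(\<Sum>p\<in>win c. wt p) \<le> (\<Sum>p\<in>cells M. wt p)"
    by (rule sum_mono2) (use wt_nonneg in \<open>auto simp: window_def\<close>)
  then have "(\<Sum>p\<in>win c. wt p) \<le> dirichlet N adj h" using sum_wt by linarith
  then have "(del c)\<^sup>2 \<le> dirichlet N adj h / k\<^sup>2" unfolding del_sq by (intro divide_right_mono) auto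
  also have "\<dots> \<le> dirichlet N adj h / k"
    using k dirichlet_nonneg[of N adj h] by (intro divide_left_mono) (auto simp: power2_eq_square)
  finally show ?thesis by (rule real_le_rsqrt)
qed

text \<open>Lying in the window of each other is symmetric for cells, so each cell is counted in at
  most \<open>win_size \<rho>\<close> windows.\<close>

lemma sum_del_sq: "(\<Sum>c\<in>cells M. (del c)\<^sup>2) \<le> win_size \<rho> * dirichlet N adj h / k\<^sup>2"
proof -
  have "(\<Sum>c\<in>cells M. \<Sum>p\<in>win c. wt p) = (\<Sum>c\<in>cells M. \<Sum>p\<in>cells M. if p \<in> win c then wt p else 0)"
  proof (rule sum.cong[OF refl])
    fix c
    have "win c = {p \<in> cells M. p \<in> win c}" by (auto simp: window_def)
    then show "(\<Sum>p\<in>win c. wt p) = (\<Sum>p\<in>cells M. if p \<in> win c then wt p else 0)"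
      using sum.inter_filter[of "cells M" wt "\<lambda>p. p \<in> win c"] by simp
  qed
  also have "\<dots> = (\<Sum>p\<in>cells M. \<Sum>c\<in>cells M. if p \<in> win c then wt p else 0)" by (rule sum.swap)
  also have "\<dots> = (\<Sum>p\<in>cells M. card (win p) * wt p)"
  proof (rule sum.cong[OF refl])
    fix p assume p: "p \<in> cells M"
    have "win p = {c \<in> cells M. p \<in> win c}" using p by (auto simp: window_def)
    then show "(\<Sum>c\<in>cells M. if p \<in> win c then wt p else 0) = card (win p) * wt p"
      using sum.inter_filter[of "cells M" "\<lambda>_. wt p" "\<lambda>c. p \<in> win c"] by simp
  qed
  also have "\<dots> \<le> (\<Sum>p\<in>cells M. win_size \<rho> * wt p)"
    unfolding win_size_def
    by (intro sum_mono mult_right_mono wt_nonneg) (simp only: of_nat_le_iff card_window)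
  also have "\<dots> = win_size \<rho> * (\<Sum>p\<in>cells M. wt p)" by (simp add: sum_distrib_left)
  also have "\<dots> \<le> win_size \<rho> * dirichlet N adj h"
    using sum_wt by (intro mult_left_mono) (auto simp: win_size_def)
  finally show ?thesis
    unfolding del_sq sum_divide_distrib[symmetric] by (intro divide_right_mono) auto
qed

lemma R_pos: "0 \<le> reach \<rho>" using Q_R rho by linarith

definition fgrid :: "nat \<Rightarrow> nat \<Rightarrow> real" where "fgrid i j = cavg (ref (int i, int j))"

lemma sum_cells: "(\<Sum>c\<in>cells M. f c) = (\<Sum>i<nat M. \<Sum>j<nat M. f (int i, int j))" for f :: "int \<times> int \<Rightarrow> real"
proof -
  have "{0..<M} = int ` {..<nat M}"
  proof -
    have "x \<in> int ` {..<nat M}" if "0 \<le> x" "x < M" for x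
      by (rule image_eqI[of _ _ "nat x"]) (use that in auto)
    then show ?thesis by auto
  qed
  then have "(\<Sum>i\<in>{0..<M}. g i) = (\<Sum>i<nat M. g (int i))" for g :: "int \<Rightarrow> real"
    by (simp add: sum.reindex)
  then show ?thesis by (simp add: cells_def sum.cartesian_product')
qed

text \<open>With \<open>R = reach \<rho> + 1\<close>, a grid edge costs at most
  \<open>(2 * R)^2 * 2\<close> times the two values of \<open>(del c)^2\<close> at its ends. Each
  cell is an end of at most four edges, which gives 32.\<close>

lemma gridE_fgrid: "gridE (nat M) fgrid \<le> 32 * (reach \<rho> + 1)\<^sup>2 * (win_size \<rho> * dirichlet N adj h / k\<^sup>2)"
proof -
  define K where "K = 8 * (real_of_int (reach \<rho> + 1))\<^sup>2"
  define d where "d i j = (del (int i, int j))\<^sup>2" for i j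
  have d0: "0 \<le> d i j" for i j by (simp add: d_def)
  have K0: "0 \<le> K" by (simp add: K_def)
  have edge: "(cavg (ref c) - cavg (ref c'))\<^sup>2 \<le> K * ((del c)\<^sup>2 + (del c')\<^sup>2)"
    if "c \<in> cells M" "c' \<in> cells M" "\<bar>fst c - fst c'\<bar> \<le> 1" "\<bar>snd c - snd c'\<bar> \<le> 1" for c c'
  proof -
    have "\<bar>cavg (ref c) - cavg (ref c')\<bar> \<le> 2 * (reach \<rho> + 1) * (del c + del c')"
      by (rule ref_neighbour[of cavg del]) (use that del_nonneg cavg_del in auto)
    then have "\<bar>cavg (ref c) - cavg (ref c')\<bar>\<^sup>2 \<le> (2 * (reach \<rho> + 1) * (del c + del c'))\<^sup>2"
      by (rule power_mono) simp
    then have "(cavg (ref c) - cavg (ref c'))\<^sup>2 \<le> 2\<^sup>2 * (real_of_int (reach \<rho> + 1))\<^sup>2 * (del c + del c')\<^sup>2"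
      by (simp only: power_mult_distrib of_int_mult of_int_numeral power2_abs)
    also have "(del c + del c')\<^sup>2 \<le> 2 * ((del c)\<^sup>2 + (del c')\<^sup>2)"
      using sum_squares_bound[of "del c" "del c'"] by (simp add: power2_sum)
    finally have "(cavg (ref c) - cavg (ref c'))\<^sup>2 \<le>
        2\<^sup>2 * (real_of_int (reach \<rho> + 1))\<^sup>2 * (2 * ((del c)\<^sup>2 + (del c')\<^sup>2))"
      by (simp add: mult_left_mono)
    also have "\<dots> = K * ((del c)\<^sup>2 + (del c')\<^sup>2)"
      unfolding K_def by algebra
    finally show ?thesis .
  qed
  define S where "S = (\<Sum>i<nat M. \<Sum>j<nat M. d i j)"
  have sh: "(\<Sum>i<n - 1. a i + a (Suc i)) \<le> 2 * (\<Sum>i<n. a i)" if "\<And>i. 0 \<le> a i" for a :: "nat \<Rightarrow> real" and n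
  proof -
    have "(\<Sum>i<n - 1. a i) \<le> (\<Sum>i<n. a i)" by (rule sum_mono2) (use that in auto)
    moreover have "(\<Sum>i<n - 1. a (Suc i)) \<le> (\<Sum>i<n. a i)"
      using sum_shift_le[of a 1 "n - 1" n] that by (cases n) auto
    ultimately show ?thesis by (simp add: sum.distrib)
  qed
  have "(\<Sum>i<nat M - 1. \<Sum>j<nat M. (fgrid i j - fgrid (Suc i) j)\<^sup>2)
      \<le> (\<Sum>i<nat M - 1. \<Sum>j<nat M. K * (d i j + d (Suc i) j))"
    unfolding fgrid_def d_def
    by (intro sum_mono edge) (auto simp: cells_def)
  also have "\<dots> = K * (\<Sum>i<nat M - 1. (\<Sum>j<nat M. d i j) + (\<Sum>j<nat M. d (Suc i) j))"
    by (simp add: sum_distrib_left sum.distrib distrib_left)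
  also have "\<dots> \<le> K * (2 * S)"
    unfolding S_def by (intro mult_left_mono sh K0 sum_nonneg d0)
  finally have 1: "(\<Sum>i<nat M - 1. \<Sum>j<nat M. (fgrid i j - fgrid (Suc i) j)\<^sup>2) \<le> K * (2 * S)" .
  have "(\<Sum>i<nat M. \<Sum>j<nat M - 1. (fgrid i j - fgrid i (Suc j))\<^sup>2)
      \<le> (\<Sum>i<nat M. \<Sum>j<nat M - 1. K * (d i j + d i (Suc j)))"
    unfolding fgrid_def d_def
    by (intro sum_mono edge) (auto simp: cells_def)
  also have "\<dots> = K * (\<Sum>i<nat M. \<Sum>j<nat M - 1. d i j + d i (Suc j))"
    by (simp add: sum_distrib_left)
  also have "\<dots> \<le> K * (\<Sum>i<nat M. 2 * (\<Sum>j<nat M. d i j))"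
    by (intro mult_left_mono sum_mono sh K0 d0)
  also have "\<dots> = K * (2 * S)" by (simp add: S_def sum_distrib_left)
  finally have "gridE (nat M) fgrid \<le> K * (4 * S)" using 1 by (simp add: gridE_def)
  also have "S = (\<Sum>c\<in>cells M. (del c)\<^sup>2)" by (simp add: S_def d_def sum_cells)
  also have "K * (4 * (\<Sum>c\<in>cells M. (del c)\<^sup>2)) \<le> K * (4 * (win_size \<rho> * dirichlet N adj h / k\<^sup>2))"
    using sum_del_sq by (intro mult_left_mono K0) auto
  finally show ?thesis by (simp add: K_def)
qed

lemma pt_ref:
  assumes "v < N"
  shows "\<bar>h v - cavg (ref (idx v))\<bar> \<le>
    (1 + ((win_size \<rho>)\<^sup>2 + 4 * (reach \<rho> + 1))) * sqrt (dirichlet N adj h / k)"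
proof -
  let ?D = "sqrt (dirichlet N adj h / k)"
  have "\<bar>h v - cavg (ref (idx v))\<bar> \<le> ?D + (real (((2 * nat (reach \<rho> + 1) + 1)\<^sup>2)\<^sup>2)
      + 4 * real_of_int (reach \<rho> + 1)) * del (idx v)"
  proof (rule ref_reach[of cavg del])
    fix p assume "p \<in> win (idx v)" "dense p" "cadj \<rho> (idx v) p"
    then have "(h v - cavg p)\<^sup>2 \<le> dirichlet N adj h / k" using pt_cavg_diff[OF assms] by simp
    then have "sqrt ((h v - cavg p)\<^sup>2) \<le> ?D" by (rule real_sqrt_le_mono)
    then show "\<bar>h v - cavg p\<bar> \<le> ?D" by simp
  qed (use assms idx_cells del_nonneg cavg_del in auto)
  also have "\<dots> \<le> ?D + (real (((2 * nat (reach \<rho> + 1) + 1)\<^sup>2)\<^sup>2)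
      + 4 * real_of_int (reach \<rho> + 1)) * ?D"
    using R_pos by (intro add_left_mono mult_left_mono del_le add_nonneg_nonneg) auto
  finally show ?thesis by (simp add: win_size_def distrib_right)
qed

text \<open>The grid contributes \<open>harm M / k^2\<close>, which the hypothesis on
  \<open>H\<close> reduces to order \<open>1 / k\<close>, the cost of leaving a single
  vertex.\<close>

lemma resistance_le:
  assumes uv: "u < N" "v < N" and H: "harm (nat M) \<le> H * k"
  shows "(h u - h v)\<^sup>2 \<le> resist_const \<rho> H / k * dirichlet N adj h"
proof -
  define C1 where "C1 = 1 + ((win_size \<rho>)\<^sup>2 + 4 * real_of_int (reach \<rho> + 1))"
  define X where "X = 32 * (real_of_int (reach \<rho> + 1))\<^sup>2 * win_size \<rho>"
  define D where "D = dirichlet N adj h"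
  have D0: "0 \<le> D" by (simp add: D_def dirichlet_nonneg)
  have X0: "0 \<le> X" by (simp add: X_def win_size_def)
  have H0: "0 \<le> H" using H k harm_nonneg[of "nat M", where 'a = real]
    by (metis less_le_not_le mult_neg_pos not_le_imp_less order_less_le_trans zero_less_one)
  have grid: "\<bar>cavg (ref c) - cavg (ref c')\<bar> \<le> 20 * sqrt (harm (nat M) * gridE (nat M) fgrid)"
    if "c \<in> cells M" "c' \<in> cells M" for c c'
    using grid_resistance[of "nat (fst c)" "nat M" "nat (snd c)" "nat (fst c')" "nat (snd c')" fgrid] that
    by (auto simp: cells_def fgrid_def nat_less_iff)
  have "harm (nat M) * gridE (nat M) fgrid \<le> (H * k) * (X * D / k\<^sup>2)"
    using H gridE_fgrid H0 k by (intro mult_mono gridE_nonneg) (auto simp: X_def D_def)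
  also have "\<dots> = (H * X) * (D / k)" using k by (simp add: power2_eq_square)
  finally have "sqrt (harm (nat M) * gridE (nat M) fgrid) \<le> sqrt (H * X) * sqrt (D / k)"
    unfolding real_sqrt_mult[symmetric] by (rule real_sqrt_le_mono)
  then have g: "\<bar>cavg (ref (idx u)) - cavg (ref (idx v))\<bar> \<le> 20 * (sqrt (H * X) * sqrt (D / k))"
    using grid[OF idx_cells idx_cells, OF uv] by linarith
  have "\<bar>h u - cavg (ref (idx u))\<bar> \<le> C1 * sqrt (D / k)" "\<bar>h v - cavg (ref (idx v))\<bar> \<le> C1 * sqrt (D / k)"
    using pt_ref uv by (auto simp: C1_def D_def)
  then have "\<bar>h u - h v\<bar> \<le> (2 * C1 + 20 * sqrt (H * X)) * sqrt (D / k)"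
    using g unfolding distrib_right by linarith
  then have "\<bar>h u - h v\<bar>\<^sup>2 \<le> ((2 * C1 + 20 * sqrt (H * X)) * sqrt (D / k))\<^sup>2"
    by (rule power_mono) simp
  also have "\<dots> = (2 * C1 + 20 * sqrt (H * X))\<^sup>2 * (D / k)"
    using D0 k by (simp add: power_mult_distrib)
  also have "(2 * C1 + 20 * sqrt (H * X))\<^sup>2 = resist_const \<rho> H"
    by (simp add: resist_const_def C1_def X_def)
  finally show ?thesis by (simp add: D_def)
qed

end

text \<open>The resistance is of order \<open>1 / k\<close> and the volume of order
  \<open>N * k\<close>; in their product \<open>k\<close> cancels, so \<open>hmax\<close> is linear
  in \<open>N\<close>.\<close>

theorem cover_time_cell_graph:
  fixes C D H :: real
  assumes sym: "\<And>u w. u < N \<Longrightarrow> w < N \<Longrightarrow> adj u w = adj w u"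
    and N: "2 \<le> N" and H: "harm (nat M) \<le> H * k"
    and deg: "\<And>v. v < N \<Longrightarrow> real (card (nbs N adj v)) \<le> D * k"
  defines "C \<equiv> 2 * resist_const \<rho> H * D"
  shows "ennreal (N / 8 * (ln (N / (8 * C + 2)) - 1)) \<le> cover_time N adj"
    and "cover_time N adj \<le> ennreal (C * N * harm N)"
proof -
  define E where "E = resist_const \<rho> H / k"
  have "0 < 2 * (1 + ((win_size \<rho>)\<^sup>2 + 4 * (reach \<rho> + 1))) +
     20 * sqrt (H * (32 * (reach \<rho> + 1)\<^sup>2 * win_size \<rho>))"
  proof (rule add_pos_nonneg)
    show "0 < 2 * (1 + ((win_size \<rho>)\<^sup>2 + 4 * (reach \<rho> + 1)))"
      using R_pos by (intro mult_pos_pos add_pos_nonneg add_nonneg_nonneg) auto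
    have H0: "0 \<le> H" using H k harm_nonneg[of "nat M", where 'a = real]
      by (metis less_le_not_le mult_neg_pos not_le_imp_less order_less_le_trans zero_less_one)
    show "0 \<le> 20 * sqrt (H * (32 * (reach \<rho> + 1)\<^sup>2 * win_size \<rho>))"
      using H0 by (simp add: win_size_def)
  qed
  then have E: "0 < E" unfolding E_def resist_const_def using k by (intro divide_pos_pos) auto
  interpret resist_graph N adj E
    by (rule resist_graphI[OF sym N E]) (use resistance_le H in \<open>auto simp: E_def\<close>)
  have "vol \<le> (\<Sum>x<N. D * k)" unfolding vol_def by (intro sum_mono) (auto simp: deg_def deg)
  then have "2 * E * vol \<le> 2 * E * (N * (D * k))" using E by (intro mult_left_mono) auto
  also have "\<dots> = C * N" using k by (simp add: E_def C_def)
  finally have "hmax \<le> C * N" by (simp add: hmax_def)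
  from cover_time_bounds[OF _ this] N
  show "ennreal (N / 8 * (ln (N / (8 * C + 2)) - 1)) \<le> cover_time N adj"
    and "cover_time N adj \<le> ennreal (C * N * harm N)" by auto
qed

end

section \<open>The Poisson process\<close>

definition count_in :: "'a set \<Rightarrow> nat \<times> (nat \<Rightarrow> 'a) \<Rightarrow> nat" where
  "count_in U \<omega> = card {i. i < fst \<omega> \<and> snd \<omega> i \<in> U}"

locale poisson_process = prob_space \<mu> for \<mu> :: "'a measure" +
  fixes lam :: real
  assumes lam: "0 < lam"
begin

definition seqM where "seqM = (\<Pi>\<^sub>M i\<in>(UNIV::nat set). \<mu>)"

definition proc where "proc = measure_pmf (poisson_pmf lam) \<Otimes>\<^sub>M seqM"

sublocale coords: product_prob_space "\<lambda>_::nat. \<mu>" UNIV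
  by standard

sublocale seqP: prob_space seqM
  unfolding seqM_def by (rule coords.prob_space_axioms)

sublocale procP: prob_space proc
proof -
  interpret pair_prob_space "measure_pmf (poisson_pmf lam)" seqM ..
  show "prob_space proc" unfolding proc_def by (rule prob_space_axioms)
qed

lemma fst_meas [measurable]: "fst \<in> measurable proc (count_space UNIV)"
  unfolding proc_def by (rule measurable_compose[OF measurable_fst]) simp

lemma coord_meas [measurable]: "(\<lambda>\<omega>. snd \<omega> i) \<in> measurable proc \<mu>"
  unfolding proc_def seqM_def
  by (rule measurable_compose[OF measurable_snd measurable_component_singleton]) simp

lemma coord_meas' [measurable]: "(\<lambda>x. x i) \<in> measurable seqM \<mu>"
  unfolding seqM_def by (rule measurable_component_singleton) simp

lemma count_in_sum: "count_in U \<omega> = (\<Sum>i<fst \<omega>. of_bool (snd \<omega> i \<in> U))"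
proof -
  have "{i. i < fst \<omega> \<and> snd \<omega> i \<in> U} = {..<fst \<omega>} \<inter> {i. snd \<omega> i \<in> U}" by auto
  then show ?thesis by (simp add: count_in_def sum_of_bool_eq)
qed

lemma count_in_meas [measurable]:
  assumes [measurable]: "U \<in> sets \<mu>"
  shows "(\<lambda>\<omega>. real (count_in U \<omega>)) \<in> borel_measurable proc"
proof -
  have "(\<lambda>\<omega>. \<Sum>i<fst \<omega>. indicator U (snd \<omega> i) :: real) \<in> borel_measurable proc"
    by (rule measurable_compose_countable[of "\<lambda>k \<omega>. \<Sum>i<k. indicator U (snd \<omega> i) :: real"]) measurable
  then show ?thesis by (simp add: count_in_sum indicator_def of_bool_def)
qed

text \<open>Project the infinite product to the first \<open>k\<close> coordinates and use
  independence there.\<close>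

lemma nn_integral_prod_coords:
  assumes [measurable]: "g \<in> borel_measurable \<mu>"
  shows "(\<integral>\<^sup>+x. (\<Prod>i<k. g (x i)) \<partial>seqM) = (\<integral>\<^sup>+x. g x \<partial>\<mu>) ^ k"
proof -
  let ?J = "{..<k::nat}"
  have d: "distr seqM (PiM ?J (\<lambda>_. \<mu>)) (\<lambda>x. restrict x ?J) = PiM ?J (\<lambda>_. \<mu>)"
    unfolding seqM_def by (rule coords.distr_PiM_restrict_finite) auto
  have "(\<integral>\<^sup>+x. (\<Prod>i<k. g (x i)) \<partial>seqM) = (\<integral>\<^sup>+x. (\<Prod>i<k. g (restrict x ?J i)) \<partial>seqM)"
    by (intro nn_integral_cong prod.cong) auto
  also have "\<dots> = (\<integral>\<^sup>+x. (\<Prod>i<k. g (x i)) \<partial>distr seqM (PiM ?J (\<lambda>_. \<mu>)) (\<lambda>x. restrict x ?J))"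
    by (subst nn_integral_distr) (auto simp: seqM_def)
  also have "\<dots> = (\<integral>\<^sup>+x. (\<Prod>i<k. g (x i)) \<partial>PiM ?J (\<lambda>_. \<mu>))" by (simp only: d)
  also have "\<dots> = (\<Prod>i<k. \<integral>\<^sup>+x. g x \<partial>\<mu>)"
    by (rule coords.product_nn_integral_prod) auto
  finally show ?thesis by simp
qed

lemma poisson_mgf:
  assumes "0 \<le> a"
  shows "(\<integral>\<^sup>+k. ennreal a ^ k \<partial>measure_pmf (poisson_pmf lam)) = ennreal (exp (lam * (a - 1)))"
proof -
  have "(\<integral>\<^sup>+k. ennreal a ^ k \<partial>measure_pmf (poisson_pmf lam))
      = (\<integral>\<^sup>+k. ennreal (pmf (poisson_pmf lam) k) * ennreal a ^ k \<partial>count_space UNIV)"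
    by (rule nn_integral_measure_pmf)
  also have "\<dots> = (\<Sum>k. ennreal (exp (- lam) * ((lam * a) ^ k / fact k)))"
    using lam assms
    by (simp add: nn_integral_count_space_nat ennreal_mult[symmetric] ennreal_power power_mult_distrib
        mult.commute mult.left_commute)
  also have "\<dots> = ennreal (exp (- lam) * exp (lam * a))"
  proof (rule suminf_ennreal_eq)
    have "(\<lambda>k. (lam * a) ^ k / fact k) sums exp (lam * a)"
      using exp_converges[of "lam * a"] by (simp add: divide_inverse mult.commute)
    then show "(\<lambda>k. exp (- lam) * ((lam * a) ^ k / fact k)) sums (exp (- lam) * exp (lam * a))"
      by (rule sums_mult)
  qed (use lam assms in auto)
  also have "exp (- lam) * exp (lam * a) = exp (lam * (a - 1))"
    by (simp add: mult_exp_exp algebra_simps)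
  finally show ?thesis .
qed

text \<open>Thinning: given \<open>k\<close> points, the generating function is
  \<open>(1 + prob U * (z - 1))^k\<close>. Averaging over the Poisson number yields that of a
  Poisson variable with mean \<open>lam * prob U\<close>.\<close>

lemma count_mgf:
  assumes U[measurable]: "U \<in> sets \<mu>" and z: "0 \<le> z"
  shows "(\<integral>\<^sup>+\<omega>. ennreal (z ^ count_in U \<omega>) \<partial>proc) = ennreal (exp (lam * prob U * (z - 1)))"
proof -
  define g where "g x = ennreal (if x \<in> U then z else 1)" for x
  have gm[measurable]: "g \<in> borel_measurable \<mu>" unfolding g_def by measurable
  have zc: "ennreal (z ^ count_in U \<omega>) = (\<Prod>i<fst \<omega>. g (snd \<omega> i))" for \<omega> :: "nat \<times> (nat \<Rightarrow> 'a)"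
  proof -
    have "(\<Prod>i<fst \<omega>. (if snd \<omega> i \<in> U then z else 1)) = z ^ count_in U \<omega>"
      by (simp add: prod.If_cases count_in_def lessThan_def Collect_conj_eq)
    then show ?thesis unfolding g_def by (subst prod_ennreal) (use z in auto)
  qed
  have pm: "(\<lambda>\<omega>. \<Prod>i<fst \<omega>. g (snd \<omega> i)) \<in> borel_measurable proc"
    by (rule measurable_compose_countable[of "\<lambda>k \<omega>. \<Prod>i<k. g (snd \<omega> i)"]) measurable
  have ig: "(\<integral>\<^sup>+x. g x \<partial>\<mu>) = ennreal (1 + prob U * (z - 1))"
  proof -
    have "(\<integral>\<^sup>+x. g x \<partial>\<mu>) = (\<integral>\<^sup>+x. ennreal z * indicator U x + indicator (space \<mu> - U) x \<partial>\<mu>)"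
      by (intro nn_integral_cong) (auto simp: g_def indicator_def)
    also have "\<dots> = ennreal z * emeasure \<mu> U + emeasure \<mu> (space \<mu> - U)"
      by (subst nn_integral_add) (auto simp: nn_integral_cmult)
    also have "\<dots> = ennreal (z * prob U + (1 - prob U))"
      using z by (simp add: emeasure_eq_measure ennreal_mult[symmetric] prob_compl ennreal_plus)
    finally show ?thesis by (simp add: algebra_simps)
  qed
  have i0: "0 \<le> 1 + prob U * (z - 1)"
  proof -
    have "1 + prob U * (z - 1) = (1 - prob U) + prob U * z" by (simp add: algebra_simps)
    moreover have "0 \<le> prob U * z" "prob U \<le> 1" using z by auto
    ultimately show ?thesis by linarith
  qed
  have "(\<integral>\<^sup>+\<omega>. ennreal (z ^ count_in U \<omega>) \<partial>proc) = (\<integral>\<^sup>+\<omega>. (\<Prod>i<fst \<omega>. g (snd \<omega> i)) \<partial>proc)"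
    by (simp only: zc)
  also have "\<dots> = (\<integral>\<^sup>+k. \<integral>\<^sup>+x. (\<Prod>i<k. g (x i)) \<partial>seqM \<partial>measure_pmf (poisson_pmf lam))"
    using seqP.nn_integral_fst[OF pm[unfolded proc_def]] by (simp add: proc_def)
  also have "\<dots> = (\<integral>\<^sup>+k. ennreal (1 + prob U * (z - 1)) ^ k \<partial>measure_pmf (poisson_pmf lam))"
    by (simp add: nn_integral_prod_coords ig)
  also have "\<dots> = ennreal (exp (lam * (1 + prob U * (z - 1) - 1)))"
    by (rule poisson_mgf[OF i0])
  finally show ?thesis by (simp add: mult.assoc)
qed

text \<open>Markov's inequality for \<open>z ^ count_in U \<omega>\<close>. The event is left
  abstract so that \<open>z \<le> 1\<close> gives the lower tail and \<open>z \<ge> 1\<close> the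
  upper tail.\<close>

lemma count_chernoff:
  assumes U[measurable]: "U \<in> sets \<mu>" and z: "0 < z"
    and A: "A \<in> sets proc" "\<And>\<omega>. \<omega> \<in> A \<Longrightarrow> z powr t \<le> z ^ count_in U \<omega>"
  shows "measure proc A \<le> exp (lam * prob U * (z - 1) - t * ln z)"
proof -
  have "emeasure proc A = (\<integral>\<^sup>+\<omega>. indicator A \<omega> \<partial>proc)" using A by simp
  also have "\<dots> \<le> (\<integral>\<^sup>+\<omega>. ennreal (z powr (- t)) * ennreal (z ^ count_in U \<omega>) \<partial>proc)"
  proof (rule nn_integral_mono)
    fix \<omega>
    have "1 \<le> z powr (- t) * z ^ count_in U \<omega>" if "\<omega> \<in> A"
    proof -
      have "z powr (- t) * z powr t \<le> z powr (- t) * z ^ count_in U \<omega>"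
        using A(2)[OF that] by (intro mult_left_mono) auto
      then show ?thesis using z by (simp add: powr_add[symmetric])
    qed
    then show "indicator A \<omega> \<le> ennreal (z powr (- t)) * ennreal (z ^ count_in U \<omega>)"
      using z by (auto simp: indicator_def ennreal_mult[symmetric])
  qed
  also have "\<dots> = ennreal (z powr (- t)) * ennreal (exp (lam * prob U * (z - 1)))"
  proof -
    have [measurable]: "(\<lambda>\<omega>. z ^ count_in U \<omega>) \<in> borel_measurable proc"
    proof -
      have "(\<lambda>\<omega>. z powr real (count_in U \<omega>)) \<in> borel_measurable proc" by measurable
      moreover have "z powr real (count_in U \<omega>) = z ^ count_in U \<omega>" for \<omega> :: "nat \<times> (nat \<Rightarrow> 'a)"
        using z by (rule powr_realpow)
      ultimately show ?thesis by simp
    qed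
    show ?thesis using z by (subst nn_integral_cmult) (auto simp: count_mgf)
  qed
  also have "\<dots> = ennreal (exp (lam * prob U * (z - 1) - t * ln z))"
    using z by (simp add: ennreal_mult[symmetric] powr_def mult_exp_exp)
  finally show ?thesis by (simp add: procP.emeasure_eq_measure)
qed

lemma count_lower_tail:
  assumes U[measurable]: "U \<in> sets \<mu>" and z: "0 < z" "z \<le> 1"
  shows "measure proc {\<omega> \<in> space proc. real (count_in U \<omega>) \<le> t} \<le> exp (lam * prob U * (z - 1) - t * ln z)"
proof (rule count_chernoff[OF U z(1)])
  fix \<omega> assume "\<omega> \<in> {\<omega> \<in> space proc. real (count_in U \<omega>) \<le> t}"
  then have "z powr t \<le> z powr real (count_in U \<omega>)" using z by (intro powr_mono') auto
  then show "z powr t \<le> z ^ count_in U \<omega>" using z by (simp add: powr_realpow)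
qed measurable

lemma count_upper_tail:
  assumes U[measurable]: "U \<in> sets \<mu>" and z: "1 \<le> z"
  shows "measure proc {\<omega> \<in> space proc. t \<le> real (count_in U \<omega>)} \<le> exp (lam * prob U * (z - 1) - t * ln z)"
proof (rule count_chernoff[OF U])
  fix \<omega> assume "\<omega> \<in> {\<omega> \<in> space proc. t \<le> real (count_in U \<omega>)}"
  then have "z powr t \<le> z powr real (count_in U \<omega>)" using z by (intro powr_mono) auto
  then show "z powr t \<le> z ^ count_in U \<omega>" using z by (simp add: powr_realpow)
next
  show "{\<omega> \<in> space proc. t \<le> real (count_in U \<omega>)} \<in> sets proc" by measurable
qed (use z in simp)

end

section \<open>The point process on the square\<close>

lemma Lambda2_measure: "emeasure lborel (Lambda2 n) = ennreal n"
proof -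
  have "cbox (\<chi> i. - sqrt (real n) / 2) (\<chi> i. sqrt (real n) / 2) \<noteq> ({} :: (real^2) set)"
    by (simp add: interval_ne_empty_cart)
  then have "measure lborel (Lambda2 n) = real n"
    unfolding Lambda2_def by (subst content_cbox_cart) (simp_all add: UNIV_2)
  moreover have "emeasure lborel (Lambda2 n) = ennreal (measure lborel (Lambda2 n))"
    unfolding Lambda2_def
    by (metis emeasure_lborel_cbox_finite emeasure_eq_ennreal_measure infinity_ennreal_def less_irrefl)
  ultimately show ?thesis by simp
qed

lemma PPP2_poisson_process:
  assumes "0 < n"
  shows "poisson_process (uniform_measure lborel (Lambda2 n)) (real n)"
proof -
  interpret prob_space "uniform_measure lborel (Lambda2 n)"
    by (rule prob_space_uniform_measure) (use assms in \<open>auto simp: Lambda2_measure\<close>)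
  show ?thesis by unfold_locales (use assms in simp)
qed

lemma PPP2_proc:
  assumes "0 < n"
  shows "PPP2 n = poisson_process.proc (uniform_measure lborel (Lambda2 n)) (real n)"
proof -
  interpret poisson_process "uniform_measure lborel (Lambda2 n)" "real n"
    by (rule PPP2_poisson_process[OF assms])
  show ?thesis by (simp add: PPP2_def proc_def seqM_def)
qed

text \<open>For a fixed number of points the cover time factors through the finite set of possible
  graphs; then the countably many values of that number are combined.\<close>

lemma cover_time_measurable:
  assumes "0 < n"
  shows "rgg_cover_time r \<in> borel_measurable (PPP2 n)"
proof -
  interpret poisson_process "uniform_measure lborel (Lambda2 n)" "real n"
    by (rule PPP2_poisson_process[OF assms])
  have [measurable]: "(\<lambda>\<omega>. snd \<omega> i) \<in> borel_measurable proc" for i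
    using coord_meas[of i] by (simp cong: measurable_cong_sets)
  have k: "(\<lambda>\<omega>. cover_time k (rgg_adj r (snd \<omega>))) \<in> borel_measurable proc" for k
  proof -
    define g where "g \<omega> = {(i, j). i < k \<and> j < k \<and> rgg_adj r (snd \<omega>) i j}" for \<omega> :: "nat \<times> (nat \<Rightarrow> real^2)"
    define B where "B = Pow ({..<k} \<times> {..<k})"
    have "g \<in> measurable proc (count_space B)"
    proof (subst measurable_count_space_eq2)
      show "finite B" by (simp add: B_def)
      show "g \<in> space proc \<rightarrow> B \<and> (\<forall>a\<in>B. g -` {a} \<inter> space proc \<in> sets proc)"
      proof (intro conjI ballI)
        show "g \<in> space proc \<rightarrow> B" by (auto simp: g_def B_def)
        fix a assume "a \<in> B"
        then have "g -` {a} \<inter> space proc =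
          {\<omega> \<in> space proc. \<forall>i\<in>{..<k}. \<forall>j\<in>{..<k}. ((i, j) \<in> a) = (i \<noteq> j \<and> dist (snd \<omega> i) (snd \<omega> j) \<le> r)}"
          by (auto simp: g_def B_def rgg_adj_def set_eq_iff)
        also have "\<dots> \<in> sets proc" by measurable
        finally show "g -` {a} \<inter> space proc \<in> sets proc" .
      qed
    qed
    then have "(\<lambda>\<omega>. cover_time k (\<lambda>i j. (i, j) \<in> g \<omega>)) \<in> borel_measurable proc"
      by (rule measurable_compose) simp
    moreover have "cover_time k (\<lambda>i j. (i, j) \<in> g \<omega>) = cover_time k (rgg_adj r (snd \<omega>))" for \<omega>
      by (rule cover_time_cong) (auto simp: g_def)
    ultimately show ?thesis by simp
  qed
  have "(\<lambda>\<omega>. cover_time (fst \<omega>) (rgg_adj r (snd \<omega>))) \<in> borel_measurable proc"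
    by (rule measurable_compose_countable[OF k]) measurable
  then show ?thesis by (simp add: PPP2_proc[OF assms] rgg_cover_time_def[abs_def])
qed

section \<open>Cells of the square\<close>

text \<open>Half-open cells give every point exactly one index. Points on the upper and right edges
  of the square fall outside \<open>cells M\<close>; this null set is excluded in
  \<open>good\<close>.\<close>

definition cidx :: "nat \<Rightarrow> int \<Rightarrow> real^2 \<Rightarrow> int \<times> int" where
  "cidx n M x = (\<lfloor>(x $ 1 + sqrt n / 2) * (M / sqrt n)\<rfloor>, \<lfloor>(x $ 2 + sqrt n / 2) * (M / sqrt n)\<rfloor>)"

lemma measure_cbox2:
  fixes l u :: "real^2"
  assumes "l $ 1 \<le> u $ 1" "l $ 2 \<le> u $ 2"
  shows "measure lborel (cbox l u) = (u $ 1 - l $ 1) * (u $ 2 - l $ 2)"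
proof -
  have "cbox l u \<noteq> {}" using assms by (simp add: interval_ne_empty_cart forall_2)
  then show ?thesis by (subst content_cbox_cart) (simp_all add: UNIV_2)
qed

text \<open>The set lies between the open and the closed box, which have equal measure.\<close>

lemma halfopen2_measure:
  fixes l u :: "real^2"
  assumes "l $ 1 \<le> u $ 1" "l $ 2 \<le> u $ 2"
  defines "B \<equiv> {x :: real^2. l $ 1 \<le> x $ 1 \<and> x $ 1 < u $ 1 \<and> l $ 2 \<le> x $ 2 \<and> x $ 2 < u $ 2}"
  shows "B \<in> sets borel" "measure lborel B = (u $ 1 - l $ 1) * (u $ 2 - l $ 2)"
proof -
  show B: "B \<in> sets borel" unfolding B_def by measurable
  have "box l u \<subseteq> B" "B \<subseteq> cbox l u"
    by (auto simp: B_def mem_box_cart forall_2)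
  then have "emeasure lborel (box l u) \<le> emeasure lborel B" "emeasure lborel B \<le> emeasure lborel (cbox l u)"
    using B by (auto intro!: emeasure_mono)
  moreover have "emeasure lborel (box l u) = emeasure lborel (cbox l u)"
  proof -
    have "l \<bullet> b \<le> u \<bullet> b" if "b \<in> Basis" for b
      using that assms by (auto simp: Basis_vec_def inner_axis UNIV_2)
    then show ?thesis by (simp add: emeasure_lborel_box emeasure_lborel_cbox)
  qed
  ultimately have "emeasure lborel B = emeasure lborel (cbox l u)" by simp
  then show "measure lborel B = (u $ 1 - l $ 1) * (u $ 2 - l $ 2)"
    using measure_cbox2[OF assms(1,2)] by (simp add: measure_def)
qed

context
  fixes n :: nat and M :: int
  assumes n: "0 < n" and M: "0 < M"
begin

lemma cidx_vimage:
  "cidx n M -` {(i, j)} = {x. i * (sqrt n / M) - sqrt n / 2 \<le> x $ 1 \<and> x $ 1 < (i + 1) * (sqrt n / M) - sqrt n / 2 \<and>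
     j * (sqrt n / M) - sqrt n / 2 \<le> x $ 2 \<and> x $ 2 < (j + 1) * (sqrt n / M) - sqrt n / 2}"
proof -
  have "\<lfloor>(a + sqrt n / 2) * (M / sqrt n)\<rfloor> = k \<longleftrightarrow>
      k * (sqrt n / M) - sqrt n / 2 \<le> a \<and> a < (k + 1) * (sqrt n / M) - sqrt n / 2" for a and k :: int
  proof -
    have s: "0 < M / sqrt n" using n M by simp
    have "\<lfloor>(a + sqrt n / 2) * (M / sqrt n)\<rfloor> = k \<longleftrightarrow>
      k \<le> (a + sqrt n / 2) * (M / sqrt n) \<and> (a + sqrt n / 2) * (M / sqrt n) < k + 1"
      by (simp add: floor_eq_iff)
    also have "\<dots> \<longleftrightarrow> k / (M / sqrt n) \<le> a + sqrt n / 2 \<and> a + sqrt n / 2 < (k + 1) / (M / sqrt n)"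
      using s by (simp only: pos_divide_le_eq pos_less_divide_eq)
    finally show ?thesis by auto
  qed
  then show ?thesis by (auto simp: cidx_def vimage_def)
qed

lemma cell_measure:
  shows "cidx n M -` {p} \<in> sets borel" "measure lborel (cidx n M -` {p}) = n / M\<^sup>2"
proof -
  obtain i j where p: "p = (i, j)" by fastforce
  define s where "s = sqrt n / M"
  have s: "0 \<le> s" using M by (simp add: s_def)
  define l u where "l = (\<chi> k. (if k = 1 then i else j) * s - sqrt n / 2 :: real^2)"
    and "u = (\<chi> k. ((if k = 1 then i else j) + 1) * s - sqrt n / 2 :: real^2)"
  have "cidx n M -` {p} = {x. l $ 1 \<le> x $ 1 \<and> x $ 1 < u $ 1 \<and> l $ 2 \<le> x $ 2 \<and> x $ 2 < u $ 2}"
    unfolding p cidx_vimage by (simp add: l_def u_def s_def)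
  moreover have lu: "l $ 1 \<le> u $ 1" "l $ 2 \<le> u $ 2" "u $ 1 - l $ 1 = s" "u $ 2 - l $ 2 = s"
    using s by (auto simp: l_def u_def algebra_simps)
  moreover have "s * s = n / M\<^sup>2" by (simp add: s_def power2_eq_square)
  ultimately show "cidx n M -` {p} \<in> sets borel" "measure lborel (cidx n M -` {p}) = n / M\<^sup>2"
    using halfopen2_measure[OF lu(1,2)] by simp_all
qed

lemma cell_subset: "p \<in> cells M \<Longrightarrow> cidx n M -` {p} \<subseteq> Lambda2 n"
proof
  fix x assume p: "p \<in> cells M" and x: "x \<in> cidx n M -` {p}"
  obtain i j where pij: "p = (i, j)" by fastforce
  define s where "s = sqrt n / M"
  have s: "0 \<le> s" "M * s = sqrt n" using M by (auto simp: s_def)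
  have b: "0 \<le> k * s" "(k + 1) * s \<le> sqrt n" if "0 \<le> k" "k < M" for k :: int
  proof -
    show "0 \<le> k * s" using that s by simp
    have "(k + 1) * s \<le> M * s" using that s by (intro mult_right_mono) linarith+
    then show "(k + 1) * s \<le> sqrt n" using s by simp
  qed
  have "0 \<le> i" "i < M" "0 \<le> j" "j < M" using p by (auto simp: pij cells_def)
  then have "- sqrt n / 2 \<le> x $ 1 \<and> x $ 1 \<le> sqrt n / 2" "- sqrt n / 2 \<le> x $ 2 \<and> x $ 2 \<le> sqrt n / 2"
    using x b[of i] b[of j] unfolding pij cidx_vimage s_def[symmetric] by auto
  then show "x \<in> Lambda2 n" by (simp add: Lambda2_def mem_box_cart forall_2)
qed

lemma cells_measure:
  assumes "T \<subseteq> cells M"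
  shows "cidx n M -` T \<in> sets borel" "measure lborel (cidx n M -` T) = card T * (n / M\<^sup>2)"
    "cidx n M -` T \<subseteq> Lambda2 n"
proof -
  have T: "finite T" by (rule finite_subset[OF assms finite_cells])
  have eq: "cidx n M -` T = (\<Union>p\<in>T. cidx n M -` {p})" by auto
  show "cidx n M -` T \<in> sets borel" unfolding eq by (intro sets.finite_UN T cell_measure)
  have "measure lborel (\<Union>p\<in>T. cidx n M -` {p}) = (\<Sum>p\<in>T. measure lborel (cidx n M -` {p}))"
  proof (rule measure_finite_Union)
    fix p assume "p \<in> T"
    have "0 < measure lborel (cidx n M -` {p})" unfolding cell_measure using n M by simp
    then show "emeasure lborel (cidx n M -` {p}) \<noteq> \<infinity>" by (auto simp: measure_def)
  qed (use T cell_measure in \<open>auto simp: disjoint_family_on_def\<close>)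
  then show "measure lborel (cidx n M -` T) = card T * (n / M\<^sup>2)"
    unfolding eq by (simp add: cell_measure)
  show "cidx n M -` T \<subseteq> Lambda2 n" unfolding eq using cell_subset assms by blast
qed

lemma prob_cells:
  assumes "T \<subseteq> cells M"
  shows "measure (uniform_measure lborel (Lambda2 n)) (cidx n M -` T) = card T / M\<^sup>2"
proof -
  have L: "emeasure lborel (Lambda2 n) = ennreal n" "Lambda2 n \<in> sets borel"
    by (rule Lambda2_measure) (simp add: Lambda2_def)
  have "measure (uniform_measure lborel (Lambda2 n)) (cidx n M -` T)
      = measure lborel (Lambda2 n \<inter> cidx n M -` T) / measure lborel (Lambda2 n)"
    by (rule measure_uniform_measure) (use L n cells_measure[OF assms] in auto)
  also have "Lambda2 n \<inter> cidx n M -` T = cidx n M -` T" using cells_measure(3)[OF assms] by auto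
  also have "measure lborel (Lambda2 n) = n" using L by (simp add: measure_def)
  finally show ?thesis using n by (simp add: cells_measure[OF assms])
qed

lemma floor_dist:
  fixes a b :: real
  shows "\<bar>a - b\<bar> \<le> \<bar>\<lfloor>a\<rfloor> - \<lfloor>b\<rfloor>\<bar> + 1"
  by linarith

text \<open>Here the \<open>+ 1\<close> in \<open>cadj\<close> pays off: \<open>floor_dist\<close>
  bounds a distance by the index difference plus 1, in units of the cell side.\<close>

lemma cadj_dist:
  assumes "cadj \<rho> (cidx n M x) (cidx n M y)" "0 \<le> \<rho>" "\<rho> * (sqrt n / M) \<le> r"
  shows "dist x y \<le> r"
proof -
  define s where "s = sqrt n / M"
  have s: "0 < s" using n M by (simp add: s_def)
  define d1 d2 where "d1 = \<bar>fst (cidx n M x) - fst (cidx n M y)\<bar> + 1"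
    and "d2 = \<bar>snd (cidx n M x) - snd (cidx n M y)\<bar> + 1"
  have t: "\<bar>a - b\<bar> \<le> s * (\<bar>\<lfloor>(a + sqrt n / 2) * (M / sqrt n)\<rfloor> - \<lfloor>(b + sqrt n / 2) * (M / sqrt n)\<rfloor>\<bar> + 1)" for a b :: real
  proof -
    have "\<bar>a - b\<bar> = s * \<bar>(a + sqrt n / 2) * (M / sqrt n) - (b + sqrt n / 2) * (M / sqrt n)\<bar>"
    proof -
      have "(a + sqrt n / 2) * (M / sqrt n) - (b + sqrt n / 2) * (M / sqrt n) = (a - b) / s"
        unfolding left_diff_distrib[symmetric] by (simp add: s_def)
      then show ?thesis using s by simp
    qed
    also have "\<dots> \<le> s * (\<bar>\<lfloor>(a + sqrt n / 2) * (M / sqrt n)\<rfloor> - \<lfloor>(b + sqrt n / 2) * (M / sqrt n)\<rfloor>\<bar> + 1)"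
      using s floor_dist by (intro mult_left_mono) auto
    finally show ?thesis .
  qed
  have "\<bar>x $ 1 - y $ 1\<bar> \<le> s * d1" "\<bar>x $ 2 - y $ 2\<bar> \<le> s * d2"
    using t by (auto simp: d1_def d2_def cidx_def)
  then have "(x $ 1 - y $ 1)\<^sup>2 \<le> (s * d1)\<^sup>2" "(x $ 2 - y $ 2)\<^sup>2 \<le> (s * d2)\<^sup>2"
    by (metis abs_ge_zero power2_abs power_mono)+
  then have "(x $ 1 - y $ 1)\<^sup>2 + (x $ 2 - y $ 2)\<^sup>2 \<le> s\<^sup>2 * ((real_of_int d1)\<^sup>2 + (real_of_int d2)\<^sup>2)"
    by (simp add: power_mult_distrib distrib_left)
  also have "\<dots> \<le> s\<^sup>2 * (real_of_int \<rho>)\<^sup>2"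
  proof (rule mult_left_mono)
    have "d1\<^sup>2 + d2\<^sup>2 \<le> \<rho>\<^sup>2" using assms(1) by (simp add: cadj_def d1_def d2_def)
    then have "real_of_int (d1\<^sup>2 + d2\<^sup>2) \<le> real_of_int (\<rho>\<^sup>2)" by (simp only: of_int_le_iff)
    then show "(real_of_int d1)\<^sup>2 + (real_of_int d2)\<^sup>2 \<le> (real_of_int \<rho>)\<^sup>2" by simp
  qed simp
  finally have "sqrt ((x $ 1 - y $ 1)\<^sup>2 + (x $ 2 - y $ 2)\<^sup>2) \<le> \<rho> * s"
    using s assms(2) by (intro real_le_lsqrt) (auto simp: power_mult_distrib mult.commute)
  then show ?thesis
    using assms(3) by (simp add: s_def dist_vec_def L2_set_def UNIV_2 dist_real_def)
qed

lemma dist_cidx: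
  assumes "dist x y \<le> B * (sqrt n / M)"
  shows "\<bar>fst (cidx n M x) - fst (cidx n M y)\<bar> \<le> int B" "\<bar>snd (cidx n M x) - snd (cidx n M y)\<bar> \<le> int B"
proof -
  have s: "0 < sqrt n / M" using n M by simp
  have fl: "\<bar>\<lfloor>(x $ k + sqrt n / 2) * (M / sqrt n)\<rfloor> - \<lfloor>(y $ k + sqrt n / 2) * (M / sqrt n)\<rfloor>\<bar> \<le> int B" for k
  proof -
    have "\<bar>x $ k - y $ k\<bar> \<le> dist x y"
      using dist_vec_nth_le[of x k y] by (simp add: dist_real_def)
    then have a: "\<bar>x $ k - y $ k\<bar> / (sqrt n / M) \<le> B"
      using assms s by (subst pos_divide_le_eq) auto
    have "(x $ k + sqrt n / 2) * (M / sqrt n) - (y $ k + sqrt n / 2) * (M / sqrt n) = (x $ k - y $ k) / (sqrt n / M)"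
      unfolding left_diff_distrib[symmetric] by simp
    then have "\<bar>(x $ k + sqrt n / 2) * (M / sqrt n) - (y $ k + sqrt n / 2) * (M / sqrt n)\<bar> \<le> B"
      using a abs_divide[of "x $ k - y $ k" "sqrt n / M"] abs_of_pos[OF s] by (simp only:)
    then show ?thesis by linarith
  qed
  show "\<bar>fst (cidx n M x) - fst (cidx n M y)\<bar> \<le> int B" "\<bar>snd (cidx n M x) - snd (cidx n M y)\<bar> \<le> int B"
    using fl by (auto simp: cidx_def)
qed

end

text \<open>Cover the disc of radius \<rho> by two strips of width 4 along the axes, each of area
  \<open>8 * \<rho>\<close>, and by unit squares. A point off the strips lies in a square that
  belongs to a cell of \<open>quarter \<rho>\<close> in one of four reflections.\<close>

lemma quarter_count:
  fixes \<rho> :: int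
  assumes "0 \<le> \<rho>"
  shows "pi * (real_of_int \<rho>)\<^sup>2 \<le> 4 * card (quarter \<rho>) + 16 * \<rho>"
proof -
  define S1 S2 where "S1 = cbox (vector [-2, - \<rho>]) (vector [2, \<rho>] :: real^2)"
    and "S2 = cbox (vector [- \<rho>, -2]) (vector [\<rho>, 2] :: real^2)"
  \<comment> \<open>The interval \<open>[i + 1, i + 2]\<close> or its mirror image. The shift by 1
    matches the \<open>+ 1\<close> in \<open>quarter\<close>, so that the corner nearest to the
    origin lies in the disc.\<close>
  define lo where "lo \<sigma> i = (if \<sigma> = (1::int) then real_of_int i + 1 else - real_of_int i - 2)" for \<sigma> i
  define Sq where "Sq = (\<lambda>(\<sigma>, \<tau>, i, j). cbox (vector [lo \<sigma> i, lo \<tau> j]) (vector [lo \<sigma> i + 1, lo \<tau> j + 1]) :: (real^2) set)"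
  define I where "I = {-1, 1 :: int} \<times> {-1, 1 :: int} \<times> quarter \<rho>"
  have finI: "finite I" using finite_quarter[OF assms] by (simp add: I_def)
  have cI: "card I = 4 * card (quarter \<rho>)" by (simp add: I_def card_cartesian_product)
  have m1: "measure lborel S1 = 8 * \<rho>" "measure lborel S2 = 8 * \<rho>"
    unfolding S1_def S2_def using assms by (subst measure_cbox2; simp)+
  have mq: "measure lborel (Sq e) = 1" for e
    by (cases e) (simp add: Sq_def measure_cbox2)
  have "ball 0 (real_of_int \<rho>) \<subseteq> S1 \<union> S2 \<union> (\<Union>e\<in>I. Sq e)"
  proof
    fix x :: "real^2" assume "x \<in> ball 0 (real_of_int \<rho>)"
    then have "sqrt ((x $ 1)\<^sup>2 + (x $ 2)\<^sup>2) < \<rho>"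
      by (simp add: norm_vec_def L2_set_def UNIV_2)
    then have sq: "(x $ 1)\<^sup>2 + (x $ 2)\<^sup>2 \<le> (real_of_int \<rho>)\<^sup>2"
      using assms by (smt (verit) of_int_0_le_iff real_less_lsqrt real_sqrt_le_iff real_sqrt_abs sum_power2_ge_zero real_sqrt_unique)
    have ab: "\<bar>x $ 1\<bar> \<le> \<rho>" "\<bar>x $ 2\<bar> \<le> \<rho>"
    proof -
      have "(x $ 1)\<^sup>2 \<le> (real_of_int \<rho>)\<^sup>2" "(x $ 2)\<^sup>2 \<le> (real_of_int \<rho>)\<^sup>2"
        using sq zero_le_power2[of "x $ 1"] zero_le_power2[of "x $ 2"] by linarith+
      then have "\<bar>x $ 1\<bar> \<le> \<bar>real_of_int \<rho>\<bar>" "\<bar>x $ 2\<bar> \<le> \<bar>real_of_int \<rho>\<bar>"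
        by (simp_all only: abs_le_square_iff)
      then show "\<bar>x $ 1\<bar> \<le> \<rho>" "\<bar>x $ 2\<bar> \<le> \<rho>" using assms by simp_all
    qed
    show "x \<in> S1 \<union> S2 \<union> (\<Union>e\<in>I. Sq e)"
    proof (cases "\<bar>x $ 1\<bar> \<le> 2 \<or> \<bar>x $ 2\<bar> \<le> 2")
      case True
      then have "x \<in> S1 \<or> x \<in> S2"
        using ab by (auto simp: S1_def S2_def mem_box_cart forall_2 abs_le_iff)
      then show ?thesis by auto
    next
      case False
      define \<sigma> \<tau> where "\<sigma> = (if 0 \<le> x $ 1 then 1 else -1 :: int)" and "\<tau> = (if 0 \<le> x $ 2 then 1 else -1 :: int)"
      define i j where "i = \<lfloor>\<bar>x $ 1\<bar>\<rfloor> - 1" and "j = \<lfloor>\<bar>x $ 2\<bar>\<rfloor> - 1"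
      have ij: "1 \<le> i" "1 \<le> j" using False by (auto simp: i_def j_def le_floor_iff)
      have "real_of_int ((i + 1)\<^sup>2 + (j + 1)\<^sup>2) \<le> (x $ 1)\<^sup>2 + (x $ 2)\<^sup>2"
      proof -
        have "(real_of_int (i + 1))\<^sup>2 \<le> \<bar>x $ 1\<bar>\<^sup>2" "(real_of_int (j + 1))\<^sup>2 \<le> \<bar>x $ 2\<bar>\<^sup>2"
          using ij by (intro power_mono; simp add: i_def j_def)+
        then show ?thesis by simp
      qed
      then have "real_of_int ((i + 1)\<^sup>2 + (j + 1)\<^sup>2) \<le> real_of_int (\<rho>\<^sup>2)" using sq by simp
      then have "(i, j) \<in> quarter \<rho>" using ij by (simp only: of_int_le_iff quarter_def) simp
      then have "(\<sigma>, \<tau>, i, j) \<in> I" by (auto simp: I_def \<sigma>_def \<tau>_def)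
      moreover have "x \<in> Sq (\<sigma>, \<tau>, i, j)"
      proof -
        have lo: "lo (if 0 \<le> a then 1 else -1) (\<lfloor>\<bar>a\<bar>\<rfloor> - 1) \<le> a \<and> a \<le> lo (if 0 \<le> a then 1 else -1) (\<lfloor>\<bar>a\<bar>\<rfloor> - 1) + 1" for a :: real
          by (auto simp: lo_def) linarith+
        show ?thesis using lo[of "x $ 1"] lo[of "x $ 2"]
          by (simp add: Sq_def mem_box_cart forall_2 \<sigma>_def \<tau>_def i_def j_def)
      qed
      ultimately show ?thesis by blast
    qed
  qed
  moreover have "S1 \<union> S2 \<union> (\<Union>e\<in>I. Sq e) \<in> lmeasurable"
  proof -
    have "Sq e \<in> lmeasurable" for e by (cases e) (simp add: Sq_def)
    then show ?thesis unfolding S1_def S2_def by (intro fmeasurable.Un fmeasurable.finite_UN finI) auto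
  qed
  ultimately have "measure lebesgue (ball (0::real^2) \<rho>) \<le> measure lebesgue (S1 \<union> S2 \<union> (\<Union>e\<in>I. Sq e))"
    by (intro measure_mono_fmeasurable) auto
  also have "\<dots> \<le> measure lebesgue S1 + measure lebesgue S2 + measure lebesgue (\<Union>e\<in>I. Sq e)"
  proof -
    have sq: "Sq e \<in> sets lebesgue" for e by (cases e) (simp add: Sq_def)
    have "measure lebesgue (S1 \<union> S2 \<union> (\<Union>e\<in>I. Sq e)) \<le> measure lebesgue (S1 \<union> S2) + measure lebesgue (\<Union>e\<in>I. Sq e)"
      by (rule measure_Un_le) (use sq finI in \<open>auto simp: S1_def S2_def\<close>)
    moreover have "measure lebesgue (S1 \<union> S2) \<le> measure lebesgue S1 + measure lebesgue S2"
      by (rule measure_Un_le) (auto simp: S1_def S2_def)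
    ultimately show ?thesis by linarith
  qed
  also have "measure lebesgue (\<Union>e\<in>I. Sq e) \<le> (\<Sum>e\<in>I. measure lebesgue (Sq e))"
  proof (rule measure_UNION_le[OF finI])
    fix e show "Sq e \<in> sets lebesgue" by (cases e) (simp add: Sq_def)
  qed
  also have "(\<Sum>e\<in>I. measure lebesgue (Sq e)) = 4 * card (quarter \<rho>)"
  proof -
    have "measure lebesgue (Sq e) = 1" for e
      using mq[of e] by (cases e) (simp add: Sq_def)
    then show ?thesis by (simp add: cI)
  qed
  finally have "measure lebesgue (ball (0::real^2) \<rho>) \<le>
      measure lebesgue S1 + measure lebesgue S2 + 4 * card (quarter \<rho>)" by simp
  moreover have "measure lebesgue S1 = 8 * \<rho>" "measure lebesgue S2 = 8 * \<rho>"
    using m1 by (auto simp: S1_def S2_def)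
  ultimately have "measure lebesgue (ball (0::real^2) \<rho>) \<le> 16 * \<rho> + 4 * card (quarter \<rho>)" by simp
  moreover have "measure lebesgue (ball (0::real^2) \<rho>) = pi * (real_of_int \<rho>)\<^sup>2"
    using assms by (simp add: content_ball unit_ball_vol_2)
  ultimately show ?thesis by simp
qed

section \<open>Typical configurations\<close>

text \<open>The three terms bound the contributions of interior, side and corner cells to the sum of
  \<open>\<beta> ^ quads M \<rho> c\<close>.\<close>

definition grid_sum :: "int \<Rightarrow> int \<Rightarrow> real \<Rightarrow> real" where
  "grid_sum M \<rho> \<beta> = (real_of_int M)\<^sup>2 * \<beta> ^ 4 +
     4 * real_of_int (reach \<rho>) * real_of_int M * \<beta>\<^sup>2 + 4 * (real_of_int (reach \<rho>))\<^sup>2 * \<beta>"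

lemma quads_sum:
  fixes \<beta> :: real
  assumes M: "2 * (reach \<rho> + 1) \<le> M" and r: "0 \<le> reach \<rho>" and b: "0 \<le> \<beta>" "\<beta> \<le> 1"
  shows "(\<Sum>c\<in>cells M. \<beta> ^ quads M \<rho> c) \<le> grid_sum M \<rho> \<beta>"
proof -
  define e where "e x = (if x < reach \<rho> \<or> M - reach \<rho> \<le> x then 1 else 0 :: real)" for x
  have d: "card (dirs M \<rho> x) = (if x < reach \<rho> \<or> M - reach \<rho> \<le> x then 1 else 2)" if "0 \<le> x" "x < M" for x
  proof -
    consider "x < reach \<rho>" | "M - reach \<rho> \<le> x" | "reach \<rho> \<le> x" "x < M - reach \<rho>" by linarith
    then show ?thesis
    proof cases
      case 1
      then have "dirs M \<rho> x = {1}" using that M r by (auto simp: dirs_def)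
      then show ?thesis using 1 by simp
    next
      case 2
      then have "dirs M \<rho> x = {-1}" using that M r by (auto simp: dirs_def)
      then show ?thesis using 2 by simp
    next
      case 3
      then have "dirs M \<rho> x = {-1, 1}" using that M r by (auto simp: dirs_def)
      then show ?thesis using 3 by simp
    qed
  qed
  have se: "(\<Sum>x\<in>{0..<M}. e x) = 2 * reach \<rho>"
  proof -
    have "(\<Sum>x\<in>{0..<M}. e x) = card {x \<in> {0..<M}. x < reach \<rho> \<or> M - reach \<rho> \<le> x}"
      unfolding e_def by (subst sum.inter_filter[symmetric]) auto
    also have "{x \<in> {0..<M}. x < reach \<rho> \<or> M - reach \<rho> \<le> x} = {0..<reach \<rho>} \<union> {M - reach \<rho>..<M}"
      using M r by auto
    also have "card \<dots> = card {0..<reach \<rho>} + card {M - reach \<rho>..<M}"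
      by (rule card_Un_disjoint) (use M in auto)
    finally show ?thesis using r by simp
  qed
  have "(\<Sum>c\<in>cells M. \<beta> ^ quads M \<rho> c) = (\<Sum>x\<in>{0..<M}. \<Sum>y\<in>{0..<M}. \<beta> ^ quads M \<rho> (x, y))"
    by (simp add: cells_def sum.cartesian_product')
  \<comment> \<open>Keeping the interior and side terms for cells near the boundary too only
    increases the sum and makes it factorise.\<close>
  also have "\<dots> \<le> (\<Sum>x\<in>{0..<M}. \<Sum>y\<in>{0..<M}. \<beta> ^ 4 + e x * \<beta>\<^sup>2 + e y * \<beta>\<^sup>2 + e x * e y * \<beta>)"
    by (intro sum_mono) (use b in \<open>auto simp: quads_def d e_def power2_eq_square\<close>)
  also have "\<dots> = M\<^sup>2 * \<beta> ^ 4 + M * (\<Sum>x\<in>{0..<M}. e x) * \<beta>\<^sup>2 + M * (\<Sum>x\<in>{0..<M}. e x) * \<beta>\<^sup>2 +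
      (\<Sum>x\<in>{0..<M}. e x) * (\<Sum>x\<in>{0..<M}. e x) * \<beta>"
  proof -
    have "(\<Sum>x\<in>{0..<M}. \<Sum>y\<in>{0..<M}. e x * e y * \<beta>) = (\<Sum>x\<in>{0..<M}. e x) * (\<Sum>x\<in>{0..<M}. e x) * \<beta>"
    proof -
      have "(\<Sum>x\<in>{0..<M}. \<Sum>y\<in>{0..<M}. e x * e y * \<beta>) = (\<Sum>x\<in>{0..<M}. e x * (\<Sum>y\<in>{0..<M}. e y) * \<beta>)"
        by (intro sum.cong refl) (simp add: sum_distrib_left sum_distrib_right)
      also have "\<dots> = (\<Sum>x\<in>{0..<M}. e x) * (\<Sum>x\<in>{0..<M}. e x) * \<beta>"
        by (simp only: sum_distrib_right)
      finally show ?thesis .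
    qed
    moreover have "(\<Sum>x\<in>{0..<M}. \<Sum>y\<in>{0..<M}. e y * \<beta>\<^sup>2) = M * (\<Sum>x\<in>{0..<M}. e x) * \<beta>\<^sup>2"
      using M r by (simp add: sum_distrib_right mult.assoc)
    moreover have "(\<Sum>x\<in>{0..<M}. \<Sum>y\<in>{0..<M}. e x * \<beta>\<^sup>2) = M * (\<Sum>x\<in>{0..<M}. e x) * \<beta>\<^sup>2"
      using M r by (simp add: sum_distrib_right sum_distrib_left mult.assoc)
    moreover have "(\<Sum>x\<in>{0..<M}. \<Sum>y\<in>{0..<M}. \<beta> ^ 4) = M\<^sup>2 * \<beta> ^ 4"
      using M r by (simp add: power2_eq_square)
    ultimately show ?thesis by (simp only: sum.distrib)
  qed
  also have "\<dots> = grid_sum M \<rho> \<beta>"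
    unfolding se grid_sum_def by (simp add: algebra_simps power2_eq_square)
  finally show ?thesis .
qed

lemma count_in_vimage:
  assumes "finite T"
  shows "count_in (f -` T) \<omega> = (\<Sum>p\<in>T. card (cell_pts (fst \<omega>) (\<lambda>v. f (snd \<omega> v)) p))"
proof -
  have "count_in (f -` T) \<omega> = card (\<Union>p\<in>T. cell_pts (fst \<omega>) (\<lambda>v. f (snd \<omega> v)) p)"
    unfolding count_in_def by (rule arg_cong[of _ _ card]) (auto simp: cell_pts_def)
  also have "\<dots> = (\<Sum>p\<in>T. card (cell_pts (fst \<omega>) (\<lambda>v. f (snd \<omega> v)) p))"
    by (rule card_UN_disjoint) (use assms in \<open>auto simp: cell_pts_def\<close>)
  finally show ?thesis .
qed

text \<open>The constant of \<open>cover_time_cell_graph\<close> for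
  \<open>k = \<theta> * a\<close>: degrees are at most \<open>L * (K * a)\<close>, which is
  \<open>L * K / \<theta>\<close> times \<open>k\<close>.\<close>

definition cover_const :: "int \<Rightarrow> real \<Rightarrow> real \<Rightarrow> real \<Rightarrow> nat \<Rightarrow> real" where
  "cover_const \<rho> H \<theta> K L = 2 * resist_const \<rho> H * (L * K / \<theta>)"

definition cover_ok :: "real \<Rightarrow> nat \<Rightarrow> ennreal \<Rightarrow> bool" where
  "cover_ok C N t \<longleftrightarrow> ennreal (N / 8 * (ln (N / (8 * C + 2)) - 1)) \<le> t \<and> t \<le> ennreal (C * N * harm N)"

text \<open>\<open>a\<close> is the mean number of points in a cell; a cell is dense above
  \<open>\<theta> * a\<close> and not overfull below \<open>K * a\<close>. \<open>L\<close> bounds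
  the number of cells needed to cover the neighbours of a vertex: a block around it if
  \<open>r\<close> is comparable to the cell side, all cells if \<open>M\<close> is bounded.\<close>

locale rgg_params =
  fixes n :: nat and M \<rho> :: int and a \<theta> K r H :: real and L :: nat
  assumes n: "0 < n" and a: "a = n / M\<^sup>2" and rho: "3 \<le> \<rho>" and M: "2 * (reach \<rho> + 1) \<le> M"
    and theta: "0 < \<theta>" "1 \<le> \<theta> * a" "2 \<le> \<theta> * n" and K: "0 < K"
    and r: "\<rho> * (sqrt n / M) \<le> r"
    and L: "(\<exists>B::nat. r \<le> B * (sqrt n / M) \<and> ((2 * B + 1)\<^sup>2 :: nat) \<le> L) \<or> (nat M)\<^sup>2 \<le> L"
    and H: "harm (nat M) \<le> H * (\<theta> * a)"
begin

lemma reach_pos: "0 \<le> reach \<rho>" using rho by (simp add: reach_def)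

lemma M_pos: "0 < M"
proof -
  have "0 < 2 * (reach \<rho> + 1)" using reach_pos by simp
  then show ?thesis using M by (rule less_le_trans)
qed

abbreviation "cell_of \<omega> v \<equiv> cidx n M (snd \<omega> v)"
abbreviation "occ \<omega> \<equiv> cell_pts (fst \<omega>) (cell_of \<omega>)"

text \<open>Sparse cells are controlled through the total count of a set \<open>T\<close>. This is
  one Poisson variable with mean \<open>a * card T\<close>, so a union bound over \<open>T\<close>
  keeps the sharp exponent. The first clause keeps all points inside the cells.\<close>

definition good :: "nat \<times> (nat \<Rightarrow> real^2) \<Rightarrow> bool" where
  "good \<omega> \<longleftrightarrow> count_in (cidx n M -` (- cells M)) \<omega> < 1 \<and>
     (\<forall>c\<in>cells M. \<forall>T. T \<subseteq> window M \<rho> c \<longrightarrow> card T = quads M \<rho> c * card (quarter \<rho>) \<longrightarrow>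
        \<theta> * a * card T < count_in (cidx n M -` T) \<omega>) \<and>
     (\<forall>p\<in>cells M. count_in (cidx n M -` {p}) \<omega> < K * a) \<and>
     \<theta> * n < real (fst \<omega>)"

lemma good_cell_graph:
  assumes g: "good \<omega>"
  shows "cell_graph M \<rho> (fst \<omega>) (cell_of \<omega>) (\<theta> * a) (rgg_adj r (snd \<omega>))"
proof
  show "3 \<le> \<rho>" "2 * (reach \<rho> + 1) \<le> M" "1 \<le> \<theta> * a" by (rule rho M theta)+
next
  fix v assume v: "v < fst \<omega>"
  show "cell_of \<omega> v \<in> cells M"
  proof (rule ccontr)
    assume "cell_of \<omega> v \<notin> cells M"
    then have "v \<in> {i. i < fst \<omega> \<and> snd \<omega> i \<in> cidx n M -` (- cells M)}" using v by simp
    then have "0 < count_in (cidx n M -` (- cells M)) \<omega>"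
      unfolding count_in_def by (subst card_gt_0_iff) auto
    then show False using g by (simp add: good_def)
  qed
next
  fix u v assume "u \<noteq> v" "cadj \<rho> (cell_of \<omega> u) (cell_of \<omega> v)"
  then show "rgg_adj r (snd \<omega>) u v"
    unfolding rgg_adj_def using cadj_dist[OF n M_pos _ _ r] rho by auto
next
  fix c assume c: "c \<in> cells M"
  define S where "S = {p \<in> window M \<rho> c. \<not> \<theta> * a \<le> real (card (occ \<omega> p))}"
  show "card {p \<in> window M \<rho> c. \<not> \<theta> * a \<le> real (card (occ \<omega> p))} < quads M \<rho> c * card (quarter \<rho>)"
  proof (rule ccontr)
    assume "\<not> ?thesis"
    then have "quads M \<rho> c * card (quarter \<rho>) \<le> card S" by (simp add: S_def)
    \<comment> \<open>A subset of exactly the critical size: its cells are all sparse, so its total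
      count is at most \<open>\<theta> * a * card T\<close>.\<close>
    then obtain T where T: "T \<subseteq> S" "card T = quads M \<rho> c * card (quarter \<rho>)" "finite T"
      by (rule obtain_subset_with_card_n)
    have "T \<subseteq> window M \<rho> c" using T by (auto simp: S_def)
    then have "\<theta> * a * card T < count_in (cidx n M -` T) \<omega>" using g c T by (simp add: good_def)
    also have "real (count_in (cidx n M -` T) \<omega>) = (\<Sum>p\<in>T. real (card (occ \<omega> p)))"
      by (simp add: count_in_vimage[OF T(3)])
    also have "\<dots> \<le> (\<Sum>p\<in>T. \<theta> * a)" using T by (intro sum_mono) (auto simp: S_def)
    finally show False by (simp add: mult.commute)
  qed
qed

lemma good_pts: "good \<omega> \<Longrightarrow> p \<in> cells M \<Longrightarrow> card (occ \<omega> p) \<le> K * a"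
  using count_in_vimage[of "{p}" "cidx n M" \<omega>] by (auto simp: good_def intro: less_imp_le)

lemma card_cells: "card (cells M) = (nat M)\<^sup>2"
  by (simp add: cells_def card_cartesian_product power2_eq_square)

lemma a_pos: "0 < a" using n M_pos by (simp add: a)

lemma pts_union:
  assumes g: "good \<omega>" and D: "D \<subseteq> cells M" "A \<subseteq> (\<Union>p\<in>D. occ \<omega> p)"
  shows "card A \<le> card D * (K * a)"
proof -
  have fD: "finite D" using D(1) finite_cells by (rule finite_subset)
  have "card A \<le> card (\<Union>p\<in>D. occ \<omega> p)"
    by (rule card_mono) (use D fD in \<open>auto simp: cell_pts_def\<close>)
  also have "\<dots> \<le> (\<Sum>p\<in>D. card (occ \<omega> p))" by (rule card_UN_le[OF fD])
  finally have "real (card A) \<le> (\<Sum>p\<in>D. real (card (occ \<omega> p)))"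
    unfolding of_nat_sum[symmetric] by (simp only: of_nat_le_iff)
  also have "\<dots> \<le> (\<Sum>p\<in>D. K * a)" using D by (intro sum_mono good_pts[OF g]) auto
  finally show ?thesis by simp
qed

lemma good_vertices: "good \<omega> \<Longrightarrow> real (fst \<omega>) \<le> K * n"
proof -
  assume g: "good \<omega>"
  interpret cell_graph M \<rho> "fst \<omega>" "cell_of \<omega>" "\<theta> * a" "rgg_adj r (snd \<omega>)"
    by (rule good_cell_graph[OF g])
  have "card {..<fst \<omega>} \<le> card (cells M) * (K * a)"
    by (rule pts_union[OF g]) (use idx_cells in \<open>auto simp: cell_pts_def\<close>)
  also have "\<dots> = K * n" using M_pos by (simp add: card_cells a)
  finally show ?thesis by simp
qed

text \<open>In both cases of \<open>L\<close> the neighbours lie in at most \<open>L\<close> cells,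
  none of them overfull.\<close>

lemma good_degree:
  assumes g: "good \<omega>" and v: "v < fst \<omega>"
  shows "card (nbs (fst \<omega>) (rgg_adj r (snd \<omega>)) v) \<le> (L * K / \<theta>) * (\<theta> * a)"
proof -
  interpret cell_graph M \<rho> "fst \<omega>" "cell_of \<omega>" "\<theta> * a" "rgg_adj r (snd \<omega>)"
    by (rule good_cell_graph[OF g])
  let ?A = "nbs (fst \<omega>) (rgg_adj r (snd \<omega>)) v"
  have "\<exists>D. D \<subseteq> cells M \<and> card D \<le> L \<and> ?A \<subseteq> (\<Union>p\<in>D. occ \<omega> p)"
    using L
  proof
    assume "(nat M)\<^sup>2 \<le> L"
    then show ?thesis using card_cells idx_cells
      by (intro exI[of _ "cells M"]) (auto simp: nbs_def cell_pts_def)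
  next
    assume "\<exists>B::nat. r \<le> B * (sqrt n / M) \<and> ((2 * B + 1)\<^sup>2 :: nat) \<le> L"
    then obtain B :: nat where B: "r \<le> B * (sqrt n / M)" "((2 * B + 1)\<^sup>2 :: nat) \<le> L" by auto
    obtain i j where ij: "cell_of \<omega> v = (i, j)" by fastforce
    define D where "D = cells M \<inter> {i - int B..i + int B} \<times> {j - int B..j + int B}"
    have "card D \<le> card ({i - int B..i + int B} \<times> {j - int B..j + int B})"
      unfolding D_def by (rule card_mono) auto
    also have "\<dots> = (2 * B + 1)\<^sup>2" by (simp add: card_cartesian_product power2_eq_square nat_add_distrib nat_mult_distrib)
    finally have cD: "card D \<le> L" using B by simp
    have "?A \<subseteq> (\<Union>p\<in>D. occ \<omega> p)"
    proof
      fix w assume w: "w \<in> ?A"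
      then have wN: "w < fst \<omega>" and "dist (snd \<omega> v) (snd \<omega> w) \<le> B * (sqrt n / M)"
        using B by (auto simp: nbs_def rgg_adj_def)
      from dist_cidx[OF n M_pos this(2)] have "cell_of \<omega> w \<in> D"
        using idx_cells[OF wN] unfolding ij by (cases "cell_of \<omega> w") (auto simp: D_def)
      then show "w \<in> (\<Union>p\<in>D. occ \<omega> p)" using wN by (auto simp: cell_pts_def)
    qed
    then show ?thesis using cD by (intro exI[of _ D]) (auto simp: D_def)
  qed
  then obtain D where D: "D \<subseteq> cells M" "card D \<le> L" "?A \<subseteq> (\<Union>p\<in>D. occ \<omega> p)" by auto
  have "card ?A \<le> card D * (K * a)" by (rule pts_union[OF g D(1,3)])
  also have "\<dots> \<le> L * (K * a)" using D K a_pos by (intro mult_right_mono) auto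
  finally show ?thesis using theta by simp
qed

lemma good_cover:
  assumes g: "good \<omega>"
  shows "cover_ok (cover_const \<rho> H \<theta> K L) (fst \<omega>) (rgg_cover_time r \<omega>)"
proof -
  interpret cell_graph M \<rho> "fst \<omega>" "cell_of \<omega>" "\<theta> * a" "rgg_adj r (snd \<omega>)"
    by (rule good_cell_graph[OF g])
  have "2 < real (fst \<omega>)" using g theta by (simp add: good_def)
  then have N: "2 \<le> fst \<omega>" by simp
  have sym: "rgg_adj r (snd \<omega>) u w = rgg_adj r (snd \<omega>) w u" for u w
    by (auto simp: rgg_adj_def dist_commute)
  show ?thesis
    unfolding cover_ok_def cover_const_def rgg_cover_time_def
    using cover_time_cell_graph[OF sym N H good_degree[OF g]] by blast
qed

text \<open>One term per clause of \<open>good\<close>. The power of 2 counts the subsets of a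
  window; the exponents are Chernoff rates with parameter \<open>z\<close> for the lower tails and
  \<open>exp 1\<close> for overfull cells.\<close>

definition err :: "real \<Rightarrow> real" where
  "err z = 1 / n + 2 ^ ((2 * nat (reach \<rho> + 1) + 1)\<^sup>2) *
       grid_sum M \<rho> (exp (- (a * (1 - z + \<theta> * ln z) * card (quarter \<rho>)))) +
     M\<^sup>2 * exp (a * (exp 1 - 1 - K)) + exp (- (n * (1 - z + \<theta> * ln z)))"

lemma good_prob:
  assumes z: "0 < z" "z \<le> 1" and I: "0 \<le> 1 - z + \<theta> * ln z"
  shows "{\<omega> \<in> space (PPP2 n). good \<omega>} \<in> sets (PPP2 n)"
    and "1 - err z \<le> measure (PPP2 n) {\<omega> \<in> space (PPP2 n). good \<omega>}"
proof -
  define \<mu> where "\<mu> = uniform_measure lborel (Lambda2 n)"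
  interpret poisson_process \<mu> "real n" unfolding \<mu>_def by (rule PPP2_poisson_process[OF n])
  have PP: "PPP2 n = proc" unfolding \<mu>_def by (rule PPP2_proc[OF n])
  have sets_mu: "sets \<mu> = sets borel" by (simp add: \<mu>_def)
  have vm: "cidx n M -` T \<in> sets \<mu>" if "T \<subseteq> cells M" for T
    using cells_measure(1)[OF n M_pos that] by (simp add: sets_mu)
  have pc: "prob (cidx n M -` T) = card T / M\<^sup>2" if "T \<subseteq> cells M" for T
    using prob_cells[OF n M_pos that] by (simp add: \<mu>_def)
  define Q where "Q = card (quarter \<rho>)"
  define J where "J = 1 - z + \<theta> * ln z"
  define \<beta> where "\<beta> = exp (- (a * J * Q))"
  define W where "W = (2 * nat (reach \<rho> + 1) + 1)\<^sup>2"
  define TT where "TT c = {T. T \<subseteq> window M \<rho> c \<and> card T = quads M \<rho> c * Q}" for c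
  have out: "cidx n M -` (- cells M) = space \<mu> - cidx n M -` cells M" by (auto simp: \<mu>_def)
  have outm: "cidx n M -` (- cells M) \<in> sets \<mu>" unfolding out using vm[of "cells M"] by blast
  have outp: "prob (cidx n M -` (- cells M)) = 0"
    unfolding out using vm[of "cells M"] pc[of "cells M"] M_pos by (simp add: prob_compl card_cells)
  have winc: "window M \<rho> c \<subseteq> cells M" for c by (auto simp: window_def)
  have TTc: "T \<subseteq> cells M" "finite T" if "T \<in> TT c" for T c
    using that winc[of c] finite_subset[OF _ finite_window[of M \<rho> c], of T] unfolding TT_def by blast+
  have finTT: "finite (TT c)" for c unfolding TT_def
    by (rule finite_subset[of _ "Pow (window M \<rho> c)"]) auto
  define B0 where "B0 = {\<omega> \<in> space proc. 1 \<le> real (count_in (cidx n M -` (- cells M)) \<omega>)}"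
  define B1 where "B1 c T = {\<omega> \<in> space proc. real (count_in (cidx n M -` T) \<omega>) \<le> \<theta> * a * card T}" for c :: "int \<times> int" and T
  define B2 where "B2 p = {\<omega> \<in> space proc. K * a \<le> real (count_in (cidx n M -` {p}) \<omega>)}" for p
  define B3 where "B3 = {\<omega> \<in> space proc. real (count_in (space \<mu>) \<omega>) \<le> \<theta> * n}"
  have m0: "B0 \<in> sets proc" unfolding B0_def using outm by measurable
  have m1: "B1 c T \<in> sets proc" if "T \<in> TT c" for c T
  proof -
    have [measurable]: "cidx n M -` T \<in> sets \<mu>" using vm TTc[OF that] by blast
    show ?thesis unfolding B1_def by measurable
  qed
  have m2: "B2 p \<in> sets proc" if "p \<in> cells M" for p
  proof -
    have [measurable]: "cidx n M -` {p} \<in> sets \<mu>" using vm that by blast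
    show ?thesis unfolding B2_def by measurable
  qed
  have m3: "B3 \<in> sets proc" unfolding B3_def by measurable
  have p0: "measure proc B0 \<le> 1 / n"
  proof -
    \<comment> \<open>The set has probability 0, so the Chernoff bound is \<open>1 / z\<close> for
      any \<open>z \<ge> 1\<close>; \<open>z = n\<close> suffices.\<close>
    have "measure proc B0 \<le> exp (n * prob (cidx n M -` (- cells M)) * (real n - 1) - 1 * ln n)"
      unfolding B0_def by (rule count_upper_tail[OF outm]) (use n in auto)
    also have "\<dots> = 1 / n" using n by (simp add: outp exp_minus inverse_eq_divide)
    finally show ?thesis .
  qed
  have p1: "measure proc (B1 c T) \<le> \<beta> ^ quads M \<rho> c" if "T \<in> TT c" for c T
  proof -
    have "measure proc (B1 c T) \<le> exp (n * prob (cidx n M -` T) * (z - 1) - \<theta> * a * card T * ln z)"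
      unfolding B1_def by (rule count_lower_tail) (use vm TTc[OF that] z in auto)
    also have "n * prob (cidx n M -` T) * (z - 1) - \<theta> * a * card T * ln z = - (a * J * card T)"
    proof -
      have e: "n * prob (cidx n M -` T) = a * card T" using pc[OF TTc(1)[OF that]] by (simp add: a)
      show ?thesis unfolding e J_def by (simp add: algebra_simps)
    qed
    also have "\<dots> = quads M \<rho> c * (- (a * J * Q))" using that by (simp add: TT_def)
    finally show ?thesis by (simp only: \<beta>_def exp_of_nat_mult)
  qed
  have p2: "measure proc (B2 p) \<le> exp (a * (exp 1 - 1 - K))" if "p \<in> cells M" for p
  proof -
    have "measure proc (B2 p) \<le> exp (n * prob (cidx n M -` {p}) * (exp 1 - 1) - K * a * ln (exp 1))"
      unfolding B2_def by (rule count_upper_tail) (use vm that in auto)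
    also have "n * prob (cidx n M -` {p}) * (exp 1 - 1) - K * a * ln (exp 1) = a * (exp 1 - 1 - K)"
    proof -
      have e: "n * prob (cidx n M -` {p}) = a" using pc[of "{p}"] that by (simp add: a)
      show ?thesis unfolding e by (simp add: algebra_simps)
    qed
    finally show ?thesis .
  qed
  have p3: "measure proc B3 \<le> exp (- (n * J))"
  proof -
    have "measure proc B3 \<le> exp (n * prob (space \<mu>) * (z - 1) - \<theta> * n * ln z)"
      unfolding B3_def by (rule count_lower_tail) (use z in auto)
    also have "n * prob (space \<mu>) * (z - 1) - \<theta> * n * ln z = - (n * J)"
      by (simp add: prob_space J_def algebra_simps)
    finally show ?thesis .
  qed
  define U1 where "U1 = (\<Union>c\<in>cells M. \<Union>T\<in>TT c. B1 c T)"
  define U2 where "U2 = (\<Union>p\<in>cells M. B2 p)"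
  have U1: "U1 \<in> sets proc" unfolding U1_def by (intro sets.finite_UN finite_cells finTT m1)
  have U2: "U2 \<in> sets proc" unfolding U2_def by (intro sets.finite_UN finite_cells m2)
  have pU1: "measure proc U1 \<le> 2 ^ W * grid_sum M \<rho> \<beta>"
  proof -
    have "measure proc U1 \<le> (\<Sum>c\<in>cells M. measure proc (\<Union>T\<in>TT c. B1 c T))"
      unfolding U1_def by (rule measure_UNION_le[OF finite_cells]) (intro sets.finite_UN finTT m1)
    also have "\<dots> \<le> (\<Sum>c\<in>cells M. 2 ^ W * \<beta> ^ quads M \<rho> c)"
    proof (rule sum_mono)
      fix c
      have "card (TT c) \<le> card (Pow (window M \<rho> c))"
        unfolding TT_def by (rule card_mono) auto
      also have "\<dots> = 2 ^ card (window M \<rho> c)" by (simp add: card_Pow)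
      also have "\<dots> \<le> 2 ^ W" unfolding W_def by (intro power_increasing card_window) auto
      finally have "real (card (TT c)) \<le> real (2 ^ W)" by (simp only: of_nat_le_iff)
      then have cT: "real (card (TT c)) \<le> 2 ^ W" by simp
      have "measure proc (\<Union>T\<in>TT c. B1 c T) \<le> (\<Sum>T\<in>TT c. measure proc (B1 c T))"
        by (rule measure_UNION_le[OF finTT m1])
      also have "\<dots> \<le> (\<Sum>T\<in>TT c. \<beta> ^ quads M \<rho> c)" by (intro sum_mono p1)
      also have "\<dots> = card (TT c) * \<beta> ^ quads M \<rho> c" by simp
      also have "\<dots> \<le> 2 ^ W * \<beta> ^ quads M \<rho> c"
        using cT by (intro mult_right_mono) (auto simp: \<beta>_def)
      finally show "measure proc (\<Union>T\<in>TT c. B1 c T) \<le> 2 ^ W * \<beta> ^ quads M \<rho> c" .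
    qed
    also have "\<dots> = 2 ^ W * (\<Sum>c\<in>cells M. \<beta> ^ quads M \<rho> c)" by (simp add: sum_distrib_left)
    also have "\<dots> \<le> 2 ^ W * grid_sum M \<rho> \<beta>"
    proof (intro mult_left_mono quads_sum M reach_pos)
      show "\<beta> \<le> 1" using a_pos I by (simp add: \<beta>_def J_def)
    qed (auto simp: \<beta>_def)
    finally show ?thesis .
  qed
  have pU2: "measure proc U2 \<le> M\<^sup>2 * exp (a * (exp 1 - 1 - K))"
  proof -
    have "measure proc U2 \<le> (\<Sum>p\<in>cells M. measure proc (B2 p))"
      unfolding U2_def by (rule measure_UNION_le) (use m2 in auto)
    also have "\<dots> \<le> (\<Sum>p\<in>cells M. exp (a * (exp 1 - 1 - K)))" by (intro sum_mono p2)
    also have "\<dots> = M\<^sup>2 * exp (a * (exp 1 - 1 - K))" using M_pos by (simp add: card_cells)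
    finally show ?thesis .
  qed
  have cs: "count_in (space \<mu>) \<omega> = fst \<omega>" for \<omega>
    by (simp add: count_in_def \<mu>_def)
  have good_eq: "{\<omega> \<in> space proc. good \<omega>} = space proc - (B0 \<union> U1 \<union> U2 \<union> B3)"
  proof (intro set_eqI iffI)
    fix \<omega> assume w: "\<omega> \<in> {\<omega> \<in> space proc. good \<omega>}"
    then have g: "good \<omega>" by simp
    have "\<omega> \<notin> U1"
    proof
      assume "\<omega> \<in> U1"
      then obtain c T where c: "c \<in> cells M" "T \<in> TT c" "\<omega> \<in> B1 c T" by (auto simp: U1_def)
      then have "T \<subseteq> window M \<rho> c" "card T = quads M \<rho> c * card (quarter \<rho>)" by (auto simp: TT_def Q_def)
      then have "\<theta> * a * card T < count_in (cidx n M -` T) \<omega>" using g c(1) unfolding good_def by blast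
      then show False using c(3) by (simp add: B1_def)
    qed
    moreover have "\<omega> \<notin> B0" "\<omega> \<notin> B3"
      using g by (simp_all add: B0_def B3_def cs good_def)
    moreover have "\<omega> \<notin> U2"
    proof
      assume "\<omega> \<in> U2"
      then obtain p where "p \<in> cells M" "\<omega> \<in> B2 p" unfolding U2_def by blast
      then show False using g by (auto simp: B2_def good_def)
    qed
    ultimately show "\<omega> \<in> space proc - (B0 \<union> U1 \<union> U2 \<union> B3)" using w by simp
  next
    fix \<omega> assume w: "\<omega> \<in> space proc - (B0 \<union> U1 \<union> U2 \<union> B3)"
    have "\<theta> * a * card T < count_in (cidx n M -` T) \<omega>"
      if "c \<in> cells M" "T \<subseteq> window M \<rho> c" "card T = quads M \<rho> c * card (quarter \<rho>)" for c T
    proof -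
      have "T \<in> TT c" using that by (simp add: TT_def Q_def)
      then have "\<omega> \<notin> B1 c T" using w that by (auto simp: U1_def)
      then show ?thesis using w by (simp add: B1_def)
    qed
    moreover have "count_in (cidx n M -` (- cells M)) \<omega> < 1" "\<theta> * n < real (fst \<omega>)"
      using w by (auto simp: B0_def B3_def cs)
    moreover have "count_in (cidx n M -` {p}) \<omega> < K * a" if "p \<in> cells M" for p
    proof -
      have "\<omega> \<notin> B2 p" using w that unfolding U2_def by blast
      then show ?thesis using w by (simp add: B2_def)
    qed
    ultimately have "good \<omega>" unfolding good_def by blast
    then show "\<omega> \<in> {\<omega> \<in> space proc. good \<omega>}" using w by simp
  qed
  have bm: "B0 \<union> U1 \<union> U2 \<union> B3 \<in> sets proc" using m0 U1 U2 m3 by auto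
  show "{\<omega> \<in> space (PPP2 n). good \<omega>} \<in> sets (PPP2 n)" unfolding PP good_eq using bm by auto
  have "measure proc (B0 \<union> U1 \<union> U2 \<union> B3) \<le> measure proc B0 + measure proc U1 + measure proc U2 + measure proc B3"
  proof -
    have "measure proc (B0 \<union> U1 \<union> U2 \<union> B3) \<le> measure proc (B0 \<union> U1 \<union> U2) + measure proc B3"
      by (rule measure_Un_le) (use m0 U1 U2 m3 in auto)
    moreover have "measure proc (B0 \<union> U1 \<union> U2) \<le> measure proc (B0 \<union> U1) + measure proc U2"
      by (rule measure_Un_le) (use m0 U1 U2 in auto)
    moreover have "measure proc (B0 \<union> U1) \<le> measure proc B0 + measure proc U1"
      by (rule measure_Un_le) (use m0 U1 in auto)
    ultimately show ?thesis by linarith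
  qed
  also have "\<dots> \<le> err z"
    using p0 pU1 pU2 p3 unfolding err_def \<beta>_def J_def Q_def W_def by linarith
  finally show "1 - err z \<le> measure (PPP2 n) {\<omega> \<in> space (PPP2 n). good \<omega>}"
    unfolding PP good_eq using procP.prob_compl[OF bm] by linarith
qed

end

section \<open>Asymptotics\<close>

lemma harm_le_ln: "0 < n \<Longrightarrow> harm n \<le> 1 + ln (real n)"
proof -
  assume "0 < n"
  then obtain m where m: "n = Suc m" by (cases n) auto
  have "harm (Suc m) - ln (real (Suc m)) \<le> harm (Suc 0) - ln (real (Suc 0))"
    using decseqD[OF decseq_harm_diff_ln, of 0 m] by simp
  then show ?thesis by (simp add: m harm_def)
qed

lemma grid_sum_mono:
  fixes \<beta> \<beta>' n :: real
  assumes "0 \<le> \<beta>" "\<beta> \<le> \<beta>'" "0 \<le> reach \<rho>" "0 \<le> M" "real_of_int M \<le> sqrt n"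
  shows "grid_sum M \<rho> \<beta> \<le> n * \<beta>' ^ 4 + 4 * real_of_int (reach \<rho>) * sqrt n * \<beta>'\<^sup>2 +
    4 * (real_of_int (reach \<rho>))\<^sup>2 * \<beta>'"
proof -
  have n: "0 \<le> sqrt n" using assms by linarith
  have "(real_of_int M)\<^sup>2 \<le> (sqrt n)\<^sup>2" using assms by (intro power_mono) auto
  then have "(real_of_int M)\<^sup>2 \<le> n" using n by simp
  then have "(real_of_int M)\<^sup>2 * \<beta> ^ 4 \<le> n * \<beta>' ^ 4"
    using assms n by (intro mult_mono power_mono) auto
  moreover have "4 * real_of_int (reach \<rho>) * real_of_int M * \<beta>\<^sup>2 \<le> 4 * real_of_int (reach \<rho>) * sqrt n * \<beta>'\<^sup>2"
    using assms n by (intro mult_mono power_mono mult_nonneg_nonneg) auto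
  moreover have "4 * (real_of_int (reach \<rho>))\<^sup>2 * \<beta> \<le> 4 * (real_of_int (reach \<rho>))\<^sup>2 * \<beta>'"
    using assms by (simp add: mult_left_mono)
  ultimately show ?thesis unfolding grid_sum_def by linarith
qed

lemma cover_const_nonneg: "0 < \<theta> \<Longrightarrow> 0 \<le> K \<Longrightarrow> 0 \<le> cover_const \<rho> H \<theta> K L"
  by (simp add: cover_const_def resist_const_def)

text \<open>Three losses of a factor \<open>1 - \<delta>\<close> each must fit into
  \<open>1 + \<epsilon>\<close>: counting cells instead of area (\<rho> large), rounding the number
  of cells (\<open>c\<close> small), and the Chernoff rate. For the rate,
  \<open>z = \<delta> / 2\<close> and \<open>\<theta> * ln z = - z\<close> make it
  \<open>1 - \<delta>\<close>. By the choice of \<delta>, \<open>(1 - \<delta>)^3 \<ge> 1 - 4 *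
  \<delta> = 1 / (1 + \<epsilon>)\<close>.\<close>

lemma constants_exist:
  fixes \<epsilon> :: real
  assumes "0 < \<epsilon>"
  obtains \<rho> :: int and z \<theta> c :: real
  where "3 \<le> \<rho>" "0 < z" "z \<le> 1" "0 < \<theta>" "0 < 1 - z + \<theta> * ln z" "0 < c" "c \<le> 1" "2 * (reach \<rho> + 1) * c \<le> \<rho>"
    "pi * (real_of_int \<rho>)\<^sup>2 * (1 + c)\<^sup>2 \<le> (1 + \<epsilon>) * (4 * card (quarter \<rho>) * (1 - z + \<theta> * ln z))"
proof -
  define \<delta> where "\<delta> = \<epsilon> / (1 + \<epsilon>) / 4"
  have d: "0 < \<delta>" "\<delta> < 1/4" using assms by (auto simp: \<delta>_def field_simps)
  have g: "1 - 4 * \<delta> = 1 / (1 + \<epsilon>)" using assms by (simp add: \<delta>_def field_simps)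
  define \<rho> where "\<rho> = max 3 \<lceil>16 / (pi * \<delta>)\<rceil>"
  have "\<lceil>16 / (pi * \<delta>)\<rceil> \<le> \<rho>" by (simp add: \<rho>_def)
  then have rho: "3 \<le> \<rho>" "16 / (pi * \<delta>) \<le> real_of_int \<rho>"
    unfolding ceiling_le_iff by (simp_all add: \<rho>_def)
  have r16: "16 \<le> \<delta> * (pi * \<rho>)" using rho(2) d by (simp add: field_simps)
  define z where "z = \<delta> / 2"
  have z: "0 < z" "z < 1" using d by (auto simp: z_def)
  define \<theta> where "\<theta> = z / (- ln z)"
  have lz: "ln z < 0" using z by simp
  have th: "0 < \<theta>" "\<theta> * ln z = - z" using z lz by (auto simp: \<theta>_def divide_pos_neg)
  have I: "1 - z + \<theta> * ln z = 1 - \<delta>" using th by (simp add: z_def)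
  have R: "0 \<le> reach \<rho>" using rho by (simp add: reach_def)
  define c where "c = min (\<delta> / 2) (\<rho> / (2 * (reach \<rho> + 1)))"
  have c: "0 < c" "c \<le> \<delta> / 2" "c \<le> \<rho> / (2 * (reach \<rho> + 1))"
  proof -
    show "0 < c" using d rho R unfolding c_def by (simp add: min_less_iff_conj)
    show "c \<le> \<delta> / 2" "c \<le> \<rho> / (2 * (reach \<rho> + 1))" unfolding c_def by (rule min.cobounded1 min.cobounded2)+
  qed
  have c2: "(1 - \<delta>) * (1 + c)\<^sup>2 \<le> 1"
  proof -
    have "(1 + c)\<^sup>2 \<le> (1 + \<delta> / 2)\<^sup>2" using c by (intro power_mono) auto
    then have "(1 - \<delta>) * (1 + c)\<^sup>2 \<le> (1 - \<delta>) * (1 + \<delta> / 2)\<^sup>2" using d by (intro mult_left_mono) auto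
    also have "\<dots> = 1 - (3/4) * \<delta>\<^sup>2 - \<delta> * \<delta>\<^sup>2 / 4" by (simp add: power2_eq_square field_simps)
    also have "\<dots> \<le> 1"
    proof -
      have "0 \<le> \<delta>\<^sup>2" "0 \<le> \<delta> * \<delta>\<^sup>2" using d by auto
      then show ?thesis by linarith
    qed
    finally show ?thesis .
  qed
  have Q: "(1 - \<delta>) * (pi * (real_of_int \<rho>)\<^sup>2) \<le> 4 * card (quarter \<rho>)"
  proof -
    have "16 * real_of_int \<rho> \<le> \<delta> * (pi * \<rho>) * \<rho>" using r16 rho by (intro mult_right_mono) auto
    then have "16 * real_of_int \<rho> \<le> \<delta> * (pi * (real_of_int \<rho>)\<^sup>2)" by (simp add: power2_eq_square mult.assoc)
    then show ?thesis using quarter_count[of \<rho>] rho by (simp add: left_diff_distrib)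
  qed
  have P: "0 \<le> pi * (real_of_int \<rho>)\<^sup>2" by simp
  have "pi * (real_of_int \<rho>)\<^sup>2 * (1 + c)\<^sup>2 * (1 - 4 * \<delta>) \<le> pi * (real_of_int \<rho>)\<^sup>2 * (1 + c)\<^sup>2 * (1 - \<delta>)^3"
  proof (intro mult_left_mono mult_nonneg_nonneg P)
    have "(1 - \<delta>)^3 = 1 - 3 * \<delta> + 3 * \<delta>\<^sup>2 - \<delta> * \<delta>\<^sup>2" by (simp add: power2_eq_square power3_eq_cube algebra_simps)
    moreover have "\<delta> * \<delta>\<^sup>2 \<le> 1 * \<delta>\<^sup>2" using d by (intro mult_right_mono) auto
    moreover have "0 \<le> \<delta>\<^sup>2" by simp
    ultimately show "1 - 4 * \<delta> \<le> (1 - \<delta>)^3" using d by linarith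
  qed simp_all
  also have "\<dots> = ((1 - \<delta>) * (pi * (real_of_int \<rho>)\<^sup>2)) * ((1 - \<delta>) * (1 + c)\<^sup>2) * (1 - \<delta>)"
    by (simp add: power3_eq_cube)
  also have "\<dots> \<le> real (4 * card (quarter \<rho>)) * 1 * (1 - \<delta>)"
  proof (rule mult_right_mono)
    show "((1 - \<delta>) * (pi * (real_of_int \<rho>)\<^sup>2)) * ((1 - \<delta>) * (1 + c)\<^sup>2) \<le> real (4 * card (quarter \<rho>)) * 1"
      by (rule mult_mono[OF Q c2]) (use d in auto)
  qed (use d in simp)
  finally have "pi * (real_of_int \<rho>)\<^sup>2 * (1 + c)\<^sup>2 / (1 + \<epsilon>) \<le> 4 * card (quarter \<rho>) * (1 - \<delta>)"
    by (simp add: g)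
  then have "pi * (real_of_int \<rho>)\<^sup>2 * (1 + c)\<^sup>2 \<le> (1 + \<epsilon>) * (4 * card (quarter \<rho>) * (1 - \<delta>))"
    using assms by (simp add: pos_divide_le_eq mult.commute)
  moreover have "2 * (reach \<rho> + 1) * c \<le> \<rho>"
    using c(3) R by (simp add: pos_le_divide_eq mult.commute)
  ultimately show ?thesis
    using that[of \<rho> z \<theta> c] rho z th I c d by auto
qed

text \<open>Truncating the radius at \<open>c * sqrt n\<close> keeps \<open>M\<close> at least
  \<open>\<rho> / c\<close>, so windows fit into the grid and rounding \<open>M\<close> up loses at
  most a factor \<open>1 + c\<close>. If the truncation is active, \<open>M\<close> is bounded
  instead of \<open>r\<close> being comparable to the cell side.\<close>

lemma grid_choice:
  fixes n :: nat and r rr \<epsilon> c :: real and \<rho> :: int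
  assumes n: "0 < n" and c: "0 < c" "c \<le> 1" and rho: "3 \<le> \<rho>"
    and rr: "rr = min r (c * sqrt n)" "0 < rr" and reach: "2 * (reach \<rho> + 1) * c \<le> \<rho>"
  defines "M \<equiv> \<lceil>sqrt n * \<rho> / rr\<rceil>"
  shows "2 * (reach \<rho> + 1) \<le> M" "\<rho> * (sqrt n / M) \<le> r" "rr\<^sup>2 \<le> (n / (real_of_int M)\<^sup>2) * ((real_of_int \<rho>)\<^sup>2 * (1 + c)\<^sup>2)"
    "r \<le> real (nat (2 * \<rho>)) * (sqrt n / M) \<or> real_of_int M \<le> \<rho> / c + 1" "0 < M"
proof -
  have sn: "0 < sqrt n" using n by simp
  have rc: "rr \<le> c * sqrt n" "rr \<le> r" using rr by auto
  have Ml: "sqrt n * \<rho> / rr \<le> M" by (simp add: M_def)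
  have Mu: "M \<le> sqrt n * \<rho> / rr + 1" by (simp add: M_def)
  have pos: "0 < sqrt n * \<rho> / rr" using sn rho rr by simp
  then show M0: "0 < M" by (simp add: M_def)
  have "\<rho> / c \<le> sqrt n * \<rho> / rr"
  proof -
    have "\<rho> * rr \<le> \<rho> * (c * sqrt n)" using rc rho by (intro mult_left_mono) auto
    then show ?thesis using rr(2) c by (simp add: field_simps)
  qed
  then have "\<rho> / c \<le> M" using Ml by linarith
  moreover have "2 * (reach \<rho> + 1) \<le> \<rho> / c" using reach c by (simp add: pos_le_divide_eq)
  ultimately have "real_of_int (2 * (reach \<rho> + 1)) \<le> real_of_int M" by simp
  then show "2 * (reach \<rho> + 1) \<le> M" by (simp only: of_int_le_iff)
  have "sqrt n * \<rho> \<le> M * rr" using Ml rr(2) by (simp add: pos_divide_le_eq)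
  then have "\<rho> * (sqrt n / M) \<le> rr" using M0 by (simp add: field_simps)
  then show "\<rho> * (sqrt n / M) \<le> r" using rc by linarith
  have "M * rr \<le> sqrt n * \<rho> + rr"
  proof -
    have "M * rr \<le> (sqrt n * \<rho> / rr + 1) * rr" using Mu rr(2) by (intro mult_right_mono) auto
    then show ?thesis using rr(2) by (simp add: distrib_right)
  qed
  also have "rr \<le> sqrt n * \<rho> * c"
  proof -
    have "c * sqrt n * 1 \<le> c * sqrt n * \<rho>" using rho c by (intro mult_left_mono) auto
    then show ?thesis using rc by (simp add: mult.commute mult.left_commute)
  qed
  finally have "M * rr \<le> sqrt n * (\<rho> * (1 + c))" by (simp add: algebra_simps)
  then have key: "rr \<le> (sqrt n / M) * (\<rho> * (1 + c))" using M0 by (simp add: field_simps)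
  then have "rr\<^sup>2 \<le> ((sqrt n / M) * (\<rho> * (1 + c)))\<^sup>2" using rr(2) by (intro power_mono) auto
  then show "rr\<^sup>2 \<le> (n / (real_of_int M)\<^sup>2) * ((real_of_int \<rho>)\<^sup>2 * (1 + c)\<^sup>2)"
    by (simp add: power_mult_distrib power_divide)
  show "r \<le> real (nat (2 * \<rho>)) * (sqrt n / M) \<or> real_of_int M \<le> \<rho> / c + 1"
  proof (cases "r \<le> c * sqrt n")
    case True
    then have "r = rr" using rr by simp
    also have "rr \<le> (sqrt n / M) * (\<rho> * (1 + c))" by (rule key)
    also have "\<dots> \<le> (sqrt n / M) * (\<rho> * 2)" using c rho M0 by (intro mult_left_mono) auto
    also have "\<dots> = real (nat (2 * \<rho>)) * (sqrt n / M)" using rho by simp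
    finally show ?thesis by simp
  next
    case False
    then have "rr = c * sqrt n" using rr by simp
    then have "sqrt n * \<rho> / rr = \<rho> / c" using sn by simp
    then show ?thesis using Mu by simp
  qed
qed

theorem theorem2:
  fixes \<epsilon> :: real and r :: "nat \<Rightarrow> real"
  assumes "\<epsilon> > 0"
    and "eventually (\<lambda>n. r n \<ge> (1 + \<epsilon>) * r_c2 n) sequentially"
  shows "\<exists>c C. 0 < c \<and> 0 < C \<and>
    (\<lambda>n. measure (PPP2 n)
        {\<omega> \<in> space (PPP2 n).
           ennreal (c * real n * ln (real n)) \<le> rgg_cover_time (r n) \<omega> \<and>
           rgg_cover_time (r n) \<omega> \<le> ennreal (C * real n * ln (real n))})
    \<longlonglongrightarrow> 1"
proof -
  obtain \<rho> :: int and z \<theta> c :: real where rho: "3 \<le> \<rho>" and z: "0 < z" "z \<le> 1" and th: "0 < \<theta>"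
    and I: "0 < 1 - z + \<theta> * ln z" and c: "0 < c" "c \<le> 1" and rch: "2 * (reach \<rho> + 1) * c \<le> \<rho>"
    and key: "pi * (real_of_int \<rho>)\<^sup>2 * (1 + c)\<^sup>2 \<le> (1 + \<epsilon>) * (4 * card (quarter \<rho>) * (1 - z + \<theta> * ln z))"
    using constants_exist[OF assms(1)] by metis
  define J where "J = 1 - z + \<theta> * ln z"
  define Q where "Q = real (card (quarter \<rho>))"
  \<comment> \<open>Chosen so that the mean cell occupancy is at least
    \<open>\<alpha> * ln n\<close>. The radius enters squared: one factor
    \<open>1 + \<epsilon>\<close> is spent on \<open>key\<close>, the other survives in
    \<open>alJQ\<close>.\<close>
  define \<alpha> where "\<alpha> = (1 + \<epsilon>)\<^sup>2 / (pi * (real_of_int \<rho>)\<^sup>2 * (1 + c)\<^sup>2)"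
  have P: "0 < pi * (real_of_int \<rho>)\<^sup>2 * (1 + c)\<^sup>2" using rho c by simp
  have al: "0 < \<alpha>" unfolding \<alpha>_def using assms(1) P by (intro divide_pos_pos) auto
  have alJQ: "(1 + \<epsilon>) / 4 \<le> \<alpha> * J * Q"
  proof -
    have "(1 + \<epsilon>) * (pi * (real_of_int \<rho>)\<^sup>2 * (1 + c)\<^sup>2) \<le> (1 + \<epsilon>) * ((1 + \<epsilon>) * (4 * Q * J))"
      using key assms(1) unfolding Q_def J_def by (intro mult_left_mono) auto
    also have "\<dots> = 4 * ((1 + \<epsilon>)\<^sup>2 * J * Q)" by (simp add: power2_eq_square mult_ac)
    finally have "(1 + \<epsilon>) / 4 * (pi * (real_of_int \<rho>)\<^sup>2 * (1 + c)\<^sup>2) \<le> (1 + \<epsilon>)\<^sup>2 * J * Q" by simp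
    then have "(1 + \<epsilon>) / 4 \<le> (1 + \<epsilon>)\<^sup>2 * J * Q / (pi * (real_of_int \<rho>)\<^sup>2 * (1 + c)\<^sup>2)"
      by (simp only: pos_le_divide_eq[OF P])
    then show ?thesis by (simp add: \<alpha>_def)
  qed
  have Rp: "0 \<le> reach \<rho>" using rho by (simp add: reach_def)
  \<comment> \<open>Makes the probability of an overfull cell at most \<open>1 / n^2\<close>, enough
    for the at most \<open>n\<close> cells.\<close>
  define K where "K = exp 1 - 1 + 2 / \<alpha>"
  have K: "0 < K" using al by (simp add: K_def add_pos_pos)
  \<comment> \<open>From \<open>harm M \<le> 1 + ln n \<le> 2 * ln n\<close> and
    \<open>a \<ge> \<alpha> * ln n\<close>.\<close>
  define H where "H = 2 / (\<alpha> * \<theta>)"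
  define L where "L = max ((2 * nat (2 * \<rho>) + 1)\<^sup>2) ((nat \<lceil>\<rho> / c + 1\<rceil>)\<^sup>2)"
  define C where "C = cover_const \<rho> H \<theta> K L"
  have C0: "0 \<le> C" unfolding C_def using th K by (intro cover_const_nonneg) auto
  define rr where "rr n = min (r n) (c * sqrt (real n))" for n
  define M where "M n = \<lceil>sqrt (real n) * \<rho> / rr n\<rceil>" for n
  define a where "a n = n / (real_of_int (M n))\<^sup>2" for n :: nat
  \<comment> \<open>That is \<open>n\<close> to the power \<open>-(1 + \<epsilon>) / 4\<close>: then
    \<open>n * b^4\<close>, \<open>sqrt n * b^2\<close> and \<open>b\<close> all tend to 0.\<close>
  define b where "b n = exp (- ((1 + \<epsilon>) / 4 * ln (real n)))" for n :: nat
  define W where "W = (2 * nat (reach \<rho> + 1) + 1)\<^sup>2"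
  define err' where "err' n = 1 / n + 2 ^ W * (n * b n ^ 4 + 4 * real_of_int (reach \<rho>) * sqrt n * (b n)\<^sup>2 + 4 * (real_of_int (reach \<rho>))\<^sup>2 * b n)
      + 1 / n + exp (- (n * J))" for n :: nat
  \<comment> \<open>The lower bound of \<open>cover_ok\<close> at the guaranteed number of vertices
    \<open>\<theta> * n\<close>. Halving its leading constant \<open>\<theta> / 8\<close> absorbs
    the lower-order terms.\<close>
  define low where "low n = \<theta> * n / 8 * (ln (\<theta> * n / (8 * C + 2)) - 1)" for n :: nat
  define S where "S n = {\<omega> \<in> space (PPP2 n).
      ennreal (\<theta> / 16 * real n * ln (real n)) \<le> rgg_cover_time (r n) \<omega> \<and>
      rgg_cover_time (r n) \<omega> \<le> ennreal ((2 * C * K + 1) * real n * ln (real n))}" for n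
  have C2: "0 < 8 * C + 2" using C0 by simp
  \<comment> \<open>The truncation of the radius must not push it below the threshold.\<close>
  have ev_c: "\<forall>\<^sub>F n in sequentially. (1 + \<epsilon>) * r_c2 n \<le> c * sqrt (real n)"
    unfolding r_c2_def using c assms(1) by real_asymp
  have ev_a: "\<forall>\<^sub>F n::nat in sequentially. 1 \<le> \<alpha> * ln n \<and> 1 \<le> \<theta> * (\<alpha> * ln n) \<and> 2 \<le> \<theta> * n \<and> 1 \<le> ln (real n)"
    using al th by (intro eventually_conj) real_asymp+
  have ev_low: "\<forall>\<^sub>F n::nat in sequentially. \<theta> / 16 * n * ln n \<le> low n \<and> 0 \<le> ln (\<theta> * n / (8 * C + 2)) - 1"
    unfolding low_def using th C2 by (intro eventually_conj) real_asymp+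
  have ev_up: "\<forall>\<^sub>F n::nat in sequentially. 1 + ln (K * n) \<le> 2 * ln n"
    using K by real_asymp
  have main: "\<forall>\<^sub>F n in sequentially. 1 - err' n \<le> measure (PPP2 n) (S n)"
    using assms(2) ev_c ev_a ev_low ev_up eventually_gt_at_top[of 0]
  proof eventually_elim
    case (elim n)
    have n: "0 < n" and ln1: "1 \<le> ln (real n)" using elim by auto
    have rc0: "0 < (1 + \<epsilon>) * r_c2 n" using assms(1) ln1 by (simp add: r_c2_def)
    have rr0: "(1 + \<epsilon>) * r_c2 n \<le> rr n" "0 < rr n" using elim rc0 by (auto simp: rr_def)
    note gc = grid_choice[OF n c rho rr_def[of n] rr0(2) rch, folded M_def]
    have aln: "\<alpha> * ln n \<le> a n"
    proof -
      have "((1 + \<epsilon>) * r_c2 n)\<^sup>2 \<le> (rr n)\<^sup>2" using rr0 rc0 by (intro power_mono) auto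
      also have "((1 + \<epsilon>) * r_c2 n)\<^sup>2 = (1 + \<epsilon>)\<^sup>2 * (ln n / pi)"
        using ln1 by (simp add: r_c2_def power_mult_distrib)
      finally have "(1 + \<epsilon>)\<^sup>2 * (ln n / pi) \<le> a n * ((real_of_int \<rho>)\<^sup>2 * (1 + c)\<^sup>2)"
        using gc(3) by (simp add: a_def)
      then have "(1 + \<epsilon>)\<^sup>2 * ln n \<le> a n * (pi * (real_of_int \<rho>)\<^sup>2 * (1 + c)\<^sup>2)"
        by (simp add: field_simps)
      then have "(1 + \<epsilon>)\<^sup>2 * ln n / (pi * (real_of_int \<rho>)\<^sup>2 * (1 + c)\<^sup>2) \<le> a n"
        by (simp only: pos_divide_le_eq[OF P])
      then show ?thesis by (simp add: \<alpha>_def)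
    qed
    then have a1: "1 \<le> a n" using elim by linarith
    have Msq: "(real_of_int (M n))\<^sup>2 \<le> n"
      using a1 gc(5) by (simp add: a_def pos_le_divide_eq)
    have Mn: "real_of_int (M n) \<le> sqrt n" using Msq by (rule real_le_rsqrt)
    have "harm (nat (M n)) \<le> H * (\<theta> * a n)"
    proof -
      have "real (nat (M n)) \<le> n"
      proof -
        have "1 \<le> real_of_int (M n)" using gc(5) by simp
        then have "real_of_int (M n) * 1 \<le> (real_of_int (M n))\<^sup>2"
          unfolding power2_eq_square by (intro mult_left_mono) auto
        then have "real_of_int (M n) \<le> n" using Msq by linarith
        then show ?thesis using gc(5) by simp
      qed
      then have "ln (real (nat (M n))) \<le> ln n" using gc(5) by (intro ln_mono) auto
      then have "harm (nat (M n)) \<le> 2 * ln n"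
        using harm_le_ln[of "nat (M n)"] gc(5) ln1 by simp
      also have "\<dots> = H * (\<theta> * (\<alpha> * ln n))" using th al by (simp add: H_def)
      also have "\<dots> \<le> H * (\<theta> * a n)"
        using aln th al by (intro mult_left_mono) (auto simp: H_def)
      finally show ?thesis .
    qed
    moreover have "1 \<le> \<theta> * a n"
    proof -
      have "\<theta> * (\<alpha> * ln n) \<le> \<theta> * a n" using aln th by (intro mult_left_mono) auto
      then show ?thesis using elim by linarith
    qed
    moreover have "(\<exists>B::nat. r n \<le> B * (sqrt n / M n) \<and> ((2 * B + 1)\<^sup>2 :: nat) \<le> L) \<or> (nat (M n))\<^sup>2 \<le> L"
      using gc(4)
    proof
      assume "r n \<le> real (nat (2 * \<rho>)) * (sqrt n / M n)"
      then show ?thesis unfolding L_def by (intro disjI1 exI[of _ "nat (2 * \<rho>)"]) simp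
    next
      assume "real_of_int (M n) \<le> \<rho> / c + 1"
      then have "M n \<le> \<lceil>\<rho> / c + 1\<rceil>" by linarith
      then have "(nat (M n))\<^sup>2 \<le> (nat \<lceil>\<rho> / c + 1\<rceil>)\<^sup>2" by (intro power_mono nat_mono) auto
      then have "(nat (M n))\<^sup>2 \<le> L" unfolding L_def by (rule max.coboundedI2)
      then show ?thesis by blast
    qed
    ultimately interpret rgg_params n "M n" \<rho> "a n" \<theta> K "r n" H L
      using n rho gc th K elim by unfold_locales (auto simp: a_def)
    have J0: "0 \<le> 1 - z + \<theta> * ln z" using I by simp
    note gp = good_prob[OF z J0]
    have "err z \<le> err' n"
    proof -
      have "(1 + \<epsilon>) / 4 * ln n \<le> (\<alpha> * J * Q) * ln n" using alJQ ln1 by (intro mult_right_mono) auto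
      also have "\<dots> = (\<alpha> * ln n) * (J * Q)" by (simp add: mult_ac)
      also have "\<dots> \<le> a n * (J * Q)" using aln I by (intro mult_right_mono) (auto simp: J_def Q_def)
      finally have be: "exp (- (a n * J * Q)) \<le> b n" by (simp add: b_def mult.assoc)
      have 1: "grid_sum (M n) \<rho> (exp (- (a n * J * Q))) \<le>
          n * b n ^ 4 + 4 * real_of_int (reach \<rho>) * sqrt n * (b n)\<^sup>2 + 4 * (real_of_int (reach \<rho>))\<^sup>2 * b n"
        by (rule grid_sum_mono) (use be Rp gc(5) Mn in auto)
      have "a n * (exp 1 - 1 - K) \<le> - 2 * ln n"
      proof -
        have "a n * (exp 1 - 1 - K) = - (2 / \<alpha>) * a n" by (simp add: K_def)
        also have "\<dots> \<le> - (2 / \<alpha>) * (\<alpha> * ln n)"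
          using aln al by (intro mult_left_mono_neg) auto
        finally show ?thesis using al by simp
      qed
      then have "exp (a n * (exp 1 - 1 - K)) \<le> exp (- 2 * ln n)" by simp
      also have "exp (- 2 * ln n) = 1 / (real n)\<^sup>2"
      proof -
        have "exp (- 2 * ln n) = exp (- ln n) * exp (- ln n)" by (simp add: mult_exp_exp)
        then show ?thesis using n by (simp add: exp_minus power2_eq_square divide_inverse)
      qed
      finally have "(real_of_int (M n))\<^sup>2 * exp (a n * (exp 1 - 1 - K)) \<le> n * (1 / (real n)\<^sup>2)"
        using Msq by (intro mult_mono) auto
      then have 2: "(real_of_int (M n))\<^sup>2 * exp (a n * (exp 1 - 1 - K)) \<le> 1 / n"
        using n by (simp add: power2_eq_square)
      have 3: "2 ^ W * grid_sum (M n) \<rho> (exp (- (a n * J * Q))) \<le>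
          2 ^ W * (n * b n ^ 4 + 4 * real_of_int (reach \<rho>) * sqrt n * (b n)\<^sup>2 + 4 * (real_of_int (reach \<rho>))\<^sup>2 * b n)"
        using 1 by (intro mult_left_mono) auto
      show ?thesis using 2 3 unfolding err_def err'_def J_def Q_def W_def of_int_power by linarith
    qed
    then have "1 - err' n \<le> measure (PPP2 n) {\<omega> \<in> space (PPP2 n). good \<omega>}" using gp(2) by linarith
    also have "\<dots> \<le> measure (PPP2 n) (S n)"
    proof -
      have [measurable]: "rgg_cover_time (r n) \<in> borel_measurable (PPP2 n)"
        by (rule cover_time_measurable[OF n])
      interpret PP: poisson_process "uniform_measure lborel (Lambda2 n)" "real n"
        by (rule PPP2_poisson_process[OF n])
      interpret prob_space "PPP2 n" unfolding PPP2_proc[OF n] by (rule PP.procP.prob_space_axioms)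
      show ?thesis
      proof (rule finite_measure_mono)
        show "{\<omega> \<in> space (PPP2 n). good \<omega>} \<subseteq> S n"
          unfolding S_def
        proof safe
          fix N x assume g: "good (N, x)"
          have ok: "cover_ok C N (rgg_cover_time (r n) (N, x))"
            using good_cover[OF g] by (simp add: C_def)
          have N: "\<theta> * n < N" using g by (simp add: good_def)
          have NK: "N \<le> K * n" using good_vertices[OF g] by simp
          have tn: "0 < \<theta> * n" using th n by simp
          have N0: "0 < real N" using N tn by linarith
          have "\<theta> / 16 * n * ln n \<le> low n" using elim by simp
          also have "low n \<le> N / 8 * (ln (N / (8 * C + 2)) - 1)"
            unfolding low_def
          proof (rule mult_mono)
            have "ln (\<theta> * n / (8 * C + 2)) \<le> ln (N / (8 * C + 2))"
              using tn N C2 by (intro ln_mono divide_right_mono divide_pos_pos) auto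
            then show "ln (\<theta> * n / (8 * C + 2)) - 1 \<le> ln (N / (8 * C + 2)) - 1" by simp
            show "0 \<le> ln (\<theta> * n / (8 * C + 2)) - 1" using elim by simp
          qed (use N N0 in auto)
          finally show "ennreal (\<theta> / 16 * real n * ln (real n)) \<le> rgg_cover_time (r n) (N, x)"
            using ok unfolding cover_ok_def by (meson ennreal_leI order_trans)
          have "harm N \<le> 1 + ln (real N)" using N0 by (intro harm_le_ln) auto
          also have "ln (real N) \<le> ln (K * n)" using N0 NK by (intro ln_mono) auto
          also have "1 + ln (K * n) \<le> 2 * ln n" using elim by simp
          finally have hN: "harm N \<le> 2 * ln (real n)" by simp
          have "C * N * harm N \<le> C * (K * n) * (2 * ln n)"
            using NK hN C0 N0 harm_nonneg[of N] by (intro mult_mono mult_left_mono) auto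
          also have "\<dots> \<le> (2 * C * K + 1) * n * ln n"
            using ln1 by (simp add: algebra_simps)
          finally show "rgg_cover_time (r n) (N, x) \<le> ennreal ((2 * C * K + 1) * real n * ln (real n))"
            using ok unfolding cover_ok_def by (meson ennreal_leI order_trans)
        qed
        show "S n \<in> sets (PPP2 n)" unfolding S_def by measurable
      qed
    qed
    finally show ?case .
  qed
  have e0: "(\<lambda>n. 1 - err' n) \<longlonglongrightarrow> 1 - 0"
  proof (intro tendsto_diff tendsto_const)
    have "(\<lambda>n::nat. n * b n ^ 4) \<longlonglongrightarrow> 0" unfolding b_def using assms(1) by real_asymp
    moreover have "(\<lambda>n::nat. 4 * real_of_int (reach \<rho>) * sqrt n * (b n)\<^sup>2) \<longlonglongrightarrow> 0"
      unfolding b_def mult.assoc using assms(1) by (intro tendsto_mult_right_zero) real_asymp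
    moreover have "(\<lambda>n::nat. 4 * (real_of_int (reach \<rho>))\<^sup>2 * b n) \<longlonglongrightarrow> 0"
      unfolding b_def using assms(1) by (intro tendsto_mult_right_zero) real_asymp
    moreover have "(\<lambda>n::nat. exp (- (n * J))) \<longlonglongrightarrow> 0"
      using I unfolding J_def[symmetric] by real_asymp
    moreover have "(\<lambda>n::nat. 1 / n) \<longlonglongrightarrow> 0" by real_asymp
    ultimately have "err' \<longlonglongrightarrow> 0 + 2 ^ W * (0 + 0 + 0) + 0 + 0"
      unfolding err'_def by (intro tendsto_add tendsto_mult tendsto_const)
    then show "err' \<longlonglongrightarrow> 0" by simp
  qed
  have "(\<lambda>n. measure (PPP2 n) (S n)) \<longlonglongrightarrow> 1"
  proof (rule tendsto_sandwich[OF main _ _ tendsto_const])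
    show "(\<lambda>n. 1 - err' n) \<longlonglongrightarrow> 1" using e0 by simp
    show "\<forall>\<^sub>F n in sequentially. measure (PPP2 n) (S n) \<le> 1"
      using eventually_gt_at_top[of 0]
    proof eventually_elim
      case (elim n)
      interpret PP: poisson_process "uniform_measure lborel (Lambda2 n)" "real n"
        by (rule PPP2_poisson_process[OF elim])
      show ?case unfolding PPP2_proc[OF elim] by (rule PP.procP.prob_le_1)
    qed
  qed
  moreover have "0 < \<theta> / 16" "0 < 2 * C * K + 1" using th C0 K by (auto intro: add_nonneg_pos)
  ultimately show ?thesis unfolding S_def by blast
qed

end
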